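(* Let $0<r<1$. Then $r^{-1}\overline{\mathbb{D}}=\{z\in\mathbb{C}:|z|\le r^{-1}\}$ is a minimal spectral set for $PA_r$ and for $QA_r$.
   Context: All operators are bounded linear maps on complex Hilbert spaces. $PA_r=\{T: T\text{ is invertible and } (r^2+r^{-2})I-T^*T-T^{-*}T^{-1}\ge0\}$, where $T^{-*}=(T^{-1})^*$, and $QA_r=\{T: T\text{ is invertible and }\|T\|\le r^{-1},\ \|T^{-1}\|\le r^{-1}\}$. For compact $X\subset\mathbb{C}$, $Rat(X)$ is the algebra of rational functions with poles off $X$; $X$ is a spectral set for an operator $T$ if $\sigma(T)\subseteq X$ and $\|f(T)\|\le\sup_{\xi\in X}|f(\xi)|$ for all $f\in Rat(X)$. A compact set $X$ is a minimal spectral set for a class $\mathcal{T}$ of operators if $X$ is a spectral set for every member of $\mathcal{T}$ and for every proper compact subset $X'$ of $X$ there is $T\in\mathcal{T}$ such that $X'$ is not a spectral set for $T$. *)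

theory Defs
  imports
    Complex_Main
    "HOL-Library.Equipollence"
    "HOL-Library.Nonpos_Ints"
    "HOL-Computational_Algebra.Polynomial"
    "HOL-Algebra.Module"
begin

section \<open>Complex Hilbert spaces\<close>

text \<open>
  The statement is about the class of operators on all complex Hilbert spaces, so a
  Hilbert space is an object (a structure with an explicit carrier) and not a type. The inner product
  is linear in its first argument. Following HOL-Algebra, a structure may behave arbitrarily
  outside its carrier, and the ring multiplication and unit contained in the record
  \<^typ>\<open>('r, 'a) module\<close> play no role.
\<close>

definition complex_ring :: "complex ring" where
  "complex_ring = \<lparr>carrier = UNIV, monoid.mult = (*), one = 1, ring.zero = 0, add = (+)\<rparr>"

record 'a hilbert = "(complex, 'a) Module.module" +
  iprod :: "'a \<Rightarrow> 'a \<Rightarrow> complex"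

definition vnorm :: "('a, 'm) hilbert_scheme \<Rightarrow> 'a \<Rightarrow> real" where
  "vnorm H x = sqrt (Re (iprod H x x))"

locale complex_hilbert_space = Module.module complex_ring H
  for H :: "('a, 'm) hilbert_scheme" (structure) +
  assumes iprod_add_left:
      "\<lbrakk>x \<in> carrier H; y \<in> carrier H; z \<in> carrier H\<rbrakk>
        \<Longrightarrow> iprod H (x \<oplus> y) z = iprod H x z + iprod H y z"
    and iprod_smult_left:
      "\<lbrakk>x \<in> carrier H; y \<in> carrier H\<rbrakk> \<Longrightarrow> iprod H (a \<odot> x) y = a * iprod H x y"
    and iprod_commute:
      "\<lbrakk>x \<in> carrier H; y \<in> carrier H\<rbrakk> \<Longrightarrow> iprod H y x = cnj (iprod H x y)"
    and iprod_nonneg: "x \<in> carrier H \<Longrightarrow> iprod H x x \<in> \<real>\<^sub>\<ge>\<^sub>0"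
    and iprod_definite: "\<lbrakk>x \<in> carrier H; iprod H x x = 0\<rbrakk> \<Longrightarrow> x = \<zero>"
    and complete:
      "\<lbrakk>\<And>n. s n \<in> carrier H;
        \<And>e. e > 0 \<Longrightarrow> \<exists>N::nat. \<forall>m\<ge>N. \<forall>n\<ge>N. vnorm H (s m \<ominus> s n) < e\<rbrakk>
        \<Longrightarrow> \<exists>l\<in>carrier H. (\<lambda>n. vnorm H (s n \<ominus> l)) \<longlonglongrightarrow> 0"

section \<open>Bounded operators\<close>

definition bounded_operator :: "'a hilbert \<Rightarrow> ('a \<Rightarrow> 'a) \<Rightarrow> bool" where
  "bounded_operator H T \<longleftrightarrow>
     T \<in> carrier H \<rightarrow> carrier H \<and>
     (\<forall>x\<in>carrier H. \<forall>y\<in>carrier H. T (x \<oplus>\<^bsub>H\<^esub> y) = T x \<oplus>\<^bsub>H\<^esub> T y) \<and>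
     (\<forall>a. \<forall>x\<in>carrier H. T (a \<odot>\<^bsub>H\<^esub> x) = a \<odot>\<^bsub>H\<^esub> T x) \<and>
     (\<exists>C. \<forall>x\<in>carrier H. vnorm H (T x) \<le> C * vnorm H x)"

definition op_norm :: "'a hilbert \<Rightarrow> ('a \<Rightarrow> 'a) \<Rightarrow> real" where
  "op_norm H T = (SUP x\<in>{x \<in> carrier H. vnorm H x \<le> 1}. vnorm H (T x))"

definition op_inv :: "'a hilbert \<Rightarrow> ('a \<Rightarrow> 'a) \<Rightarrow> 'a \<Rightarrow> 'a" where
  "op_inv H T = inv_into (carrier H) T"

definition invertible_operator :: "'a hilbert \<Rightarrow> ('a \<Rightarrow> 'a) \<Rightarrow> bool" where
  "invertible_operator H T \<longleftrightarrow>
     bounded_operator H T \<and> bij_betw T (carrier H) (carrier H) \<and> bounded_operator H (op_inv H T)"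

text \<open>For a bounded operator the adjoint exists and is unique on the carrier.\<close>

definition adjoint_op :: "'a hilbert \<Rightarrow> ('a \<Rightarrow> 'a) \<Rightarrow> 'a \<Rightarrow> 'a" where
  "adjoint_op H T = (SOME S. bounded_operator H S \<and>
     (\<forall>x\<in>carrier H. \<forall>y\<in>carrier H. iprod H (T x) y = iprod H x (S y)))"

definition positive_operator :: "'a hilbert \<Rightarrow> ('a \<Rightarrow> 'a) \<Rightarrow> bool" where
  "positive_operator H A \<longleftrightarrow>
     bounded_operator H A \<and> (\<forall>x\<in>carrier H. iprod H (A x) x \<in> \<real>\<^sub>\<ge>\<^sub>0)"

definition spectrum :: "'a hilbert \<Rightarrow> ('a \<Rightarrow> 'a) \<Rightarrow> complex set" where
  "spectrum H T = {z. \<not> invertible_operator H (\<lambda>x. z \<odot>\<^bsub>H\<^esub> x \<ominus>\<^bsub>H\<^esub> T x)}"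

section \<open>Rational functional calculus and spectral sets\<close>

text \<open>
  A rational function is represented by a pair of numerator and denominator. Having poles off
  \<open>X\<close> means having a representation whose denominator does not vanish on \<open>X\<close>. If the spectrum
  of \<open>T\<close> is contained in \<open>X\<close>, then the denominator evaluated at \<open>T\<close> is invertible.
\<close>

definition Rat :: "complex set \<Rightarrow> (complex poly \<times> complex poly) set" where
  "Rat X = {(p, q). q \<noteq> 0 \<and> (\<forall>z\<in>X. poly q z \<noteq> 0)}"

definition rat_eval :: "complex poly \<times> complex poly \<Rightarrow> complex \<Rightarrow> complex" where
  "rat_eval f z = poly (fst f) z / poly (snd f) z"

definition poly_op :: "'a hilbert \<Rightarrow> complex poly \<Rightarrow> ('a \<Rightarrow> 'a) \<Rightarrow> 'a \<Rightarrow> 'a" where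
  "poly_op H p T x = (\<Oplus>\<^bsub>H\<^esub>i\<in>{..degree p}. coeff p i \<odot>\<^bsub>H\<^esub> (T ^^ i) x)"

definition rat_op :: "'a hilbert \<Rightarrow> complex poly \<times> complex poly \<Rightarrow> ('a \<Rightarrow> 'a) \<Rightarrow> 'a \<Rightarrow> 'a" where
  "rat_op H f T x = poly_op H (fst f) T (op_inv H (poly_op H (snd f) T) x)"

definition spectral_set :: "complex set \<Rightarrow> 'a hilbert \<Rightarrow> ('a \<Rightarrow> 'a) \<Rightarrow> bool" where
  "spectral_set X H T \<longleftrightarrow>
     spectrum H T \<subseteq> X \<and>
     (\<forall>f\<in>Rat X. op_norm H (rat_op H f T) \<le> (SUP z\<in>X. cmod (rat_eval f z)))"

text \<open>
  A class of operators consists of pairs of a Hilbert space and an operator on it; the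
  carriers of the spaces are subsets of the type \<^typ>\<open>'a\<close>, which serves as a universe. Statements
  about the class of all Hilbert spaces are polymorphic in this type. Those asserting the
  existence of an operator need it to be large enough: with at least continuum many elements it
  contains an isomorphic copy of every separable Hilbert space.
\<close>

definition minimal_spectral_set :: "complex set \<Rightarrow> ('a hilbert \<times> ('a \<Rightarrow> 'a)) set \<Rightarrow> bool" where
  "minimal_spectral_set X \<T> \<longleftrightarrow>
     compact X \<and>
     (\<forall>(H, T)\<in>\<T>. spectral_set X H T) \<and>
     (\<forall>X'. compact X' \<and> X' \<subset> X \<longrightarrow> (\<exists>(H, T)\<in>\<T>. \<not> spectral_set X' H T))"

section \<open>The two classes of operators\<close>

definition PA :: "real \<Rightarrow> ('a hilbert \<times> ('a \<Rightarrow> 'a)) set" where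
  "PA r = {(H, T). complex_hilbert_space H \<and> invertible_operator H T \<and>
     positive_operator H (\<lambda>x.
       complex_of_real (r\<^sup>2 + 1 / r\<^sup>2) \<odot>\<^bsub>H\<^esub> x
         \<ominus>\<^bsub>H\<^esub> adjoint_op H T (T x)
         \<ominus>\<^bsub>H\<^esub> adjoint_op H (op_inv H T) (op_inv H T x))}"

definition QA :: "real \<Rightarrow> ('a hilbert \<times> ('a \<Rightarrow> 'a)) set" where
  "QA r = {(H, T). complex_hilbert_space H \<and> invertible_operator H T \<and>
     op_norm H T \<le> 1 / r \<and> op_norm H (op_inv H T) \<le> 1 / r}"

end

theory Submission
  imports
    Defs
    "HOL-Analysis.Analysis"
    "HOL-Computational_Algebra.Fundamental_Theorem_Algebra"
begin

text \<open>
  Write \<open>R = 1 / r\<close>. Every member \<open>T\<close> of either class satisfies \<open>\<parallel>T\<parallel> \<le> R\<close>, so the disc is a spectral set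
  by von Neumann's inequality. For a fixed vector \<open>y\<close> put \<open>B(p, q) = \<langle>p(T) y, q(T) y\<rangle>\<close>, a form on
  polynomials with \<open>B(z p, z p) \<le> R\<^sup>2 B(p, p)\<close>. For \<open>\<sigma> > R\<close> the defect form
  \<open>B(p, q) - B(z p, z q) / \<sigma>\<^sup>2\<close> is positive, its values on \<open>z\<^sup>n q / \<sigma>\<^sup>n\<close> telescope, and Parseval's identity
  for the discrete Fourier transform bounds multiplication by \<open>p\<close> by its supremum on \<open>|z| = \<sigma>\<close>.
  Rational functions are reduced to polynomials by approximating \<open>1 / q\<close>.

  For minimality take the bilateral shift \<open>T\<close> on the sequences over the integers with weight
  \<open>r\<close> to the power \<open>2 |n|\<close>. It lies in both classes and has every \<open>w\<close> with \<open>r < |w| < R\<close> as an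
  eigenvalue, so a smaller spectral set must omit some \<open>w\<close> with \<open>|w| < r\<close>. There is a rational \<open>f\<close> with
  a pole at \<open>w\<close>, modulus \<open>1\<close> on \<open>|z| = R\<close> and modulus at most \<open>1\<close> on the smaller set. Its Laurent
  coefficients \<open>a\<^sub>n\<close> in the annulus have \<open>\<Sum>\<^sub>n |a\<^sub>n|\<^sup>2 R\<^sup>2\<^sup>n = 1\<close>, whereas \<open>\<parallel>f(T)\<parallel>\<^sup>2\<close> is at least the sum of
  \<open>|a\<^sub>n|\<^sup>2\<close> times \<open>R\<close> to the power \<open>2 |n|\<close>, which is larger because the principal part of \<open>f\<close> is not zero.
\<close>

section \<open>Von Neumann's inequality for forms on polynomials\<close>

text \<open>The Fourier argument sees only finitely many powers of T; working at \<sigma> > R makes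
  what lies beyond this window decay geometrically, and \<sigma> then decreases to R. For
  minimality, coordinate 0 of f(T) x is the sum of a_n x_{-n}. As a functional of x it has squared
  norm equal to the sum of |a_n|^2 R^(2|n|), and reading off coordinate 0 costs nothing because its
  weight is 1. Compared with Parseval's sum on |z| = R the terms with n >= 0 agree and those with n
  < 0 gain; the term n = -1, the residue c of f at w, already gains |c|^2 (r^-2 - r^2). Two
  approximations intervene. The modulus of f is controlled only up to \<epsilon>, so |c| needs a
  lower bound \<kappa> (1 - \<epsilon>) with \<kappa> fixed before \<epsilon>. And the Laurent
  series is cut off at z^-L, so that f becomes a polynomial h divided by z^L; the remainder c w^L /
  (z^L (z - w)) must be negligible both on the circle and at T. At T the factor z^-L can cost r^-L,
  which is where |w| < r enters.\<close>

definition root_unity :: "nat \<Rightarrow> int \<Rightarrow> complex" where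
  "root_unity N k = cis (2 * pi * of_int k / of_nat N)"

lemma root_unity_add: "root_unity N (a + b) = root_unity N a * root_unity N b"
  by (simp add: root_unity_def cis_mult add_divide_distrib ring_distribs)

lemma root_unity_0 [simp]: "root_unity N 0 = 1"
  by (simp add: root_unity_def)

lemma norm_root_unity [simp]: "cmod (root_unity N k) = 1"
  by (simp add: root_unity_def)

lemma cnj_root_unity: "cnj (root_unity N k) = root_unity N (- k)"
  by (simp add: root_unity_def cis_cnj)

lemma root_unity_mult_nat: "root_unity N (k * int j) = root_unity N k ^ j"
  by (simp add: root_unity_def Complex.DeMoivre algebra_simps)

lemma root_unity_eq_1_iff:
  assumes "N > 0"
  shows "root_unity N k = 1 \<longleftrightarrow> int N dvd k"
proof
  assume "root_unity N k = 1"
  then have "cos (2 * pi * of_int k / of_nat N) = 1"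
    by (simp add: root_unity_def complex_eq_iff)
  then obtain m :: int where "2 * pi * of_int k / of_nat N = of_int m * 2 * pi"
    using cos_one_2pi_int by (metis mult.assoc)
  then have "of_int k = (of_int m * of_nat N :: real)"
    using assms by (simp add: field_simps)
  then have "k = m * int N"
    by (metis of_int_eq_iff of_int_mult of_int_of_nat_eq)
  then show "int N dvd k" by simp
next
  assume "int N dvd k"
  then obtain m where "k = int N * m" by blast
  then have "2 * pi * of_int k / of_nat N = 2 * pi * of_int m"
    using assms by simp
  then show "root_unity N k = 1"
    unfolding root_unity_def by (metis cis_multiple_2pi Ints_of_int)
qed

lemma sum_root_unity:
  assumes "N > 0"
  shows "(\<Sum>n<N. root_unity N (m * int n)) = (if int N dvd m then of_nat N else 0)"
proof (cases "int N dvd m")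
  case True
  then have "root_unity N m = 1" using root_unity_eq_1_iff[OF assms] by simp
  then show ?thesis using True by (simp add: root_unity_mult_nat)
next
  case False
  then have "root_unity N m \<noteq> 1" using root_unity_eq_1_iff[OF assms] by simp
  moreover have "root_unity N m ^ N = 1"
    using root_unity_eq_1_iff[OF assms, of "m * int N"] by (simp add: root_unity_mult_nat)
  ultimately show ?thesis using False
    by (simp add: root_unity_mult_nat geometric_sum)
qed

lemma sum_root_unity_diff:
  assumes "k < N" "l < N"
  shows "(\<Sum>n<N. root_unity N ((int k - int l) * int n)) = (if k = l then of_nat N else 0)"
proof -
  have "int N dvd int k - int l \<longleftrightarrow> k = l"
    using assms by (auto simp flip: mod_eq_dvd_iff)
  then show ?thesis using sum_root_unity[of N "int k - int l"] assms by auto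
qed

lemma monom_mult_monom_1: "monom 1 n * monom c j = Polynomial.smult (c::complex) (monom 1 (n + j))"
  by (simp add: mult_monom smult_monom)

lemma smult_sum_right: "Polynomial.smult c (\<Sum>k\<in>S. f k) = (\<Sum>k\<in>S. Polynomial.smult c (f k))"
  by (induction S rule: infinite_finite_induct) (auto simp: smult_add_right)

text \<open>Not assumed definite: in the application \<open>B p p\<close> vanishes whenever p(T)
  annihilates the vector y. The locale covers the form itself, its defect and, in
  \<open>Parseval_lower_bound\<close>, products of constant coefficients, so that one proof of
  \<open>parseval\<close> serves operators and scalars.\<close>

locale hermitian_form =
  fixes B :: "complex poly \<Rightarrow> complex poly \<Rightarrow> complex"
  assumes add_left: "B (p + q) u = B p u + B q u"
    and smult_left: "B (Polynomial.smult a p) u = a * B p u"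
    and commute: "B q p = cnj (B p q)"
    and nonneg: "Re (B p p) \<ge> 0"
begin

lemma zero_left: "B 0 u = 0"
  using smult_left[of 0 0 u] by simp

lemma sum_left: "B (\<Sum>k\<in>S. f k) u = (\<Sum>k\<in>S. B (f k) u)"
  by (induction S rule: infinite_finite_induct) (auto simp: zero_left add_left)

lemma sum_right: "B u (\<Sum>k\<in>S. f k) = (\<Sum>k\<in>S. B u (f k))"
  by (subst commute, subst sum_left, subst cnj_sum) (simp add: commute[of u])

lemma smult_right: "B u (Polynomial.smult a p) = cnj a * B u p"
  by (subst commute, subst smult_left) (simp add: commute[of u])

lemma smult_both: "B (Polynomial.smult a p) (Polynomial.smult a p) = of_real ((cmod a)\<^sup>2) * B p p"
  by (simp add: smult_left smult_right complex_norm_square mult_ac del: of_real_power)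

text \<open>Summing over the frequency \<open>n\<close> first leaves only the diagonal
  \<open>k = l\<close>, by orthogonality of the characters. The transform is not normalised, hence
  the factor \<open>N\<close>.\<close>

lemma parseval:
  assumes "N > 0"
  shows "(\<Sum>n<N. B (\<Sum>k<N. Polynomial.smult (root_unity N (int k * int n)) (x k))
                  (\<Sum>k<N. Polynomial.smult (root_unity N (int k * int n)) (x k)))
       = of_nat N * (\<Sum>k<N. B (x k) (x k))"
proof -
  have "(\<Sum>n<N. B (\<Sum>k<N. Polynomial.smult (root_unity N (int k * int n)) (x k))
                  (\<Sum>k<N. Polynomial.smult (root_unity N (int k * int n)) (x k)))
     = (\<Sum>n<N. \<Sum>k<N. \<Sum>l<N. B (x k) (x l) * root_unity N ((int k - int l) * int n))"
  proof (intro sum.cong refl)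
    fix n
    have "root_unity N ((int k - int l) * int n) = root_unity N (int k * int n) * root_unity N (- (int l * int n))" for k l
      by (simp add: left_diff_distrib flip: root_unity_add)
    then show "B (\<Sum>k<N. Polynomial.smult (root_unity N (int k * int n)) (x k))
                  (\<Sum>k<N. Polynomial.smult (root_unity N (int k * int n)) (x k))
      = (\<Sum>k<N. \<Sum>l<N. B (x k) (x l) * root_unity N ((int k - int l) * int n))"
      by (simp only: sum_left)
        (simp add: sum_right smult_left smult_right cnj_root_unity sum_distrib_left mult_ac)
  qed
  also have "\<dots> = (\<Sum>k<N. \<Sum>l<N. \<Sum>n<N. B (x k) (x l) * root_unity N ((int k - int l) * int n))"
    by (subst sum.swap, rule sum.cong[OF refl], rule sum.swap)
  also have "\<dots> = (\<Sum>k<N. \<Sum>l<N. B (x k) (x l) * (if k = l then of_nat N else 0))"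
    by (intro sum.cong refl) (simp add: sum_root_unity_diff flip: sum_distrib_left)
  also have "\<dots> = (\<Sum>k<N. B (x k) (x k) * of_nat N)"
    by (intro sum.cong refl) (simp add: if_distrib cong: if_cong)
  finally show ?thesis by (simp add: sum_distrib_left mult.commute)
qed

end

locale poly_form = hermitian_form +
  fixes R :: real
  assumes R_pos: "R > 0"
    and shift_le: "Re (B (pCons 0 p) (pCons 0 p)) \<le> R\<^sup>2 * Re (B p p)"
begin

text \<open>Polarised form of |u|^2 - |T u|^2 / \<sigma>^2, the defect of the contraction T /
  \<sigma>, with multiplication by z standing for T.\<close>

definition defect :: "real \<Rightarrow> complex poly \<Rightarrow> complex poly \<Rightarrow> complex" where
  "defect \<sigma> p u = B p u - B (pCons 0 p) (pCons 0 u) / of_real (\<sigma>\<^sup>2)"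

definition shift_norm :: "real \<Rightarrow> complex poly \<Rightarrow> nat \<Rightarrow> real" where
  "shift_norm \<sigma> q n = Re (B (monom 1 n * q) (monom 1 n * q)) / \<sigma> ^ (2 * n)"

lemma hermitian_form_defect:
  assumes "\<sigma> > R"
  shows "hermitian_form (defect \<sigma>)"
proof
  fix p q u :: "complex poly" and a :: complex
  have "pCons 0 (p + q) = pCons 0 p + pCons 0 q" by simp
  then show "defect \<sigma> (p + q) u = defect \<sigma> p u + defect \<sigma> q u"
    by (simp only: defect_def add_left add_divide_distrib) simp
  have "pCons 0 (Polynomial.smult a p) = Polynomial.smult a (pCons 0 p)" by simp
  then show "defect \<sigma> (Polynomial.smult a p) u = a * defect \<sigma> p u"
    by (simp only: defect_def smult_left) (simp add: algebra_simps)
  show "defect \<sigma> q p = cnj (defect \<sigma> p q)"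
    by (simp add: defect_def commute[of q p] commute[of "pCons 0 q" "pCons 0 p"])
  have "Re (B (pCons 0 p) (pCons 0 p)) \<le> R\<^sup>2 * Re (B p p)" by (rule shift_le)
  also have "\<dots> \<le> \<sigma>\<^sup>2 * Re (B p p)"
    using assms R_pos nonneg by (intro mult_right_mono power_mono) auto
  finally show "Re (defect \<sigma> p p) \<ge> 0"
    using assms R_pos by (simp add: defect_def Re_divide_of_real field_simps flip: of_real_power)
qed

lemma shift_norm_0 [simp]: "shift_norm \<sigma> q 0 = Re (B q q)"
  by (simp add: shift_norm_def one_poly_def flip: one_poly_def)

lemma shift_norm_nonneg: "\<sigma> > 0 \<Longrightarrow> shift_norm \<sigma> q n \<ge> 0"
  by (simp add: shift_norm_def nonneg)

lemma monom_Suc_mult: "monom 1 (Suc n) * q = pCons 0 (monom 1 n * q)"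
  by (simp add: monom_Suc)

text \<open>Iterates \<open>shift_le\<close>. For \<sigma> > R the bound tends to 0 as
  \<open>n\<close> grows, which is what a radius larger than R is needed for.\<close>

lemma shift_norm_le:
  assumes "\<sigma> > 0"
  shows "shift_norm \<sigma> q n \<le> ((R / \<sigma>)\<^sup>2) ^ n * Re (B q q)"
proof (induction n)
  case (Suc n)
  have "shift_norm \<sigma> q (Suc n) \<le> (R / \<sigma>)\<^sup>2 * shift_norm \<sigma> q n"
    using shift_le[of "monom 1 n * q"] assms unfolding shift_norm_def monom_Suc_mult
    by (simp add: field_simps power2_eq_square)
  also have "\<dots> \<le> (R / \<sigma>)\<^sup>2 * (((R / \<sigma>)\<^sup>2) ^ n * Re (B q q))"
    by (intro mult_left_mono Suc) simp
  finally show ?case by (simp add: mult.assoc)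
qed simp

lemma Re_defect_shift:
  assumes "\<sigma> > R"
  shows "Re (defect \<sigma> (Polynomial.smult (of_real (1 / \<sigma> ^ n)) (monom 1 n * q))
                     (Polynomial.smult (of_real (1 / \<sigma> ^ n)) (monom 1 n * q)))
       = shift_norm \<sigma> q n - shift_norm \<sigma> q (Suc n)"
proof -
  interpret D: hermitian_form "defect \<sigma>" by (rule hermitian_form_defect[OF assms])
  have "Re (defect \<sigma> (Polynomial.smult (of_real (1 / \<sigma> ^ n)) (monom 1 n * q))
                     (Polynomial.smult (of_real (1 / \<sigma> ^ n)) (monom 1 n * q)))
      = (1 / \<sigma> ^ n)\<^sup>2 * Re (defect \<sigma> (monom 1 n * q) (monom 1 n * q))"
    using assms R_pos by (subst D.smult_both) (simp add: norm_divide norm_power power_divide)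
  also have "\<dots> = shift_norm \<sigma> q n - shift_norm \<sigma> q (Suc n)"
    unfolding shift_norm_def defect_def monom_Suc_mult using assms R_pos
    by (simp add: Re_divide_of_real field_simps power_mult power2_eq_square flip: of_real_power)
  finally show ?thesis .
qed

text \<open>Regard the vectors z^n q / \<sigma>^n with n < N as a signal with transform
  \<open>x\<close>. Multiplying by \<open>p\<close> is a convolution of this signal: z^n p q /
  \<sigma>^n is the sum over j of \<open>coeff p j\<close> times \<sigma>^j times the entry with
  index n + j. On the transform side it becomes multiplication by the values of \<open>p\<close> at
  N points of the circle of radius \<sigma>, each of modulus at most \<open>M\<close>. Telescoping
  defects convert both ends back to \<open>B\<close>.\<close>

lemma strict_von_Neumann:
  assumes \<sigma>: "\<sigma> > R"
    and M: "\<And>z. cmod z = \<sigma> \<Longrightarrow> cmod (poly p z) \<le> M"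
  shows "Re (B (p * q) (p * q)) \<le> M\<^sup>2 * Re (B q q)"
proof -
  interpret D: hermitian_form "defect \<sigma>" by (rule hermitian_form_defect[OF \<sigma>])
  have \<sigma>0: "\<sigma> > 0" using \<sigma> R_pos by simp
  define d where "d = degree p"
  have main: "Re (B (p * q) (p * q)) * (1 - ((R / \<sigma>)\<^sup>2) ^ K) \<le> M\<^sup>2 * Re (B q q)" for K
  proof (cases "K = 0")
    case True
    then show ?thesis by (simp add: nonneg)
  next
    case False
    \<comment> \<open>The cyclic convolution wraps around only in the last \<open>d\<close> places,
      so it is the true one for \<open>n < K\<close>.\<close>
    define N where "N = d + K"
    have N: "N > 0" using False by (simp add: N_def)
    define a where "a u m = Polynomial.smult (of_real (1 / \<sigma> ^ m)) (monom 1 m * u)" for u :: "complex poly" and m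
    define x where "x k = (\<Sum>m<N. Polynomial.smult (root_unity N (- (int k * int m))) (a q m))" for k
    define z where "z k = of_real \<sigma> * root_unity N (int k)" for k
    define y where "y k = Polynomial.smult (poly p (z k)) (x k)" for k
    have inv: "(\<Sum>k<N. Polynomial.smult (root_unity N (int k * int n)) (x k)) = Polynomial.smult (of_nat N) (a q n)"
      if "n < N" for n
    proof -
      have "(\<Sum>k<N. Polynomial.smult (root_unity N (int k * int n)) (x k))
          = (\<Sum>m<N. \<Sum>k<N. Polynomial.smult (root_unity N ((int n - int m) * int k)) (a q m))"
        by (simp add: x_def smult_sum_right root_unity_add[symmetric] algebra_simps, subst sum.swap)
          (simp add: mult.commute)
      also have "\<dots> = (\<Sum>m<N. Polynomial.smult (if n = m then of_nat N else 0) (a q m))"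
        using that by (intro sum.cong refl) (simp add: sum_root_unity_diff flip: smult_sum)
      also have "\<dots> = (\<Sum>m<N. if m = n then Polynomial.smult (of_nat N) (a q m) else 0)"
        by (intro sum.cong) auto
      also have "\<dots> = Polynomial.smult (of_nat N) (a q n)" using that by simp
      finally show ?thesis .
    qed
    have conv: "(\<Sum>k<N. Polynomial.smult (root_unity N (int k * int n)) (y k)) = Polynomial.smult (of_nat N) (a (p * q) n)"
      if "n < K" for n
    proof -
      have "poly p (z k) = (\<Sum>j\<le>d. coeff p j * of_real \<sigma> ^ j * root_unity N (int k * int j))" for k
        by (simp add: poly_altdef d_def z_def power_mult_distrib root_unity_mult_nat mult.assoc)
      then have "(\<Sum>k<N. Polynomial.smult (root_unity N (int k * int n)) (y k))
          = (\<Sum>k<N. \<Sum>j\<le>d. Polynomial.smult (coeff p j * of_real \<sigma> ^ j)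
               (Polynomial.smult (root_unity N (int k * int (n + j))) (x k)))"
        by (simp add: y_def smult_sum smult_sum_right root_unity_add distrib_left mult_ac sum_distrib_left)
      also have "\<dots> = (\<Sum>j\<le>d. Polynomial.smult (coeff p j * of_real \<sigma> ^ j)
               (\<Sum>k<N. Polynomial.smult (root_unity N (int k * int (n + j))) (x k)))"
        by (subst sum.swap) (simp add: smult_sum_right)
      also have "\<dots> = (\<Sum>j\<le>d. Polynomial.smult (coeff p j * of_real \<sigma> ^ j) (Polynomial.smult (of_nat N) (a q (n + j))))"
        using that by (intro sum.cong refl, subst inv) (auto simp: N_def)
      also have "\<dots> = (\<Sum>j\<le>d. Polynomial.smult (of_nat N * of_real (1 / \<sigma> ^ n)) (monom 1 n * monom (coeff p j) j * q))"
        using \<sigma>0 by (intro sum.cong refl) (simp add: a_def power_add monom_mult_monom_1 mult.commute)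
      also have "\<dots> = Polynomial.smult (of_nat N * of_real (1 / \<sigma> ^ n)) (monom 1 n * (\<Sum>j\<le>d. monom (coeff p j) j) * q)"
        by (simp add: smult_sum_right sum_distrib_left sum_distrib_right)
      also have "\<dots> = Polynomial.smult (of_nat N) (a (p * q) n)"
        by (simp add: a_def d_def poly_as_sum_of_monoms mult.assoc)
      finally show ?thesis .
    qed
    have tele: "(\<Sum>n<L. Re (defect \<sigma> (a u n) (a u n))) = Re (B u u) - shift_norm \<sigma> u L" for u L
      unfolding a_def Re_defect_shift[OF \<sigma>] by (simp add: sum_lessThan_telescope')
    have N2: "Re (defect \<sigma> (Polynomial.smult (of_nat N) u) (Polynomial.smult (of_nat N) u)) = (real N)\<^sup>2 * Re (defect \<sigma> u u)" for u
      by (subst D.smult_both) (simp flip: of_real_power)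
    have "(real N)\<^sup>2 * (Re (B (p * q) (p * q)) - shift_norm \<sigma> (p * q) K)
        = (\<Sum>n<K. Re (defect \<sigma> (\<Sum>k<N. Polynomial.smult (root_unity N (int k * int n)) (y k))
                                (\<Sum>k<N. Polynomial.smult (root_unity N (int k * int n)) (y k))))"
      by (simp add: conv N2 flip: tele sum_distrib_left)
    \<comment> \<open>The wrapped-around entries with \<open>n \<ge> K\<close> are not multiples of
      \<open>p * q\<close> of the wanted kind, but their defects are non-negative and may be
      added.\<close>
    also have "\<dots> \<le> (\<Sum>n<N. Re (defect \<sigma> (\<Sum>k<N. Polynomial.smult (root_unity N (int k * int n)) (y k))
                                (\<Sum>k<N. Polynomial.smult (root_unity N (int k * int n)) (y k))))"
      by (intro sum_mono2) (auto simp: N_def D.nonneg)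
    also have "\<dots> = real N * (\<Sum>k<N. Re (defect \<sigma> (y k) (y k)))"
      using arg_cong[OF D.parseval[OF N, of y], of Re] by simp
    also have "\<dots> \<le> real N * (\<Sum>k<N. M\<^sup>2 * Re (defect \<sigma> (x k) (x k)))"
    proof (intro mult_left_mono sum_mono)
      fix k
      have "cmod (z k) = \<sigma>" using \<sigma>0 by (simp add: z_def norm_mult)
      then have "(cmod (poly p (z k)))\<^sup>2 \<le> M\<^sup>2" by (intro power_mono M) auto
      then show "Re (defect \<sigma> (y k) (y k)) \<le> M\<^sup>2 * Re (defect \<sigma> (x k) (x k))"
        unfolding y_def D.smult_both
        by (simp add: mult_right_mono D.nonneg flip: of_real_power)
    qed simp
    also have "\<dots> = M\<^sup>2 * (real N * (\<Sum>k<N. Re (defect \<sigma> (x k) (x k))))"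
      by (simp add: sum_distrib_left mult_ac)
    also have "real N * (\<Sum>k<N. Re (defect \<sigma> (x k) (x k)))
        = (\<Sum>n<N. Re (defect \<sigma> (\<Sum>k<N. Polynomial.smult (root_unity N (int k * int n)) (x k))
                                (\<Sum>k<N. Polynomial.smult (root_unity N (int k * int n)) (x k))))"
      using arg_cong[OF D.parseval[OF N, of x], of Re] by simp
    also have "\<dots> = (real N)\<^sup>2 * (Re (B q q) - shift_norm \<sigma> q N)"
      by (simp add: inv N2 flip: tele sum_distrib_left)
    finally have "Re (B (p * q) (p * q)) - shift_norm \<sigma> (p * q) K \<le> M\<^sup>2 * (Re (B q q) - shift_norm \<sigma> q N)"
      using N by (simp add: mult.left_commute[of "M\<^sup>2"])
    also have "\<dots> \<le> M\<^sup>2 * Re (B q q)"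
      using shift_norm_nonneg[OF \<sigma>0] by (intro mult_left_mono) auto
    finally show ?thesis
      using shift_norm_le[OF \<sigma>0, of "p * q" K] by (simp add: algebra_simps)
  qed
  have "\<bar>R / \<sigma>\<bar> < 1" using \<sigma> R_pos by simp
  then have "(R / \<sigma>)\<^sup>2 < 1" by (simp only: abs_square_less_1)
  then have "(\<lambda>K. Re (B (p * q) (p * q)) * (1 - ((R / \<sigma>)\<^sup>2) ^ K))
      \<longlonglongrightarrow> Re (B (p * q) (p * q)) * (1 - 0)"
    by (intro tendsto_intros LIMSEQ_power_zero) auto
  then show ?thesis
    using LIMSEQ_le_const2 main by fastforce
qed

text \<open>Here \<open>M\<close> bounds \<open>p\<close> on |z| <= R only, so a point of the circle
  of radius \<sigma> is compared with its radial projection to |z| = R. The error is at most the sum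
  in \<open>h\<close>, which vanishes as \<sigma> decreases to R.\<close>

theorem von_Neumann_poly:
  assumes M: "\<And>z. cmod z \<le> R \<Longrightarrow> cmod (poly p z) \<le> M"
  shows "Re (B (p * q) (p * q)) \<le> M\<^sup>2 * Re (B q q)"
proof -
  define h where "h \<sigma> = (M + (\<Sum>j\<le>degree p. cmod (coeff p j) * (\<sigma> ^ j - R ^ j)))\<^sup>2 * Re (B q q)" for \<sigma>
  have le: "Re (B (p * q) (p * q)) \<le> h \<sigma>" if \<sigma>: "\<sigma> > R" for \<sigma>
    unfolding h_def
  proof (rule strict_von_Neumann[OF \<sigma>])
    fix z assume z: "cmod z = \<sigma>"
    define w where "w = of_real (R / \<sigma>) * z"
    have w: "cmod w = R" using z \<sigma> R_pos by (simp add: w_def norm_mult norm_divide)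
    have "cmod (z ^ j - w ^ j) = \<sigma> ^ j - R ^ j" for j
    proof -
      have "z ^ j - w ^ j = of_real (1 - (R / \<sigma>) ^ j) * z ^ j"
        by (simp only: w_def power_mult_distrib of_real_power of_real_diff of_real_1 left_diff_distrib mult_1_left)
      moreover have "(R / \<sigma>) ^ j \<le> 1" using \<sigma> R_pos by (intro power_le_one) auto
      ultimately have "cmod (z ^ j - w ^ j) = (1 - (R / \<sigma>) ^ j) * \<sigma> ^ j"
        by (simp add: norm_mult norm_power z del: of_real_diff of_real_power of_real_divide)
      then show ?thesis using \<sigma> R_pos by (simp add: left_diff_distrib power_divide)
    qed
    then have "cmod (poly p z - poly p w) \<le> (\<Sum>j\<le>degree p. cmod (coeff p j) * (\<sigma> ^ j - R ^ j))"
      unfolding poly_altdef sum_subtractf[symmetric] right_diff_distrib[symmetric]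
      by (intro order_trans[OF norm_sum] sum_mono) (simp add: norm_mult)
    then show "cmod (poly p z) \<le> M + (\<Sum>j\<le>degree p. cmod (coeff p j) * (\<sigma> ^ j - R ^ j))"
      using M[of w] w norm_triangle_sub[of "poly p z" "poly p w"] by simp
  qed
  have "isCont h R" unfolding h_def by (intro continuous_intros)
  then have "(h \<longlongrightarrow> h R) (at_right R)"
    by (simp add: isCont_def filterlim_at_split)
  then have "Re (B (p * q) (p * q)) \<le> h R"
    by (rule tendsto_lowerbound) (auto simp: eventually_at_filter le)
  then show ?thesis by (simp add: h_def)
qed

end

text \<open>Induction over the roots of \<open>q\<close>. A root a lies outside the disc, so 1 / (z
  - a) is a geometric series in z / a that converges uniformly on |z| <= R.\<close>

lemma approx_inverse_poly:
  fixes q :: "complex poly"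
  assumes "R > 0" "\<And>z. cmod z \<le> R \<Longrightarrow> poly q z \<noteq> 0" "\<epsilon> > 0"
  shows "\<exists>s. \<forall>z. cmod z \<le> R \<longrightarrow> cmod (poly s z * poly q z - 1) \<le> \<epsilon>"
  using assms(2,3)
proof (induction "degree q" arbitrary: q \<epsilon>)
  case 0
  then obtain c where c: "q = [:c:]" using degree_eq_zeroE by metis
  with 0(2)[of 0] \<open>R > 0\<close> have "c \<noteq> 0" by simp
  then show ?case using c 0 by (intro exI[of _ "[:1 / c:]"]) auto
next
  case (Suc d)
  then have "\<not> constant (poly q)" by (simp add: constant_degree)
  then obtain a where a: "poly q a = 0" using fundamental_theorem_of_algebra by blast
  with Suc(3)[of a] have aR: "cmod a > R" by force
  obtain q' where q': "q = [:- a, 1:] * q'" using a poly_eq_0_iff_dvd by blast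
  have "q' \<noteq> 0" using Suc(2) q' by auto
  then have "degree q = Suc (degree q')" unfolding q' by (subst degree_mult_eq) auto
  with Suc(2) have "d = degree q'" by simp
  moreover have "poly q' z \<noteq> 0" if "cmod z \<le> R" for z using Suc(3)[OF that] q' by simp
  \<comment> \<open>With both relative errors at most \<open>e \<le> 1\<close>, the error e1 + e2 +
    e1 e2 of the product is at most 3 e.\<close>
  moreover define e where "e = min (\<epsilon> / 3) 1"
  ultimately obtain s where s: "\<And>z. cmod z \<le> R \<Longrightarrow> cmod (poly s z * poly q' z - 1) \<le> e"
    using Suc(1)[of q' e] Suc(4) by (auto simp: e_def)
  have e: "0 < e" "e \<le> \<epsilon> / 3" "e \<le> 1" using Suc(4) by (auto simp: e_def)
  have "(\<lambda>n. (R / cmod a) ^ n) \<longlonglongrightarrow> 0"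
    using aR assms(1) order_less_trans[OF assms(1) aR]
    by (intro LIMSEQ_power_zero) (auto simp: divide_less_eq)
  then have "eventually (\<lambda>n. (R / cmod a) ^ n < e) sequentially"
    using e(1) by (rule order_tendstoD(2))
  then obtain n where n: "(R / cmod a) ^ n < e"
    by (meson eventually_sequentially order_refl)
  \<comment> \<open>Partial sum of the geometric series of 1 / (z - a).\<close>
  define t where "t = (\<Sum>j<n. monom (- 1 / a ^ Suc j) j)"
  have a0: "a \<noteq> 0" using aR assms(1) by auto
  have t: "poly t z * (z - a) = 1 - (z / a) ^ n" for z
  proof -
    have "poly t z = - 1 / a * (\<Sum>j<n. (z / a) ^ j)"
      by (simp add: t_def poly_sum poly_monom sum_distrib_left power_divide)
    then have "poly t z * (z - a) = (- 1 / a * (z - a)) * (\<Sum>j<n. (z / a) ^ j)" by simp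
    also have "- 1 / a * (z - a) = 1 - z / a" using a0 by (simp add: field_simps)
    finally have "poly t z * (z - a) = (1 - z / a) * (\<Sum>j<n. (z / a) ^ j)" .
    then show ?thesis by (simp add: one_diff_power_eq)
  qed
  show ?case
  proof (intro exI[of _ "t * s"] allI impI)
    fix z assume z: "cmod z \<le> R"
    define e1 where "e1 = - ((z / a) ^ n)"
    define e2 where "e2 = poly s z * poly q' z - 1"
    have "cmod e1 \<le> (R / cmod a) ^ n"
      using z by (auto simp: e1_def norm_power norm_divide intro!: power_mono divide_right_mono)
    then have e1: "cmod e1 \<le> e" using n by simp
    have e2: "cmod e2 \<le> e" using s[OF z] by (simp add: e2_def)
    have "poly (t * s) z * poly q z = (poly t z * (z - a)) * (poly s z * poly q' z)"
      by (simp add: q' algebra_simps)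
    also have "\<dots> = (1 + e1) * (1 + e2)" by (simp add: t e1_def e2_def)
    finally have "poly (t * s) z * poly q z - 1 = e1 + e2 + e1 * e2" by (simp add: algebra_simps)
    also have "cmod \<dots> \<le> cmod e1 + cmod e2 + cmod e1 * cmod e2"
      by (metis norm_mult norm_triangle_ineq order_trans add_right_mono)
    also have "\<dots> \<le> e + e + e * 1" using e1 e2 e by (intro add_mono mult_mono) auto
    finally show "cmod (poly (t * s) z * poly q z - 1) \<le> \<epsilon>" using e by simp
  qed
qed

section \<open>Operators on Hilbert spaces\<close>

lemma complex_ring_simps [simp]:
  "carrier complex_ring = UNIV" "monoid.mult complex_ring = (*)" "one complex_ring = 1"
  "ring.zero complex_ring = 0" "add complex_ring = (+)"
  by (simp_all add: complex_ring_def)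

section \<open>Inner product geometry and the Riesz representation theorem\<close>

locale hilbert_space = complex_hilbert_space H for H :: "'a hilbert" (structure)
begin

lemma smult_in [simp, intro]: "x \<in> carrier H \<Longrightarrow> a \<odot> x \<in> carrier H"
  by (rule smult_closed) auto

lemma smult_smult [simp]: "x \<in> carrier H \<Longrightarrow> a \<odot> (b \<odot> x) = (a * b) \<odot> x"
  using smult_assoc1[of a b x] by simp

lemma smult_add_left: "x \<in> carrier H \<Longrightarrow> (a + b) \<odot> x = a \<odot> x \<oplus> b \<odot> x"
  using smult_l_distr[of a b x] by simp

lemma smult_add_right: "x \<in> carrier H \<Longrightarrow> y \<in> carrier H \<Longrightarrow> a \<odot> (x \<oplus> y) = a \<odot> x \<oplus> a \<odot> y"
  using smult_r_distr[of a x y] by simp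

lemma smult_1 [simp]: "x \<in> carrier H \<Longrightarrow> 1 \<odot> x = x"
  using smult_one[of x] by simp

lemma smult_0_left [simp]: "x \<in> carrier H \<Longrightarrow> 0 \<odot> x = \<zero>"
  using smult_l_null[of x] by simp

lemma smult_0_right [simp]: "a \<odot> \<zero> = \<zero>"
  using smult_r_null[of a] by simp

lemma uminus_eq_smult: "x \<in> carrier H \<Longrightarrow> \<ominus> x = (-1) \<odot> x"
  using smult_add_left[of x 1 "-1"] by (simp add: minus_equality M.add.inv_equality M.a_comm)

lemma minus_eq_smult: "x \<in> carrier H \<Longrightarrow> y \<in> carrier H \<Longrightarrow> x \<ominus> y = x \<oplus> (-1) \<odot> y"
  by (simp add: a_minus_def uminus_eq_smult)

lemma iprod_zero_left [simp]: "y \<in> carrier H \<Longrightarrow> iprod H \<zero> y = 0"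
  using iprod_smult_left[of y y 0] by simp

lemma iprod_zero_right [simp]: "y \<in> carrier H \<Longrightarrow> iprod H y \<zero> = 0"
  by (subst iprod_commute) auto

lemma iprod_add_right:
  "x \<in> carrier H \<Longrightarrow> y \<in> carrier H \<Longrightarrow> z \<in> carrier H \<Longrightarrow> iprod H z (x \<oplus> y) = iprod H z x + iprod H z y"
  by (subst iprod_commute) (auto simp: iprod_add_left iprod_commute[of _ z])

lemma iprod_smult_right:
  "x \<in> carrier H \<Longrightarrow> z \<in> carrier H \<Longrightarrow> iprod H z (a \<odot> x) = cnj a * iprod H z x"
  by (subst iprod_commute) (auto simp: iprod_smult_left iprod_commute[of _ z])

lemmas iprod_simps = iprod_add_left iprod_add_right iprod_smult_left iprod_smult_right minus_eq_smult

lemma vnorm_power2: "x \<in> carrier H \<Longrightarrow> (vnorm H x)\<^sup>2 = Re (iprod H x x)"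
  using iprod_nonneg[of x] by (auto simp: vnorm_def complex_nonneg_Reals_iff)

lemma iprod_self: "x \<in> carrier H \<Longrightarrow> iprod H x x = of_real ((vnorm H x)\<^sup>2)"
  using iprod_nonneg[of x] by (auto simp: vnorm_power2 complex_eq_iff complex_nonneg_Reals_iff)

lemma vnorm_nonneg [simp]: "x \<in> carrier H \<Longrightarrow> vnorm H x \<ge> 0"
  using iprod_nonneg[of x] by (auto simp: vnorm_def complex_nonneg_Reals_iff)

lemma vnorm_zero [simp]: "vnorm H \<zero> = 0"
  by (simp add: vnorm_def)

lemma vnorm_eq_0_iff: "x \<in> carrier H \<Longrightarrow> vnorm H x = 0 \<longleftrightarrow> x = \<zero>"
  using iprod_definite[of x] iprod_self[of x] by auto

lemma vnorm_smult: "x \<in> carrier H \<Longrightarrow> vnorm H (a \<odot> x) = cmod a * vnorm H x"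
proof -
  assume x: "x \<in> carrier H"
  have "iprod H (a \<odot> x) (a \<odot> x) = (a * cnj a) * iprod H x x"
    using x by (simp add: iprod_smult_left iprod_smult_right)
  also have "\<dots> = of_real ((cmod a * vnorm H x)\<^sup>2)"
    unfolding complex_norm_square[symmetric] iprod_self[OF x] by (simp add: power_mult_distrib)
  finally show ?thesis using x by (simp add: vnorm_def[of H "a \<odot> x"])
qed

lemma vnorm_add_power2:
  assumes "x \<in> carrier H" "y \<in> carrier H"
  shows "(vnorm H (x \<oplus> y))\<^sup>2 = (vnorm H x)\<^sup>2 + 2 * Re (iprod H x y) + (vnorm H y)\<^sup>2"
  using assms by (simp add: vnorm_power2 iprod_simps iprod_commute[of x y])

lemma vnorm_minus_power2:
  assumes "x \<in> carrier H" "y \<in> carrier H"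
  shows "(vnorm H (x \<ominus> y))\<^sup>2 = (vnorm H x)\<^sup>2 - 2 * Re (iprod H x y) + (vnorm H y)\<^sup>2"
  using assms by (simp add: vnorm_power2 iprod_simps iprod_commute[of x y])

lemma vnorm_minus_commute:
  assumes "x \<in> carrier H" "y \<in> carrier H"
  shows "vnorm H (x \<ominus> y) = vnorm H (y \<ominus> x)"
proof -
  have "(vnorm H (x \<ominus> y))\<^sup>2 = (vnorm H (y \<ominus> x))\<^sup>2"
    using assms by (simp add: vnorm_minus_power2 iprod_commute[of x y])
  then show ?thesis using assms by (simp add: power2_eq_iff_nonneg)
qed

lemma Cauchy_Schwarz:
  assumes x: "x \<in> carrier H" and y: "y \<in> carrier H"
  shows "cmod (iprod H x y) \<le> vnorm H x * vnorm H y"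
proof (cases "y = \<zero>")
  case False
  then have pos: "vnorm H y > 0"
    using y vnorm_eq_0_iff[of y] vnorm_nonneg[of y] by linarith
  define a where "a = iprod H x y / of_real ((vnorm H y)\<^sup>2)"
  have "Re (iprod H x (a \<odot> y)) = (cmod (iprod H x y))\<^sup>2 / (vnorm H y)\<^sup>2"
  proof -
    have "iprod H x (a \<odot> y) = of_real ((cmod (iprod H x y))\<^sup>2 / (vnorm H y)\<^sup>2)"
      using x y by (simp add: iprod_smult_right a_def complex_norm_square mult_ac
          del: of_real_power)
    then show ?thesis by simp
  qed
  moreover have "(vnorm H (a \<odot> y))\<^sup>2 = (cmod (iprod H x y))\<^sup>2 / (vnorm H y)\<^sup>2"
  proof -
    have "cmod a = cmod (iprod H x y) / (vnorm H y)\<^sup>2"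
      by (simp add: a_def norm_divide del: of_real_power)
    then show ?thesis using y pos by (simp add: vnorm_smult field_simps power2_eq_square)
  qed
  ultimately have "0 \<le> (vnorm H x)\<^sup>2 - (cmod (iprod H x y))\<^sup>2 / (vnorm H y)\<^sup>2"
    using vnorm_minus_power2[of x "a \<odot> y"] x y zero_le_power2[of "vnorm H (x \<ominus> a \<odot> y)"] by simp
  then have "(cmod (iprod H x y))\<^sup>2 \<le> (vnorm H x * vnorm H y)\<^sup>2"
    using pos by (simp add: field_simps)
  then show ?thesis using x y by (simp add: power2_le_iff_abs_le)
qed (use x in simp)

lemma vnorm_triangle:
  assumes "x \<in> carrier H" "y \<in> carrier H"
  shows "vnorm H (x \<oplus> y) \<le> vnorm H x + vnorm H y"
proof -
  have "Re (iprod H x y) \<le> vnorm H x * vnorm H y"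
    using Cauchy_Schwarz[OF assms] complex_Re_le_cmod order_trans by blast
  then have "(vnorm H (x \<oplus> y))\<^sup>2 \<le> (vnorm H x + vnorm H y)\<^sup>2"
    using assms by (simp add: vnorm_add_power2 power2_sum)
  then show ?thesis by (rule power2_le_imp_le) (use assms in auto)
qed

lemma minus_add_minus:
  assumes "x \<in> carrier H" "y \<in> carrier H" "z \<in> carrier H"
  shows "(x \<ominus> y) \<oplus> (y \<ominus> z) = x \<ominus> z"
  using assms by (simp add: M.minus_eq M.a_assoc M.r_neg1)

lemma vnorm_triangle_minus:
  assumes "x \<in> carrier H" "y \<in> carrier H" "z \<in> carrier H"
  shows "vnorm H (x \<ominus> z) \<le> vnorm H (x \<ominus> y) + vnorm H (y \<ominus> z)"
  using vnorm_triangle[of "x \<ominus> y" "y \<ominus> z"] assms by (simp add: minus_add_minus)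

lemma minus_zero_right [simp]: "x \<in> carrier H \<Longrightarrow> x \<ominus> \<zero> = x"
  by (simp add: minus_eq_smult)

lemma vnorm_diff_le:
  assumes "x \<in> carrier H" "y \<in> carrier H"
  shows "\<bar>vnorm H x - vnorm H y\<bar> \<le> vnorm H (x \<ominus> y)"
  using vnorm_triangle_minus[of x y \<zero>] vnorm_triangle_minus[of y x \<zero>]
    vnorm_minus_commute[of x y] assms by simp

lemma minus_eq_zeroD: "x \<in> carrier H \<Longrightarrow> y \<in> carrier H \<Longrightarrow> x \<ominus> y = \<zero> \<Longrightarrow> x = y"
proof -
  assume x: "x \<in> carrier H" and y: "y \<in> carrier H" and eq: "x \<ominus> y = \<zero>"
  have "x = (x \<ominus> y) \<oplus> y" using x y by (simp add: M.minus_eq M.a_assoc M.l_neg)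
  then show "x = y" using eq y by simp
qed

lemma iprod_ext:
  assumes "u \<in> carrier H" "v \<in> carrier H" "\<And>x. x \<in> carrier H \<Longrightarrow> iprod H x u = iprod H x v"
  shows "u = v"
proof (rule minus_eq_zeroD)
  have "iprod H (u \<ominus> v) (u \<ominus> v) = 0"
    using assms(1,2) assms(3)[of "u \<ominus> v"] by (simp add: minus_eq_smult iprod_add_right iprod_smult_right)
  then show "u \<ominus> v = \<zero>" using assms by (intro iprod_definite) auto
qed (use assms in auto)

text \<open>The representing vector is a minimiser of \<open>J\<close>, which is bounded below by
  completing the square. The parallelogram law makes a minimising sequence Cauchy. The first
  variation at the minimiser gives equality of real parts, and applying this to
  \<open>\<i> \<odot> x\<close> gives the imaginary parts.\<close>

theorem Riesz:
  assumes add: "\<And>x y. x \<in> carrier H \<Longrightarrow> y \<in> carrier H \<Longrightarrow> \<phi> (x \<oplus> y) = \<phi> x + \<phi> y"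
    and smult: "\<And>a x. x \<in> carrier H \<Longrightarrow> \<phi> (a \<odot> x) = a * \<phi> x"
    and bound: "\<And>x. x \<in> carrier H \<Longrightarrow> cmod (\<phi> x) \<le> C * vnorm H x"
  shows "\<exists>l\<in>carrier H. \<forall>x\<in>carrier H. \<phi> x = iprod H x l"
proof -
  define J where "J x = (vnorm H x)\<^sup>2 - 2 * Re (\<phi> x)" for x
  define m where "m = (INF x\<in>carrier H. J x)"
  have "J x \<ge> - C\<^sup>2" if x: "x \<in> carrier H" for x
  proof -
    have "Re (\<phi> x) \<le> C * vnorm H x" using bound[OF x] complex_Re_le_cmod order_trans by blast
    then show ?thesis using zero_le_power2[of "vnorm H x - C"] by (simp add: J_def power2_diff mult.commute)
  qed
  then have bdd: "bdd_below (J ` carrier H)" by (intro bdd_belowI2[of _ "- C\<^sup>2"])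
  have m_le: "m \<le> J x" if "x \<in> carrier H" for x
    unfolding m_def using bdd that by (rule cINF_lower)
  have ne: "carrier H \<noteq> {}" by blast
  have "\<exists>x\<in>carrier H. J x < m + 1 / real (Suc n)" for n
  proof -
    have "(INF x\<in>carrier H. J x) < m + 1 / real (Suc n)" by (simp add: m_def)
    then show ?thesis by (simp only: cINF_less_iff[OF ne bdd])
  qed
  then obtain s where s: "\<And>n. s n \<in> carrier H" and J_s: "\<And>n. J (s n) < m + 1 / real (Suc n)"
    by metis
  have gap: "(vnorm H (s i \<ominus> s j))\<^sup>2 \<le> 2 / real (Suc i) + 2 / real (Suc j)" for i j
  proof -
    \<comment> \<open>The midpoint: since \<open>J c\<close> is at least the infimum, the
      parallelogram identity bounds the distance of \<open>s i\<close> and \<open>s j\<close> by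
      their excess over it.\<close>
    define c where "c = (1 / 2 :: complex) \<odot> (s i \<oplus> s j)"
    have c: "c \<in> carrier H" using s by (simp add: c_def)
    have "4 * J c = (vnorm H (s i \<oplus> s j))\<^sup>2 - 4 * Re (\<phi> (s i)) - 4 * Re (\<phi> (s j))"
    proof -
      have "Re (\<phi> c) = (Re (\<phi> (s i)) + Re (\<phi> (s j))) / 2"
        using s by (simp add: c_def smult add)
      moreover have "(vnorm H c)\<^sup>2 = (vnorm H (s i \<oplus> s j))\<^sup>2 / 4"
        using s by (simp add: c_def vnorm_smult power_mult_distrib power_divide)
      ultimately show ?thesis unfolding J_def by argo
    qed
    then have "(vnorm H (s i \<ominus> s j))\<^sup>2 = 2 * J (s i) + 2 * J (s j) - 4 * J c"
      using s by (simp add: J_def vnorm_add_power2 vnorm_minus_power2)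
    then show ?thesis using m_le[OF c] J_s[of i] J_s[of j] by simp
  qed
  have "\<exists>N. \<forall>i\<ge>N. \<forall>j\<ge>N. vnorm H (s i \<ominus> s j) < e" if e: "e > 0" for e :: real
  proof -
    obtain N where N: "4 / e\<^sup>2 < real N" using reals_Archimedean2 by blast
    have "vnorm H (s i \<ominus> s j) < e" if "i \<ge> N" "j \<ge> N" for i j
    proof (rule power2_less_imp_less)
      have "4 / e\<^sup>2 < real (Suc i)" "4 / e\<^sup>2 < real (Suc j)" using N that by auto
      then have "2 / real (Suc i) < e\<^sup>2 / 2" "2 / real (Suc j) < e\<^sup>2 / 2"
        using e by (simp_all add: field_simps)
      then show "(vnorm H (s i \<ominus> s j))\<^sup>2 < e\<^sup>2" using gap[of i j] by simp
    qed (use e in simp)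
    then show ?thesis by blast
  qed
  from complete[OF s this] obtain l where l: "l \<in> carrier H" and lim: "(\<lambda>n. vnorm H (s n \<ominus> l)) \<longlonglongrightarrow> 0"
    by blast
  have "(\<lambda>n. vnorm H (s n)) \<longlonglongrightarrow> vnorm H l"
    by (rule LIM_zero_cancel, rule Lim_null_comparison[OF _ lim])
      (simp add: vnorm_diff_le s l)
  moreover have "(\<lambda>n. \<phi> (s n)) \<longlonglongrightarrow> \<phi> l"
  proof (rule LIM_zero_cancel, rule Lim_null_comparison)
    show "\<forall>\<^sub>F n in sequentially. cmod (\<phi> (s n) - \<phi> l) \<le> C * vnorm H (s n \<ominus> l)"
    proof (intro always_eventually allI)
      fix n
      have "\<phi> (s n \<ominus> l) = \<phi> (s n) - \<phi> l" using s l by (simp add: minus_eq_smult add smult)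
      then show "cmod (\<phi> (s n) - \<phi> l) \<le> C * vnorm H (s n \<ominus> l)" using bound[of "s n \<ominus> l"] s l by simp
    qed
    show "(\<lambda>n. C * vnorm H (s n \<ominus> l)) \<longlonglongrightarrow> 0" using tendsto_mult_left[OF lim, of C] by simp
  qed
  ultimately have "(\<lambda>n. J (s n)) \<longlonglongrightarrow> J l" unfolding J_def by (intro tendsto_intros)
  moreover have "(\<lambda>n. m + 1 / real (Suc n)) \<longlonglongrightarrow> m + 0"
    by (intro tendsto_intros LIMSEQ_Suc[OF lim_1_over_n])
  ultimately have "J l \<le> m + 0"
    by (rule LIMSEQ_le) (meson J_s less_imp_le)
  then have J_l: "J l \<le> m" by simp
  have Re_eq: "Re (\<phi> h) = Re (iprod H h l)" if h: "h \<in> carrier H" for h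
  proof (rule ccontr)
    define d where "d = Re (iprod H h l) - Re (\<phi> h)"
    assume "Re (\<phi> h) \<noteq> Re (iprod H h l)"
    then have d: "d \<noteq> 0" by (simp add: d_def)
    have quad: "0 \<le> 2 * t * d + t\<^sup>2 * (vnorm H h)\<^sup>2" for t
    proof -
      have "J (l \<oplus> of_real t \<odot> h) = J l + 2 * t * d + t\<^sup>2 * (vnorm H h)\<^sup>2"
        using l h by (simp add: J_def add smult vnorm_add_power2 vnorm_smult iprod_smult_right
            iprod_commute[of h l] power_mult_distrib d_def algebra_simps)
      then show ?thesis using J_l m_le[of "l \<oplus> of_real t \<odot> h"] l h by simp
    qed
    \<comment> \<open>The test value t = - d / n has to make sense when \<open>vnorm H h\<close> is
      0, hence the added 1.\<close>
    define n where "n = (vnorm H h)\<^sup>2 + 1"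
    have n: "n > 0" "(vnorm H h)\<^sup>2 \<le> n" by (auto simp: n_def intro: add_nonneg_pos)
    have "0 \<le> 2 * (- d / n) * d + (- d / n)\<^sup>2 * (vnorm H h)\<^sup>2" by (rule quad)
    also have "\<dots> \<le> 2 * (- d / n) * d + (- d / n)\<^sup>2 * n" using n by (intro add_left_mono mult_left_mono) auto
    also have "\<dots> = - d\<^sup>2 / n" using n by (simp add: field_simps power2_eq_square)
    also have "\<dots> < 0" using d n by simp
    finally show False by simp
  qed
  have "\<phi> x = iprod H x l" if x: "x \<in> carrier H" for x
    using Re_eq[OF x] Re_eq[of "\<i> \<odot> x"] x l by (simp add: complex_eq_iff smult iprod_smult_left)
  then show ?thesis using l by blast
qed

section \<open>Bounded and invertible operators\<close>

lemma bounded_operatorI: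
  assumes "\<And>x. x \<in> carrier H \<Longrightarrow> T x \<in> carrier H"
    and "\<And>x y. x \<in> carrier H \<Longrightarrow> y \<in> carrier H \<Longrightarrow> T (x \<oplus> y) = T x \<oplus> T y"
    and "\<And>a x. x \<in> carrier H \<Longrightarrow> T (a \<odot> x) = a \<odot> T x"
    and "\<And>x. x \<in> carrier H \<Longrightarrow> vnorm H (T x) \<le> C * vnorm H x"
  shows "bounded_operator H T"
  unfolding bounded_operator_def by (intro conjI funcsetI ballI allI exI[of _ C] assms)

lemma bounded_operator_closed: "bounded_operator H T \<Longrightarrow> x \<in> carrier H \<Longrightarrow> T x \<in> carrier H"
  by (auto simp: bounded_operator_def)

lemma bounded_operator_add:
  "bounded_operator H T \<Longrightarrow> x \<in> carrier H \<Longrightarrow> y \<in> carrier H \<Longrightarrow> T (x \<oplus> y) = T x \<oplus> T y"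
  by (auto simp: bounded_operator_def)

lemma bounded_operator_smult: "bounded_operator H T \<Longrightarrow> x \<in> carrier H \<Longrightarrow> T (a \<odot> x) = a \<odot> T x"
  by (auto simp: bounded_operator_def)

lemma bounded_operator_bound:
  assumes "bounded_operator H T"
  obtains C where "C \<ge> 0" "\<And>x. x \<in> carrier H \<Longrightarrow> vnorm H (T x) \<le> C * vnorm H x"
proof -
  obtain C where C: "\<And>x. x \<in> carrier H \<Longrightarrow> vnorm H (T x) \<le> C * vnorm H x"
    using assms unfolding bounded_operator_def by blast
  show ?thesis
  proof (rule that[of "max C 0"])
    fix x assume x: "x \<in> carrier H"
    have "C * vnorm H x \<le> max C 0 * vnorm H x" using x by (intro mult_right_mono) auto
    then show "vnorm H (T x) \<le> max C 0 * vnorm H x" using C[OF x] by simp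
  qed simp
qed

lemma bounded_operator_zero: "bounded_operator H T \<Longrightarrow> T \<zero> = \<zero>"
  using bounded_operator_smult[of T \<zero> 0] bounded_operator_closed[of T \<zero>] by simp

lemma bounded_operator_minus:
  "bounded_operator H T \<Longrightarrow> x \<in> carrier H \<Longrightarrow> y \<in> carrier H \<Longrightarrow> T (x \<ominus> y) = T x \<ominus> T y"
  by (simp add: minus_eq_smult bounded_operator_add bounded_operator_smult bounded_operator_closed)

text \<open>Operators are functions on a whole type but matter only on the carrier; inverses and
  rearranged expressions agree with the intended function only there.\<close>

lemma bounded_operator_cong:
  assumes "bounded_operator H T" "\<And>x. x \<in> carrier H \<Longrightarrow> S x = T x"
  shows "bounded_operator H S"
proof -
  obtain C where C: "\<And>x. x \<in> carrier H \<Longrightarrow> vnorm H (T x) \<le> C * vnorm H x"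
    using bounded_operator_bound[OF assms(1)] by blast
  show ?thesis using assms C
    by (intro bounded_operatorI[of _ C])
      (auto simp: bounded_operator_closed bounded_operator_add bounded_operator_smult)
qed

lemma bounded_operator_id: "bounded_operator H (\<lambda>x. x)"
  by (rule bounded_operatorI[of _ 1]) auto

lemma bounded_operator_comp:
  assumes S: "bounded_operator H S" and T: "bounded_operator H T"
  shows "bounded_operator H (\<lambda>x. S (T x))"
proof -
  obtain C where C: "C \<ge> 0" "\<And>x. x \<in> carrier H \<Longrightarrow> vnorm H (S x) \<le> C * vnorm H x"
    using bounded_operator_bound[OF S] by blast
  obtain D where D: "D \<ge> 0" "\<And>x. x \<in> carrier H \<Longrightarrow> vnorm H (T x) \<le> D * vnorm H x"
    using bounded_operator_bound[OF T] by blast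
  show ?thesis
  proof (rule bounded_operatorI[of _ "C * D"])
    fix x assume x: "x \<in> carrier H"
    have "vnorm H (S (T x)) \<le> C * vnorm H (T x)" using C(2) x T by (simp add: bounded_operator_closed)
    also have "\<dots> \<le> C * (D * vnorm H x)" using C(1) D(2)[OF x] by (rule mult_left_mono[rotated])
    finally show "vnorm H (S (T x)) \<le> C * D * vnorm H x" by simp
  qed (use S T in \<open>auto simp: bounded_operator_closed bounded_operator_add bounded_operator_smult\<close>)
qed

lemma bounded_operator_scale:
  assumes T: "bounded_operator H T"
  shows "bounded_operator H (\<lambda>x. a \<odot> T x)"
proof -
  have "bounded_operator H (\<lambda>x. a \<odot> x)"
    by (rule bounded_operatorI[of _ "cmod a"]) (auto simp: smult_add_right vnorm_smult mult.commute)
  from bounded_operator_comp[OF this T] show ?thesis .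
qed

lemma bounded_operator_plus:
  assumes S: "bounded_operator H S" and T: "bounded_operator H T"
  shows "bounded_operator H (\<lambda>x. S x \<oplus> T x)"
proof -
  obtain C where C: "\<And>x. x \<in> carrier H \<Longrightarrow> vnorm H (S x) \<le> C * vnorm H x"
    using bounded_operator_bound[OF S] by blast
  obtain D where D: "\<And>x. x \<in> carrier H \<Longrightarrow> vnorm H (T x) \<le> D * vnorm H x"
    using bounded_operator_bound[OF T] by blast
  show ?thesis
  proof (rule bounded_operatorI[of _ "C + D"])
    fix x assume x: "x \<in> carrier H"
    show "vnorm H (S x \<oplus> T x) \<le> (C + D) * vnorm H x"
      using vnorm_triangle[of "S x" "T x"] C[OF x] D[OF x] S T x
      by (simp add: bounded_operator_closed distrib_right)
  next
    fix x y assume "x \<in> carrier H" "y \<in> carrier H"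
    then show "S (x \<oplus> y) \<oplus> T (x \<oplus> y) = S x \<oplus> T x \<oplus> (S y \<oplus> T y)"
      using S T by (simp add: bounded_operator_closed bounded_operator_add M.a_ac)
  qed (use S T in \<open>auto simp: bounded_operator_closed bounded_operator_smult smult_add_right\<close>)
qed

lemma bounded_operator_diff:
  assumes S: "bounded_operator H S" and T: "bounded_operator H T"
  shows "bounded_operator H (\<lambda>x. S x \<ominus> T x)"
  by (rule bounded_operator_cong[OF bounded_operator_plus[OF S bounded_operator_scale[OF T, of "-1"]]])
    (use S T in \<open>auto simp: minus_eq_smult bounded_operator_closed\<close>)

lemma bdd_above_vnorm_image:
  assumes "bounded_operator H T"
  shows "bdd_above ((\<lambda>x. vnorm H (T x)) ` {x \<in> carrier H. vnorm H x \<le> 1})"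
proof -
  obtain C where C: "C \<ge> 0" "\<And>x. x \<in> carrier H \<Longrightarrow> vnorm H (T x) \<le> C * vnorm H x"
    using bounded_operator_bound[OF assms] by blast
  show ?thesis
  proof (rule bdd_aboveI2[of _ _ C])
    fix x assume "x \<in> {x \<in> carrier H. vnorm H x \<le> 1}"
    then show "vnorm H (T x) \<le> C" using C(2)[of x] mult_left_mono[of "vnorm H x" 1 C] C(1) by auto
  qed
qed

lemma vnorm_le_op_norm:
  assumes T: "bounded_operator H T" and x: "x \<in> carrier H"
  shows "vnorm H (T x) \<le> op_norm H T * vnorm H x"
proof (cases "x = \<zero>")
  case True
  then show ?thesis by (simp add: bounded_operator_zero[OF T])
next
  case False
  then have pos: "vnorm H x > 0" using x vnorm_eq_0_iff[of x] vnorm_nonneg[of x] by linarith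
  define u where "u = of_real (1 / vnorm H x) \<odot> x"
  have u: "u \<in> carrier H" "vnorm H u = 1" using x pos by (auto simp: u_def vnorm_smult norm_divide)
  have "vnorm H (T u) \<le> op_norm H T"
    unfolding op_norm_def by (rule cSUP_upper[OF _ bdd_above_vnorm_image[OF T]]) (use u in auto)
  moreover have "vnorm H (T u) = vnorm H (T x) / vnorm H x"
    using T x pos
    by (simp add: u_def bounded_operator_smult bounded_operator_closed vnorm_smult norm_divide)
  ultimately show ?thesis using pos by (simp add: field_simps)
qed

lemma op_norm_le:
  assumes "C \<ge> 0" "\<And>x. x \<in> carrier H \<Longrightarrow> vnorm H (T x) \<le> C * vnorm H x"
  shows "op_norm H T \<le> C"
  unfolding op_norm_def
proof (rule cSUP_least)
  show "{x \<in> carrier H. vnorm H x \<le> 1} \<noteq> {}" using M.zero_closed vnorm_zero by fastforce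
  fix x assume "x \<in> {x \<in> carrier H. vnorm H x \<le> 1}"
  then show "vnorm H (T x) \<le> C"
    using assms(2)[of x] mult_left_mono[of "vnorm H x" 1 C] assms(1) by auto
qed

lemma invertible_operatorI:
  assumes T: "bounded_operator H T" and S: "bounded_operator H S"
    and ST: "\<And>x. x \<in> carrier H \<Longrightarrow> S (T x) = x" and TS: "\<And>x. x \<in> carrier H \<Longrightarrow> T (S x) = x"
  shows "invertible_operator H T" and "x \<in> carrier H \<Longrightarrow> op_inv H T x = S x"
proof -
  have bij: "bij_betw T (carrier H) (carrier H)"
    by (rule bij_betwI[of _ _ _ S]) (auto simp: S T ST TS bounded_operator_closed)
  have inv: "op_inv H T x = S x" if "x \<in> carrier H" for x
    unfolding op_inv_def
    by (rule inv_into_f_eq) (use bij that S TS in \<open>auto simp: bij_betw_def bounded_operator_closed\<close>)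
  then show "x \<in> carrier H \<Longrightarrow> op_inv H T x = S x" by blast
  show "invertible_operator H T"
    unfolding invertible_operator_def using T bij bounded_operator_cong[OF S inv] by blast
qed

lemma invertible_operator_bounded: "invertible_operator H T \<Longrightarrow> bounded_operator H T"
  by (simp add: invertible_operator_def)

lemma op_inv_bounded: "invertible_operator H T \<Longrightarrow> bounded_operator H (op_inv H T)"
  by (simp add: invertible_operator_def)

lemma op_inv_left: "invertible_operator H T \<Longrightarrow> x \<in> carrier H \<Longrightarrow> op_inv H T (T x) = x"
  by (simp add: invertible_operator_def op_inv_def bij_betw_def)

lemma op_inv_right: "invertible_operator H T \<Longrightarrow> x \<in> carrier H \<Longrightarrow> T (op_inv H T x) = x"
  by (simp add: invertible_operator_def op_inv_def bij_betw_def f_inv_into_f)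

lemma invertible_operator_cong:
  assumes T: "invertible_operator H T" and eq: "\<And>x. x \<in> carrier H \<Longrightarrow> S x = T x"
  shows "invertible_operator H S"
  by (rule invertible_operatorI(1)[OF bounded_operator_cong[OF invertible_operator_bounded[OF T] eq] op_inv_bounded[OF T]])
    (use T in \<open>auto simp: eq op_inv_left op_inv_right bounded_operator_closed op_inv_bounded\<close>)

lemma invertible_operator_comp:
  assumes S: "invertible_operator H S" and T: "invertible_operator H T"
  shows "invertible_operator H (\<lambda>x. S (T x))"
proof -
  have b: "bounded_operator H S" "bounded_operator H T" "bounded_operator H (op_inv H S)" "bounded_operator H (op_inv H T)"
    using S T by (auto simp: invertible_operator_def)
  show ?thesis
    by (rule invertible_operatorI(1)[OF bounded_operator_comp[OF b(1,2)] bounded_operator_comp[OF b(4,3)]])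
      (use S T b in \<open>auto simp: op_inv_left op_inv_right bounded_operator_closed\<close>)
qed

lemma invertible_operator_scalar:
  assumes "a \<noteq> 0"
  shows "invertible_operator H (\<lambda>x. a \<odot> x)"
  by (rule invertible_operatorI(1)[OF bounded_operator_scale[OF bounded_operator_id]
        bounded_operator_scale[OF bounded_operator_id, of "1 / a"]]) (use assms in auto)

text \<open>For fixed \<open>y\<close> the functional taking \<open>x\<close> to
  \<open>iprod H (T x) y\<close> has a Riesz vector \<open>S y\<close>, and uniqueness of that
  vector (\<open>iprod_ext\<close>) makes \<open>S\<close> linear. Testing with
  \<open>x = S y\<close> and cancelling one factor \<open>vnorm H (S y)\<close> bounds it. This
  gives the choice in \<open>adjoint_op\<close> its meaning.\<close>

lemma adjoint_exists:
  assumes T: "bounded_operator H T"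
  shows "\<exists>S. bounded_operator H S \<and> (\<forall>x\<in>carrier H. \<forall>y\<in>carrier H. iprod H (T x) y = iprod H x (S y))"
proof -
  obtain C where C: "C \<ge> 0" "\<And>x. x \<in> carrier H \<Longrightarrow> vnorm H (T x) \<le> C * vnorm H x"
    using bounded_operator_bound[OF T] by blast
  have "\<exists>l\<in>carrier H. \<forall>x\<in>carrier H. iprod H (T x) y = iprod H x l" if y: "y \<in> carrier H" for y
  proof (rule Riesz[of _ "C * vnorm H y"])
    fix x assume x: "x \<in> carrier H"
    have "cmod (iprod H (T x) y) \<le> vnorm H (T x) * vnorm H y"
      using T x y by (intro Cauchy_Schwarz) (auto simp: bounded_operator_closed)
    also have "\<dots> \<le> C * vnorm H x * vnorm H y" using C(2)[OF x] y by (intro mult_right_mono) auto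
    finally show "cmod (iprod H (T x) y) \<le> C * vnorm H y * vnorm H x" by (simp add: mult_ac)
  qed (use T y in \<open>auto simp: bounded_operator_add bounded_operator_smult bounded_operator_closed
      iprod_add_left iprod_smult_left\<close>)
  then obtain S where S: "\<And>y. y \<in> carrier H \<Longrightarrow> S y \<in> carrier H"
    and adj: "\<And>x y. x \<in> carrier H \<Longrightarrow> y \<in> carrier H \<Longrightarrow> iprod H (T x) y = iprod H x (S y)"
    by metis
  have "bounded_operator H S"
  proof (rule bounded_operatorI[of _ C])
    fix x y assume xy: "x \<in> carrier H" "y \<in> carrier H"
    show "S (x \<oplus> y) = S x \<oplus> S y"
      by (rule iprod_ext) (use xy S T in \<open>auto simp: iprod_add_right bounded_operator_closed adj[symmetric]\<close>)
  next
    fix a x assume x: "x \<in> carrier H"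
    show "S (a \<odot> x) = a \<odot> S x"
      by (rule iprod_ext) (use x S T in \<open>auto simp: iprod_smult_right bounded_operator_closed adj[symmetric]\<close>)
  next
    fix y assume y: "y \<in> carrier H"
    have "(vnorm H (S y))\<^sup>2 = Re (iprod H (T (S y)) y)" using y S by (simp add: vnorm_power2 adj)
    also have "\<dots> \<le> cmod (iprod H (T (S y)) y)" by (rule complex_Re_le_cmod)
    also have "\<dots> \<le> vnorm H (T (S y)) * vnorm H y"
      using T y S by (intro Cauchy_Schwarz) (auto simp: bounded_operator_closed)
    also have "\<dots> \<le> C * vnorm H (S y) * vnorm H y" using C(2)[OF S[OF y]] y by (intro mult_right_mono) auto
    finally have le: "vnorm H (S y) * vnorm H (S y) \<le> vnorm H (S y) * (C * vnorm H y)"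
      by (simp add: power2_eq_square mult_ac)
    show "vnorm H (S y) \<le> C * vnorm H y"
    proof (cases "vnorm H (S y) = 0")
      case True
      then show ?thesis using C(1) y by simp
    next
      case False
      then have "vnorm H (S y) > 0" using vnorm_nonneg[OF S[OF y]] by linarith
      then show ?thesis using le by simp
    qed
  qed (use S in auto)
  then show ?thesis using adj by blast
qed

lemma adjoint_op:
  assumes T: "bounded_operator H T"
  shows "bounded_operator H (adjoint_op H T)"
    and "x \<in> carrier H \<Longrightarrow> y \<in> carrier H \<Longrightarrow> iprod H (T x) y = iprod H x (adjoint_op H T y)"
  using someI_ex[OF adjoint_exists[OF T]] unfolding adjoint_op_def by blast+

lemma iprod_adjoint_self:
  assumes T: "bounded_operator H T" and x: "x \<in> carrier H"
  shows "iprod H (adjoint_op H T (T x)) x = of_real ((vnorm H (T x))\<^sup>2)"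
proof -
  have "iprod H (adjoint_op H T (T x)) x = cnj (iprod H x (adjoint_op H T (T x)))"
    using T x by (intro iprod_commute) (auto simp: bounded_operator_closed adjoint_op)
  also have "\<dots> = cnj (iprod H (T x) (T x))" using T x by (simp add: adjoint_op(2) bounded_operator_closed)
  finally show ?thesis using T x by (simp add: iprod_self bounded_operator_closed)
qed

section \<open>Polynomials in an operator\<close>

lemma bounded_operator_funpow: "bounded_operator H T \<Longrightarrow> bounded_operator H (T ^^ n)"
proof (induction n)
  case (Suc n)
  then show ?case using bounded_operator_comp[of T "T ^^ n"] by (simp add: comp_def)
qed (simp add: bounded_operator_id id_def)

lemma poly_op_0 [simp]: "x \<in> carrier H \<Longrightarrow> poly_op H 0 T x = \<zero>"
  by (simp add: poly_op_def)

lemma bounded_operator_finsum: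
  assumes T: "bounded_operator H T" and f: "\<And>i. f i \<in> carrier H"
  shows "T (\<Oplus>i\<in>{..n::nat}. f i) = (\<Oplus>i\<in>{..n}. T (f i))"
  using f by (induction n) (auto simp: bounded_operator_add[OF T] bounded_operator_closed[OF T])

text \<open>Horner's rule. It allows induction over \<open>pCons\<close> in place of manipulating
  finite sums in the carrier.\<close>

lemma poly_op_pCons:
  assumes T: "bounded_operator H T" and x: "x \<in> carrier H"
  shows "poly_op H (pCons a p) T x = a \<odot> x \<oplus> T (poly_op H p T x)"
\<comment> \<open>\<open>pCons a 0\<close> still has degree 0, so only for
  \<open>p \<noteq> 0\<close> does the sum get one term longer.\<close>
proof (cases "p = 0")
  case True
  then show ?thesis using x by (simp add: poly_op_def bounded_operator_zero[OF T])
next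
  case False
  have cl: "(T ^^ i) x \<in> carrier H" for i
    using bounded_operator_closed[OF bounded_operator_funpow[OF T] x] .
  have "poly_op H (pCons a p) T x
      = (\<Oplus>i\<in>{..Suc (degree p)}. coeff (pCons a p) i \<odot> (T ^^ i) x)"
    using False by (simp add: poly_op_def)
  also have "\<dots> = (\<Oplus>i\<in>{..degree p}. coeff p i \<odot> (T ^^ Suc i) x) \<oplus> a \<odot> x"
    using cl by (subst M.finsum_Suc2) (auto intro!: smult_in simp del: funpow.simps simp: x)
  also have "(\<Oplus>i\<in>{..degree p}. coeff p i \<odot> (T ^^ Suc i) x) = T (poly_op H p T x)"
    unfolding poly_op_def using cl
    by (subst bounded_operator_finsum[OF T]) (auto simp: bounded_operator_smult[OF T])
  finally show ?thesis
    using x T cl by (subst M.a_comm) (auto simp: poly_op_def intro!: bounded_operator_closed[OF T] M.finsum_closed)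
qed

lemma bounded_operator_poly_op:
  assumes T: "bounded_operator H T"
  shows "bounded_operator H (poly_op H p T)"
proof (induction p)
  case 0
  show ?case
    by (rule bounded_operator_cong[OF bounded_operator_scale[OF bounded_operator_id, of 0]]) auto
next
  case (pCons a p)
  show ?case
    by (rule bounded_operator_cong[OF bounded_operator_plus[OF bounded_operator_scale[OF bounded_operator_id]
            bounded_operator_comp[OF T pCons(2)]]]) (simp add: poly_op_pCons[OF T])
qed

lemma poly_op_closed: "bounded_operator H T \<Longrightarrow> x \<in> carrier H \<Longrightarrow> poly_op H p T x \<in> carrier H"
  using bounded_operator_closed[OF bounded_operator_poly_op] .

lemma poly_op_add:
  assumes T: "bounded_operator H T" and x: "x \<in> carrier H"
  shows "poly_op H (p + q) T x = poly_op H p T x \<oplus> poly_op H q T x"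
proof (induction p q rule: poly_induct2)
  case (pCons a p b q)
  show ?case
    using T x by (simp add: poly_op_pCons pCons bounded_operator_add poly_op_closed bounded_operator_closed
        smult_add_left M.a_ac)
qed (use x in simp)

lemma poly_op_smult:
  assumes T: "bounded_operator H T" and x: "x \<in> carrier H"
  shows "poly_op H (Polynomial.smult a p) T x = a \<odot> poly_op H p T x"
proof (induction p)
  case (pCons b p)
  show ?case
    using T x by (simp add: poly_op_pCons pCons bounded_operator_smult poly_op_closed bounded_operator_closed
        smult_add_right)
qed (use x in simp)

lemma poly_op_mult:
  assumes T: "bounded_operator H T" and x: "x \<in> carrier H"
  shows "poly_op H (p * q) T x = poly_op H p T (poly_op H q T x)"
proof (induction p)
  case (pCons b p)
  show ?case
    using T x by (simp add: poly_op_pCons pCons poly_op_add poly_op_smult poly_op_closed)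
      (simp add: pCons poly_op_closed bounded_operator_closed)
qed (use T x in \<open>simp add: poly_op_closed\<close>)

lemma poly_op_linear:
  assumes T: "bounded_operator H T" and x: "x \<in> carrier H"
  shows "poly_op H [:- a, 1:] T x = T x \<ominus> a \<odot> x"
  using T x by (simp add: poly_op_pCons bounded_operator_closed bounded_operator_zero minus_eq_smult M.a_comm)

text \<open>Over the complex numbers \<open>q\<close> splits into linear factors, and each factor at
  T is invertible because its root is not in the spectrum.\<close>

lemma invertible_poly_op:
  assumes T: "bounded_operator H T" and "q \<noteq> 0" "\<And>z. poly q z = 0 \<Longrightarrow> z \<notin> spectrum H T"
  shows "invertible_operator H (poly_op H q T)"
  using assms(2,3)
proof (induction "degree q" arbitrary: q)
  case 0
  then obtain c where c: "q = [:c:]" using degree_eq_zeroE by metis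
  show ?case
    by (rule invertible_operator_cong[OF invertible_operator_scalar[of c]])
      (use 0 c T in \<open>auto simp: poly_op_pCons bounded_operator_zero\<close>)
next
  case (Suc d)
  then have "\<not> constant (poly q)" by (simp add: constant_degree)
  then obtain a where a: "poly q a = 0" using fundamental_theorem_of_algebra by blast
  obtain q' where q': "q = [:- a, 1:] * q'" using a poly_eq_0_iff_dvd by blast
  have "q' \<noteq> 0" using Suc(2) q' by auto
  then have "degree q = Suc (degree q')" unfolding q' by (subst degree_mult_eq) auto
  with Suc(2) have "d = degree q'" by simp
  moreover have "z \<notin> spectrum H T" if "poly q' z = 0" for z using Suc(4)[of z] that q' by simp
  ultimately have inv': "invertible_operator H (poly_op H q' T)" using Suc(1) \<open>q' \<noteq> 0\<close> by blast
  have "invertible_operator H (\<lambda>x. a \<odot> x \<ominus> T x)"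
    using Suc(4)[OF a] by (simp add: spectrum_def)
  \<comment> \<open>\<open>spectrum\<close> uses a x - T x, whereas the factor z - a yields T x - a
    x.\<close>
  from invertible_operator_comp[OF invertible_operator_scalar[of "-1"] this]
  have "invertible_operator H (poly_op H [:- a, 1:] T)"
    by (rule invertible_operator_cong)
      (use T in \<open>auto simp: poly_op_linear minus_eq_smult bounded_operator_closed smult_add_right M.a_comm\<close>)
  from invertible_operator_comp[OF this inv'] show ?case
    by (rule invertible_operator_cong) (simp only: q' poly_op_mult[OF T])
qed

subsection \<open>The disc as a spectral set\<close>

lemma poly_form_poly_op:
  assumes T: "bounded_operator H T" and R: "R > 0"
    and contr: "\<And>x. x \<in> carrier H \<Longrightarrow> vnorm H (T x) \<le> R * vnorm H x"
    and y: "y \<in> carrier H"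
  shows "poly_form (\<lambda>p q. iprod H (poly_op H p T y) (poly_op H q T y)) R"
proof
  note cl = poly_op_closed[OF T y]
  fix p q u :: "complex poly" and a :: complex
  show "iprod H (poly_op H (p + q) T y) (poly_op H u T y)
    = iprod H (poly_op H p T y) (poly_op H u T y) + iprod H (poly_op H q T y) (poly_op H u T y)"
    using cl by (simp add: poly_op_add[OF T y] iprod_add_left)
  show "iprod H (poly_op H (Polynomial.smult a p) T y) (poly_op H u T y)
    = a * iprod H (poly_op H p T y) (poly_op H u T y)"
    using cl by (simp add: poly_op_smult[OF T y] iprod_smult_left)
  show "iprod H (poly_op H q T y) (poly_op H p T y) = cnj (iprod H (poly_op H p T y) (poly_op H q T y))"
    using cl by (intro iprod_commute)
  show "0 \<le> Re (iprod H (poly_op H p T y) (poly_op H p T y))"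
    by (simp only: vnorm_power2[OF cl, symmetric] zero_le_power2)
  have "poly_op H (pCons 0 p) T y = T (poly_op H p T y)"
    using cl y T by (simp add: poly_op_pCons bounded_operator_closed)
  moreover have "(vnorm H (T (poly_op H p T y)))\<^sup>2 \<le> (R * vnorm H (poly_op H p T y))\<^sup>2"
    by (rule power_mono[OF contr[OF cl] vnorm_nonneg[OF bounded_operator_closed[OF T cl]]])
  ultimately show "Re (iprod H (poly_op H (pCons 0 p) T y) (poly_op H (pCons 0 p) T y))
      \<le> R\<^sup>2 * Re (iprod H (poly_op H p T y) (poly_op H p T y))"
    by (simp only: vnorm_power2[OF cl, symmetric] power_mult_distrib
        vnorm_power2[OF bounded_operator_closed[OF T cl], symmetric])
qed (rule R)

lemma vnorm_poly_op_mult_le: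
  assumes T: "bounded_operator H T" and R: "R > 0"
    and contr: "\<And>x. x \<in> carrier H \<Longrightarrow> vnorm H (T x) \<le> R * vnorm H x"
    and y: "y \<in> carrier H" and M: "\<And>z. cmod z \<le> R \<Longrightarrow> cmod (poly p z) \<le> M"
  shows "vnorm H (poly_op H (p * q) T y) \<le> M * vnorm H (poly_op H q T y)"
proof -
  interpret poly_form "\<lambda>p q. iprod H (poly_op H p T y) (poly_op H q T y)" R
    by (rule poly_form_poly_op[OF T R contr y])
  note cl = poly_op_closed[OF T y]
  have "0 \<le> M" using order_trans[OF norm_ge_zero M[of 0]] R by simp
  moreover have "(vnorm H (poly_op H (p * q) T y))\<^sup>2 \<le> (M * vnorm H (poly_op H q T y))\<^sup>2"
    using von_Neumann_poly[OF M] cl by (simp add: power_mult_distrib vnorm_power2)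
  ultimately show ?thesis using cl by (intro power2_le_imp_le[of "vnorm H (poly_op H (p * q) T y)"]) auto
qed

text \<open>Take a polynomial s close to 1 / q on the disc and split p = p s q + (1 - s q) p. The
  polynomial inequality bounds the first part by M (1 + \<epsilon>) |q(T) y| and the second by
  \<epsilon> |p(T) y|; the latter is absorbed on the left, and \<epsilon> tends to 0.\<close>

theorem von_Neumann_rational:
  assumes T: "bounded_operator H T" and R: "R > 0"
    and contr: "\<And>x. x \<in> carrier H \<Longrightarrow> vnorm H (T x) \<le> R * vnorm H x"
    and y: "y \<in> carrier H"
    and q: "\<And>z. cmod z \<le> R \<Longrightarrow> poly q z \<noteq> 0"
    and pq: "\<And>z. cmod z \<le> R \<Longrightarrow> cmod (poly p z) \<le> M * cmod (poly q z)"
  shows "vnorm H (poly_op H p T y) \<le> M * vnorm H (poly_op H q T y)"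
proof -
  note cl = poly_op_closed[OF T y]
  have "0 \<le> M * cmod (poly q 0)" using order_trans[OF norm_ge_zero pq[of 0]] R by simp
  then have M: "M \<ge> 0" using q[of 0] R by (simp add: zero_le_mult_iff)
  have le: "(1 - \<epsilon>) * vnorm H (poly_op H p T y) \<le> M * (1 + \<epsilon>) * vnorm H (poly_op H q T y)"
    if e: "\<epsilon> > 0" for \<epsilon>
  proof -
    obtain s where s: "\<And>z. cmod z \<le> R \<Longrightarrow> cmod (poly s z * poly q z - 1) \<le> \<epsilon>"
      using approx_inverse_poly[OF R q e] by blast
    have ps: "cmod (poly (p * s) z) \<le> M * (1 + \<epsilon>)" if z: "cmod z \<le> R" for z
    proof -
      have "cmod (poly (p * s) z) \<le> M * cmod (poly q z) * cmod (poly s z)"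
        using pq[OF z] by (auto simp: norm_mult intro: mult_right_mono)
      also have "\<dots> = M * cmod (poly s z * poly q z)" by (simp add: norm_mult mult_ac)
      also have "cmod (poly s z * poly q z) \<le> 1 + \<epsilon>"
        using s[OF z] norm_triangle_sub[of "poly s z * poly q z" 1] by simp
      finally show ?thesis using M by (simp add: mult_left_mono)
    qed
    have 1: "vnorm H (poly_op H (p * s * q) T y) \<le> M * (1 + \<epsilon>) * vnorm H (poly_op H q T y)"
      by (rule vnorm_poly_op_mult_le[OF T R _ y ps]) (rule contr)
    have sq: "cmod (poly (1 - s * q) z) \<le> \<epsilon>" if z: "cmod z \<le> R" for z
      using s[OF z] by (simp add: norm_minus_commute)
    have 2: "vnorm H (poly_op H ((1 - s * q) * p) T y) \<le> \<epsilon> * vnorm H (poly_op H p T y)"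
      by (rule vnorm_poly_op_mult_le[OF T R _ y sq]) (rule contr)
    have "p = p * s * q + (1 - s * q) * p" by (simp add: algebra_simps)
    then have "poly_op H p T y = poly_op H (p * s * q) T y \<oplus> poly_op H ((1 - s * q) * p) T y"
      by (metis poly_op_add[OF T y])
    then have "vnorm H (poly_op H p T y) \<le> vnorm H (poly_op H (p * s * q) T y) + vnorm H (poly_op H ((1 - s * q) * p) T y)"
      using vnorm_triangle[OF cl cl] by simp
    then show ?thesis using 1 2 by (simp only: left_diff_distrib mult_1; linarith)
  qed
  have "((\<lambda>\<epsilon>. (1 - \<epsilon>) * vnorm H (poly_op H p T y)) \<longlongrightarrow> (1 - 0) * vnorm H (poly_op H p T y)) (at_right 0)"
    by (intro tendsto_intros)
  moreover have "((\<lambda>\<epsilon>. M * (1 + \<epsilon>) * vnorm H (poly_op H q T y)) \<longlongrightarrow> M * (1 + 0) * vnorm H (poly_op H q T y)) (at_right 0)"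
    by (intro tendsto_intros)
  ultimately have "(1 - 0) * vnorm H (poly_op H p T y) \<le> M * (1 + 0) * vnorm H (poly_op H q T y)"
    by (intro tendsto_le[OF trivial_limit_at_right_real]) (auto simp: eventually_at_filter le)
  then show ?thesis by simp
qed

lemma eq_if_vnorm_minus_le_0:
  assumes "x \<in> carrier H" "y \<in> carrier H" "vnorm H (x \<ominus> y) \<le> 0"
  shows "x = y"
proof (rule minus_eq_zeroD)
  have "vnorm H (x \<ominus> y) = 0"
    by (rule antisym[OF assms(3)]) (use assms in simp)
  then show "x \<ominus> y = \<zero>" using assms by (simp add: vnorm_eq_0_iff)
qed (use assms in auto)

lemma smult_add_minus:
  assumes "u \<in> carrier H" "v \<in> carrier H" "w \<in> carrier H"
  shows "a \<odot> (u \<oplus> v) \<ominus> a \<odot> (u \<oplus> w) = a \<odot> (v \<ominus> w)"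
proof (rule iprod_ext)
  fix x assume "x \<in> carrier H"
  then show "iprod H x (a \<odot> (u \<oplus> v) \<ominus> a \<odot> (u \<oplus> w)) = iprod H x (a \<odot> (v \<ominus> w))"
    using assms by (simp add: minus_eq_smult iprod_add_right iprod_smult_right algebra_simps
        del: smult_smult)
qed (use assms in auto)

text \<open>The equation is the fixed point equation of \<open>F\<close>, a contraction with
  constant R / |z| < 1; the solution is the limit of its iterates from 0.\<close>

lemma resolvent_surj:
  assumes T: "bounded_operator H T" and R: "R > 0"
    and contr: "\<And>x. x \<in> carrier H \<Longrightarrow> vnorm H (T x) \<le> R * vnorm H x"
    and z: "cmod z > R" and y: "y \<in> carrier H"
  shows "\<exists>l\<in>carrier H. z \<odot> l \<ominus> T l = y"
proof -
  define k where "k = R / cmod z"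
  have z0: "cmod z > 0" "z \<noteq> 0" using z R by auto
  have k: "0 \<le> k" "k < 1" using z R z0 by (auto simp: k_def)
  define F where "F x = (1 / z) \<odot> (y \<oplus> T x)" for x
  have F_cl: "F x \<in> carrier H" if "x \<in> carrier H" for x
    using that y T by (simp add: F_def bounded_operator_closed)
  have F_lip: "vnorm H (F x \<ominus> F x') \<le> k * vnorm H (x \<ominus> x')" if x: "x \<in> carrier H" "x' \<in> carrier H" for x x'
  proof -
    have "F x \<ominus> F x' = (1 / z) \<odot> T (x \<ominus> x')"
      unfolding F_def bounded_operator_minus[OF T x]
      by (rule smult_add_minus) (use x y T in \<open>auto simp: bounded_operator_closed\<close>)
    then have "vnorm H (F x \<ominus> F x') = vnorm H (T (x \<ominus> x')) / cmod z"
      using x T by (simp add: vnorm_smult bounded_operator_closed norm_divide)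
    also have "\<dots> \<le> R * vnorm H (x \<ominus> x') / cmod z"
      using x contr z0 by (intro divide_right_mono) auto
    finally show ?thesis by (simp add: k_def)
  qed
  define s where "s n = (F ^^ n) \<zero>" for n
  have s_Suc: "s (Suc n) = F (s n)" for n by (simp add: s_def)
  have s0: "s 0 = \<zero>" by (simp add: s_def)
  have s: "s n \<in> carrier H" for n by (induction n) (auto simp: s0 s_Suc F_cl)
  define c where "c = vnorm H (F \<zero>)"
  have c: "c \<ge> 0" by (simp add: c_def F_cl)
  have s_le: "vnorm H (s n) \<le> c / (1 - k)" for n
  proof (induction n)
    case 0
    then show ?case using c k by (simp add: s0)
  next
    case (Suc n)
    have "vnorm H (F (s n)) \<le> vnorm H (F (s n) \<ominus> F \<zero>) + c"
      using vnorm_diff_le[of "F (s n)" "F \<zero>"] by (simp add: c_def F_cl s)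
    also have "\<dots> \<le> k * vnorm H (s n) + c" using F_lip[of "s n" \<zero>] s by simp
    also have "\<dots> \<le> k * (c / (1 - k)) + c" by (rule add_right_mono[OF mult_left_mono[OF Suc k(1)]])
    also have "\<dots> = c / (1 - k)"
    proof -
      have "1 - k \<noteq> 0" using k by simp
      then show ?thesis by (simp add: field_simps)
    qed
    finally show ?case by (simp add: s_Suc)
  qed
  \<comment> \<open>Each step lowers both indices and gains a factor \<open>k\<close>, down to
    \<open>s m\<close> and \<open>s 0 = \<zero>\<close>, where the uniform bound \<open>s_le\<close>
    applies.\<close>
  have gap: "vnorm H (s (n + m) \<ominus> s n) \<le> k ^ n * (c / (1 - k))" for n m
  proof (induction n)
    case 0
    then show ?case using s_le[of m] s by (simp add: s0)
  next
    case (Suc n)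
    have "vnorm H (s (Suc n + m) \<ominus> s (Suc n)) \<le> k * vnorm H (s (n + m) \<ominus> s n)"
      using F_lip[OF s s] by (simp add: s_Suc)
    also have "\<dots> \<le> k * (k ^ n * (c / (1 - k)))" using Suc k by (intro mult_left_mono)
    finally show ?case by (simp add: mult.assoc)
  qed
  have "\<exists>N. \<forall>i\<ge>N. \<forall>j\<ge>N. vnorm H (s i \<ominus> s j) < e" if e: "e > 0" for e :: real
  proof -
    have "(\<lambda>n. k ^ n * (c / (1 - k))) \<longlonglongrightarrow> 0 * (c / (1 - k))"
      using k by (intro tendsto_intros LIMSEQ_power_zero) auto
    then have "\<forall>\<^sub>F n in sequentially. k ^ n * (c / (1 - k)) < e / 2"
      using e by (intro order_tendstoD(2)) auto
    then obtain N where N: "k ^ N * (c / (1 - k)) < e / 2" by (meson eventually_sequentially order_refl)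
    have "vnorm H (s i \<ominus> s j) < e" if ij: "i \<ge> N" "j \<ge> N" for i j
    proof -
      obtain a b where "i = N + a" "j = N + b" using ij le_Suc_ex by metis
      then have "vnorm H (s i \<ominus> s N) < e / 2" "vnorm H (s N \<ominus> s j) < e / 2"
        using le_less_trans[OF gap[of N a] N] le_less_trans[OF gap[of N b] N] vnorm_minus_commute[of "s N" "s j"] s
        by (simp_all del: times_divide_eq_right)
      then show ?thesis using vnorm_triangle_minus[of "s i" "s N" "s j"] s by simp
    qed
    then show ?thesis by blast
  qed
  from complete[OF s this] obtain l where l: "l \<in> carrier H" and lim: "(\<lambda>n. vnorm H (s n \<ominus> l)) \<longlonglongrightarrow> 0"
    by blast
  have "vnorm H (F l \<ominus> l) \<le> k * vnorm H (s n \<ominus> l) + vnorm H (s (Suc n) \<ominus> l)" for n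
    using vnorm_triangle_minus[OF F_cl[OF l] s l, of "Suc n"] F_lip[OF l s, of n]
      vnorm_minus_commute[OF l s, of n] by (simp add: s_Suc)
  moreover have "(\<lambda>n. k * vnorm H (s n \<ominus> l) + vnorm H (s (Suc n) \<ominus> l)) \<longlonglongrightarrow> k * 0 + 0"
    by (intro tendsto_intros lim LIMSEQ_Suc[OF lim])
  ultimately have "vnorm H (F l \<ominus> l) \<le> k * 0 + 0"
    by (intro LIMSEQ_le_const[of "\<lambda>n. k * vnorm H (s n \<ominus> l) + vnorm H (s (Suc n) \<ominus> l)"]) auto
  then have "F l = l" using F_cl[OF l] l by (intro eq_if_vnorm_minus_le_0) auto
  then have "z \<odot> l = z \<odot> F l" by simp
  also have "\<dots> = y \<oplus> T l" using z0 y T l by (simp add: F_def bounded_operator_closed)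
  finally have "z \<odot> l \<ominus> T l = y" using y T l by (simp add: bounded_operator_closed M.minus_eq M.a_assoc M.r_neg)
  then show ?thesis using l by blast
qed

text \<open>For |z| > R the operator z - T is bounded below by |z| - R. This makes it injective and
  bounds its inverse; injectivity also gives linearity of the inverse chosen from
  \<open>resolvent_surj\<close>.\<close>

lemma spectrum_subset_cball:
  assumes T: "bounded_operator H T" and R: "R > 0"
    and contr: "\<And>x. x \<in> carrier H \<Longrightarrow> vnorm H (T x) \<le> R * vnorm H x"
  shows "spectrum H T \<subseteq> {z. cmod z \<le> R}"
proof
  fix z assume spec: "z \<in> spectrum H T"
  show "z \<in> {z. cmod z \<le> R}"
  proof (rule ccontr)
    assume "z \<notin> {z. cmod z \<le> R}"
    then have z: "cmod z > R" by simp
    define A where "A x = z \<odot> x \<ominus> T x" for x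
    have A: "bounded_operator H A"
      unfolding A_def by (rule bounded_operator_diff[OF bounded_operator_scale[OF bounded_operator_id] T])
    have below: "(cmod z - R) * vnorm H x \<le> vnorm H (A x)" if x: "x \<in> carrier H" for x
    proof -
      have "cmod z * vnorm H x - vnorm H (T x) \<le> vnorm H (A x)"
        using vnorm_diff_le[of "z \<odot> x" "T x"] x T by (simp add: A_def vnorm_smult bounded_operator_closed)
      then show ?thesis using contr[OF x] by (simp add: algebra_simps)
    qed
    have inj: "x = x'" if x: "x \<in> carrier H" "x' \<in> carrier H" "A x = A x'" for x x'
    proof -
      have "A (x \<ominus> x') = A x' \<ominus> A x'" using bounded_operator_minus[OF A x(1,2)] x(3) by simp
      also have "\<dots> = \<zero>" using bounded_operator_closed[OF A x(2)] by (simp add: M.minus_eq M.r_neg)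
      finally have "A (x \<ominus> x') = \<zero>" .
      then have "(cmod z - R) * vnorm H (x \<ominus> x') \<le> 0" using below[of "x \<ominus> x'"] x by simp
      then show ?thesis using z x by (intro eq_if_vnorm_minus_le_0) (auto simp: mult_le_0_iff)
    qed
    obtain S where S: "\<And>y. y \<in> carrier H \<Longrightarrow> S y \<in> carrier H" "\<And>y. y \<in> carrier H \<Longrightarrow> A (S y) = y"
      using resolvent_surj[OF T R contr z] unfolding A_def by metis
    have "bounded_operator H S"
    proof (rule bounded_operatorI[of _ "1 / (cmod z - R)"])
      fix y assume y: "y \<in> carrier H"
      show "vnorm H (S y) \<le> 1 / (cmod z - R) * vnorm H y"
        using below[OF S(1)[OF y]] S(2)[OF y] z by (simp add: field_simps)
    next
      fix x y assume xy: "x \<in> carrier H" "y \<in> carrier H"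
      show "S (x \<oplus> y) = S x \<oplus> S y"
        by (rule inj) (use xy S A in \<open>auto simp: bounded_operator_add\<close>)
    next
      fix a x assume x: "x \<in> carrier H"
      show "S (a \<odot> x) = a \<odot> S x"
        by (rule inj) (use x S A in \<open>auto simp: bounded_operator_smult\<close>)
    qed (rule S)
    then have "invertible_operator H A"
      by (rule invertible_operatorI(1)[OF A]) (use A S inj in \<open>auto simp: bounded_operator_closed\<close>)
    then show False using spec by (simp add: spectrum_def A_def[abs_def])
  qed
qed

theorem spectral_set_cball:
  assumes T: "bounded_operator H T" and R: "R > 0"
    and contr: "\<And>x. x \<in> carrier H \<Longrightarrow> vnorm H (T x) \<le> R * vnorm H x"
  shows "spectral_set {z. cmod z \<le> R} H T"
  unfolding spectral_set_def
proof (intro conjI ballI)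
  show spec: "spectrum H T \<subseteq> {z. cmod z \<le> R}" by (rule spectrum_subset_cball[OF assms])
  fix f assume f: "f \<in> Rat {z. cmod z \<le> R}"
  obtain p q where pq: "f = (p, q)" by (cases f)
  have q: "q \<noteq> 0" "\<And>z. cmod z \<le> R \<Longrightarrow> poly q z \<noteq> 0" using f by (auto simp: Rat_def pq)
  define M where "M = (SUP z\<in>{z. cmod z \<le> R}. cmod (rat_eval f z))"
  have cball: "{z. cmod z \<le> R} = cball 0 R" by auto
  \<comment> \<open>Continuity on the compact disc keeps the supremum from being taken over an
    unbounded set.\<close>
  have "continuous_on {z. cmod z \<le> R} (\<lambda>z. cmod (rat_eval f z))"
    unfolding rat_eval_def pq by (intro continuous_intros) (use q in auto)
  then have "compact ((\<lambda>z. cmod (rat_eval f z)) ` {z. cmod z \<le> R})"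
    by (rule compact_continuous_image) (simp add: cball)
  then have "bdd_above ((\<lambda>z. cmod (rat_eval f z)) ` {z. cmod z \<le> R})"
    by (intro bounded_imp_bdd_above compact_imp_bounded)
  then have le: "cmod (rat_eval f z) \<le> M" if "cmod z \<le> R" for z
    unfolding M_def using that by (intro cSUP_upper) auto
  have M: "M \<ge> 0" using order_trans[OF norm_ge_zero le[of 0]] R by simp
  have inv: "invertible_operator H (poly_op H q T)"
    using q spec by (intro invertible_poly_op[OF T]) auto
  show "op_norm H (rat_op H f T) \<le> (SUP z\<in>{z. cmod z \<le> R}. cmod (rat_eval f z))"
    unfolding M_def[symmetric]
  proof (rule op_norm_le[OF M])
    fix x assume x: "x \<in> carrier H"
    \<comment> \<open>In terms of \<open>y\<close> the claim reads |p(T) y| <= M |q(T) y|, the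
      inverse-free form of \<open>von_Neumann_rational\<close>.\<close>
    define y where "y = op_inv H (poly_op H q T) x"
    have y: "y \<in> carrier H"
      unfolding y_def using bounded_operator_closed[OF op_inv_bounded[OF inv] x] .
    have "vnorm H (poly_op H p T y) \<le> M * vnorm H (poly_op H q T y)"
    proof (rule von_Neumann_rational[OF T R contr y q(2)])
      fix z assume z: "cmod z \<le> R"
      show "cmod (poly p z) \<le> M * cmod (poly q z)"
        using le[OF z] q(2)[OF z] by (simp add: rat_eval_def pq norm_divide field_simps)
    qed
    then show "vnorm H (rat_op H f T x) \<le> M * vnorm H x"
      using op_inv_right[OF inv x] by (simp add: rat_op_def pq y_def)
  qed
qed

text \<open>Adjoints disappear in the quadratic form, which at \<open>x\<close> is c |x|^2 minus the
  squared norms of T x and of the inverse at x.\<close>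

lemma positive_operator_PA_iff:
  assumes T: "invertible_operator H T"
  shows "positive_operator H (\<lambda>x. complex_of_real c \<odot> x \<ominus> adjoint_op H T (T x)
           \<ominus> adjoint_op H (op_inv H T) (op_inv H T x))
     \<longleftrightarrow> (\<forall>x\<in>carrier H. (vnorm H (T x))\<^sup>2 + (vnorm H (op_inv H T x))\<^sup>2 \<le> c * (vnorm H x)\<^sup>2)"
proof -
  note b = invertible_operator_bounded[OF T] op_inv_bounded[OF T]
  note adj = adjoint_op(1)[OF b(1)] adjoint_op(1)[OF b(2)]
  define A where "A x = complex_of_real c \<odot> x \<ominus> adjoint_op H T (T x)
           \<ominus> adjoint_op H (op_inv H T) (op_inv H T x)" for x
  have "bounded_operator H A"
    unfolding A_def by (intro bounded_operator_diff bounded_operator_scale bounded_operator_id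
        bounded_operator_comp[OF adj(1) b(1)] bounded_operator_comp[OF adj(2) b(2)])
  moreover have "iprod H (A x) x
      = of_real (c * (vnorm H x)\<^sup>2 - (vnorm H (T x))\<^sup>2 - (vnorm H (op_inv H T x))\<^sup>2)"
    if x: "x \<in> carrier H" for x
    using x b adj
    by (simp add: A_def minus_eq_smult iprod_add_left iprod_smult_left bounded_operator_closed iprod_adjoint_self iprod_self)
  ultimately have "positive_operator H A
      \<longleftrightarrow> (\<forall>x\<in>carrier H. complex_of_real (c * (vnorm H x)\<^sup>2 - (vnorm H (T x))\<^sup>2 - (vnorm H (op_inv H T x))\<^sup>2) \<in> \<real>\<^sub>\<ge>\<^sub>0)"
    by (simp add: positive_operator_def)
  also have "\<dots> \<longleftrightarrow> (\<forall>x\<in>carrier H. (vnorm H (T x))\<^sup>2 + (vnorm H (op_inv H T x))\<^sup>2 \<le> c * (vnorm H x)\<^sup>2)"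
    by (simp only: nonneg_Reals_of_real_iff) (simp add: algebra_simps)
  finally show ?thesis unfolding A_def .
qed

text \<open>
  The optimal constant \<open>C\<close> in \<open>\<parallel>T x\<parallel>\<^sup>2 \<le> C \<parallel>x\<parallel>\<^sup>2\<close> satisfies \<open>C \<le> R\<^sup>2 + R\<^sup>-\<^sup>2 - 1 / C\<close>, because
  \<open>\<parallel>x\<parallel>\<^sup>2 \<le> C \<parallel>T\<^sup>-\<^sup>1 x\<parallel>\<^sup>2\<close>.
\<close>

lemma PA_imp_contraction:
  assumes T: "invertible_operator H T" and R: "R \<ge> 1"
    and PA: "\<And>x. x \<in> carrier H \<Longrightarrow>
      (vnorm H (T x))\<^sup>2 + (vnorm H (op_inv H T x))\<^sup>2 \<le> (R\<^sup>2 + 1 / R\<^sup>2) * (vnorm H x)\<^sup>2"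
    and x: "x \<in> carrier H"
  shows "vnorm H (T x) \<le> R * vnorm H x"
proof -
  note b = invertible_operator_bounded[OF T] op_inv_bounded[OF T]
  define N where "N = op_norm H T"
  have le: "vnorm H (T x) \<le> N * vnorm H x" if "x \<in> carrier H" for x
    unfolding N_def using b(1) that by (rule vnorm_le_op_norm)
  have "N \<le> R"
  proof (rule ccontr)
    assume "\<not> N \<le> R"
    then have NR: "N > R" by simp
    then have N: "N > 1" using R by simp
    define D where "D = R\<^sup>2 + 1 / R\<^sup>2 - 1 / N\<^sup>2"
    have step: "(vnorm H (T x))\<^sup>2 \<le> D * (vnorm H x)\<^sup>2" if x: "x \<in> carrier H" for x
    proof -
      have "vnorm H x \<le> N * vnorm H (op_inv H T x)"
        using le[of "op_inv H T x"] op_inv_right[OF T x] b x by (simp add: bounded_operator_closed)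
      then have "(vnorm H x)\<^sup>2 \<le> (N * vnorm H (op_inv H T x))\<^sup>2" using x by (intro power_mono) auto
      then have "(vnorm H x)\<^sup>2 / N\<^sup>2 \<le> (vnorm H (op_inv H T x))\<^sup>2"
        using N by (simp add: field_simps)
      then show ?thesis using PA[OF x] by (simp add: D_def algebra_simps)
    qed
    have R2: "R\<^sup>2 \<ge> 1" using R by simp
    have N2: "N\<^sup>2 > R\<^sup>2" using NR R by (intro power_strict_mono) auto
    have D0: "D \<ge> 0"
    proof -
      have "1 / N\<^sup>2 \<le> 1 / R\<^sup>2" using N2 R2 by (intro frac_le) linarith+
      then show ?thesis using zero_le_power2[of R] unfolding D_def by linarith
    qed
    have "vnorm H (T x) \<le> sqrt D * vnorm H x" if x: "x \<in> carrier H" for x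
      using real_sqrt_le_mono[OF step[OF x]] x b by (simp add: real_sqrt_mult bounded_operator_closed)
    then have "N \<le> sqrt D" unfolding N_def using D0 by (intro op_norm_le) auto
    then have "N\<^sup>2 \<le> (sqrt D)\<^sup>2" using N by (intro power_mono) auto
    then have "N\<^sup>2 \<le> D" using D0 by simp
    \<comment> \<open>The inequality says N^2 + N^-2 <= R^2 + R^-2, which fails for N > R >= 1
      because t + 1 / t is strictly increasing for t >= 1.\<close>
    then have "N\<^sup>2 - R\<^sup>2 \<le> 1 / R\<^sup>2 - 1 / N\<^sup>2" by (simp add: D_def)
    also have "1 / R\<^sup>2 - 1 / N\<^sup>2 = (N\<^sup>2 - R\<^sup>2) / (R\<^sup>2 * N\<^sup>2)"
      using N R by (simp add: field_simps)
    also have "\<dots> < (N\<^sup>2 - R\<^sup>2) / 1"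
    proof (rule divide_strict_left_mono)
      show "1 < R\<^sup>2 * N\<^sup>2" using R2 N2 mult_mono[of 1 "R\<^sup>2" "N\<^sup>2" "N\<^sup>2"] by simp
    qed (use N2 R N in \<open>auto intro!: mult_pos_pos\<close>)
    finally show False by simp
  qed
  then show ?thesis using le[OF x] x by (meson mult_right_mono order_trans vnorm_nonneg)
qed

end

section \<open>An almost inner function with a pole off a given set\<close>

text \<open>The average of |h|^2 over N equally spaced points of the circle is exactly the
  coefficient sum once N exceeds the degree, so no integral is involved. Constant polynomials play
  the part of scalars in \<open>parseval\<close>.\<close>

lemma Parseval_lower_bound:
  assumes R: "R > 0" and m: "m \<ge> 0" "\<And>z. cmod z = R \<Longrightarrow> m \<le> cmod (poly h z)"
  shows "m\<^sup>2 \<le> (\<Sum>j\<le>degree h. (cmod (coeff h j))\<^sup>2 * R ^ (2 * j))"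
proof -
  define N where "N = Suc (degree h)"
  interpret hermitian_form "\<lambda>p q :: complex poly. coeff p 0 * cnj (coeff q 0)"
    by standard (auto simp: algebra_simps)
  define x where "x k = [:coeff h k * of_real R ^ k:]" for k
  have "coeff (\<Sum>k<N. Polynomial.smult (root_unity N (int k * int n)) (x k)) 0
      = poly h (of_real R * root_unity N (int n))" for n
    by (simp add: N_def x_def coeff_sum poly_altdef power_mult_distrib lessThan_Suc_atMost mult_ac
        flip: root_unity_mult_nat)
  then have "(\<Sum>n<N. (poly h (of_real R * root_unity N (int n)) * cnj (poly h (of_real R * root_unity N (int n)))))
      = of_nat N * (\<Sum>k<N. coeff (x k) 0 * cnj (coeff (x k) 0))"
    using parseval[of N x] by (simp add: N_def del: of_nat_Suc)
  then have "of_real (\<Sum>n<N. (cmod (poly h (of_real R * root_unity N (int n))))\<^sup>2)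
      = (of_real (real N * (\<Sum>k<N. (cmod (coeff (x k) 0))\<^sup>2)) :: complex)"
    by (simp add: complex_norm_square del: of_real_power)
  then have eq: "(\<Sum>n<N. (cmod (poly h (of_real R * root_unity N (int n))))\<^sup>2)
      = real N * (\<Sum>k<N. (cmod (coeff (x k) 0))\<^sup>2)"
    by (simp only: of_real_eq_iff)
  have "real N * m\<^sup>2 = (\<Sum>n<N. m\<^sup>2)" by simp
  also have "\<dots> \<le> (\<Sum>n<N. (cmod (poly h (of_real R * root_unity N (int n))))\<^sup>2)"
    using R m by (intro sum_mono power_mono) (auto simp: norm_mult)
  finally have "real N * m\<^sup>2 \<le> real N * (\<Sum>k<N. (cmod (coeff (x k) 0))\<^sup>2)" by (simp only: eq)
  then have "m\<^sup>2 \<le> (\<Sum>k<N. (cmod (coeff (x k) 0))\<^sup>2)" by (simp add: N_def)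
  also have "\<dots> = (\<Sum>j\<le>degree h. (cmod (coeff h j))\<^sup>2 * R ^ (2 * j))"
    using R by (simp add: N_def x_def lessThan_Suc_atMost norm_mult norm_power power_mult_distrib
        power_mult power_even_abs mult.commute flip: power_mult)
  finally show ?thesis .
qed

text \<open>The difference of the squares, right minus left, is (1 - \<sigma>^2) (\<sigma>^2 - 2 b
  Re x - b^2 (1 + \<sigma>^2 + \<sigma>^4)). With b <= \<sigma> / 3 the two subtracted terms are at
  most 2/3 and 1/3 of \<sigma>^2. It is applied with x = \<zeta>^2 and |\<zeta>| = \<sigma>.\<close>

lemma Blaschke_square_le:
  fixes x :: complex
  assumes x: "cmod x = \<sigma>\<^sup>2" and \<sigma>: "0 < \<sigma>" "\<sigma> \<le> 1" and b: "0 \<le> b" "b \<le> \<sigma> / 3"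
  shows "cmod (of_real b + x) \<le> \<sigma> * cmod (1 + of_real b * x)"
proof (rule power2_le_imp_le)
  have b2: "b\<^sup>2 \<le> \<sigma>\<^sup>2 / 9" using power_mono[OF b(2) b(1), of 2] by (simp add: power_divide)
  have \<sigma>2: "\<sigma>\<^sup>2 \<le> 1" "\<sigma>\<^sup>2 \<ge> 0" using \<sigma> by (auto intro: power_le_one)
  have \<sigma>4: "(\<sigma>\<^sup>2)\<^sup>2 \<le> 1" using power_le_one[OF \<sigma>2(2,1), of 2] .
  have "b * Re x \<le> (1 / 3) * \<sigma>\<^sup>2"
  proof -
    have "b * Re x \<le> b * \<sigma>\<^sup>2" using b(1) x complex_Re_le_cmod[of x] by (intro mult_left_mono) auto
    also have "\<dots> \<le> (1 / 3) * \<sigma>\<^sup>2" using b \<sigma> by (intro mult_right_mono) auto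
    finally show ?thesis .
  qed
  moreover have "b\<^sup>2 * (1 + \<sigma>\<^sup>2 + (\<sigma>\<^sup>2)\<^sup>2) \<le> \<sigma>\<^sup>2 / 9 * 3"
    using b2 \<sigma>2 \<sigma>4 by (intro mult_mono) auto
  ultimately have "0 \<le> \<sigma>\<^sup>2 - 2 * (b * Re x) - b\<^sup>2 * (1 + \<sigma>\<^sup>2 + (\<sigma>\<^sup>2)\<^sup>2)" by linarith
  then have "0 \<le> (1 - \<sigma>\<^sup>2) * (\<sigma>\<^sup>2 - 2 * (b * Re x) - b\<^sup>2 * (1 + \<sigma>\<^sup>2 + (\<sigma>\<^sup>2)\<^sup>2))"
    using \<sigma>2 by simp
  moreover have x2: "(Re x)\<^sup>2 + (Im x)\<^sup>2 = (\<sigma>\<^sup>2)\<^sup>2" using x cmod_power2[of x] by simp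
  have "(cmod (of_real b + x))\<^sup>2 = b\<^sup>2 + 2 * (b * Re x) + ((Re x)\<^sup>2 + (Im x)\<^sup>2)"
    by (simp add: cmod_power2 power2_sum)
  moreover have "(cmod (1 + of_real b * x))\<^sup>2 = 1 + 2 * (b * Re x) + b\<^sup>2 * ((Re x)\<^sup>2 + (Im x)\<^sup>2)"
    by (simp add: cmod_power2 power2_sum power_mult_distrib algebra_simps)
  ultimately show "(cmod (of_real b + x))\<^sup>2 \<le> (\<sigma> * cmod (1 + of_real b * x))\<^sup>2"
    unfolding power_mult_distrib x2 by (simp add: algebra_simps power2_eq_square)
qed (use \<sigma> in simp)

text \<open>For |w| < R the right side is non-negative on the disc |z| <= R and zero on its
  boundary: hence |\<zeta>| <= 1 inside and |\<zeta>| = 1 on the circle.\<close>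

lemma norm_pseudohyperbolic:
  fixes z w :: complex
  shows "(cmod (of_real (R\<^sup>2) - cnj w * z))\<^sup>2 - (cmod (of_real R * (z - w)))\<^sup>2
       = (R\<^sup>2 - (cmod z)\<^sup>2) * (R\<^sup>2 - (cmod w)\<^sup>2)"
  unfolding cmod_power2 by (simp add: power2_eq_square) (simp add: algebra_simps)

text \<open>
  With \<open>\<zeta> = R (z - w) / (R\<^sup>2 - cnj w z)\<close>, which is unimodular on \<open>|z| = R\<close>, the function
  \<open>(b + \<zeta>\<^sup>2) / (\<zeta> (1 + b \<zeta>\<^sup>2))\<close> has modulus \<open>1\<close> on \<open>|z| = R\<close>, is bounded by \<open>1\<close> on \<open>X\<close> for small
  \<open>b > 0\<close>, and has a pole at \<open>w\<close>. The polynomial \<open>P\<close> approximates \<open>z - w\<close> times this function.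
\<close>

lemma almost_inner_function:
  assumes w: "cmod w < R" "w \<notin> X" and X: "closed X" "X \<subseteq> {z. cmod z \<le> R}"
  obtains \<kappa> where "\<kappa> > 0"
    "\<And>\<epsilon>. 0 < \<epsilon> \<Longrightarrow> \<exists>P. (\<forall>z\<in>X. cmod (poly P z) \<le> (1 + \<epsilon>) * cmod (z - w)) \<and>
       (\<forall>z. cmod z = R \<longrightarrow> (1 - \<epsilon>) * cmod (z - w) \<le> cmod (poly P z)) \<and> (1 - \<epsilon>) * \<kappa> \<le> cmod (poly P w)"
proof -
  have R: "R > 0" using w(1) norm_ge_zero[of w] by linarith
  obtain \<delta> where \<delta>: "\<delta> > 0" "\<And>z. z \<in> X \<Longrightarrow> \<delta> \<le> dist w z"
    using separate_point_closed[OF X(1) w(2)] by blast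
  \<comment> \<open>A lower bound for |\<zeta>| on \<open>X\<close>: there R |z - w| >= R \<delta>,
    while the denominator is at most 2 R^2. The choice \<open>b = s / 3\<close> is the hypothesis of
    \<open>Blaschke_square_le\<close>.\<close>
  define s where "s = min (\<delta> / (2 * R)) 1"
  have s: "0 < s" "s \<le> 1" "s \<le> \<delta> / (2 * R)" using \<delta> R by (auto simp: s_def)
  define b where "b = s / 3"
  have b: "0 < b" "b < 1" using s by (auto simp: b_def)
  \<comment> \<open>\<open>U / V\<close> is \<zeta>, and \<open>N / Q\<close> is z - w times the
    function described above: z - w cancels against \<open>U\<close>, which removes the
    pole.\<close>
  define U where "U = [:- of_real R * w, of_real R:]"
  define V where "V = [:of_real (R\<^sup>2), - cnj w:]"
  define N where "N = V * (Polynomial.smult (of_real b) (V\<^sup>2) + U\<^sup>2)"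
  define Q where "Q = Polynomial.smult (of_real R) (V\<^sup>2 + Polynomial.smult (of_real b) (U\<^sup>2))"
  have U: "poly U z = of_real R * (z - w)" for z by (simp add: U_def algebra_simps)
  have V: "poly V z = of_real (R\<^sup>2) - cnj w * z" for z by (simp add: V_def)
  have N: "poly N z = poly V z * (of_real b * (poly V z)\<^sup>2 + (poly U z)\<^sup>2)" for z by (simp add: N_def)
  have Q: "poly Q z = of_real R * ((poly V z)\<^sup>2 + of_real b * (poly U z)\<^sup>2)" for z by (simp add: Q_def)
  have w2: "(cmod w)\<^sup>2 < R\<^sup>2" using w by (intro power_strict_mono) auto
  have V0: "poly V z \<noteq> 0" and UV: "cmod (poly U z) \<le> cmod (poly V z)" if z: "cmod z \<le> R" for z
  proof -
    have "cmod (cnj w * z) \<le> cmod w * R" using z by (simp add: norm_mult mult_left_mono)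
    also have "\<dots> < R * R" using w(1) R by simp
    finally have "cmod (cnj w * z) < cmod (of_real (R\<^sup>2))" by (simp add: power2_eq_square norm_mult)
    then show "poly V z \<noteq> 0" unfolding V by force
    have "(cmod z)\<^sup>2 \<le> R\<^sup>2" using z by (intro power_mono) auto
    then have "0 \<le> (R\<^sup>2 - (cmod z)\<^sup>2) * (R\<^sup>2 - (cmod w)\<^sup>2)" using w2 by simp
    then have "(cmod (poly U z))\<^sup>2 \<le> (cmod (poly V z))\<^sup>2"
      unfolding U V using norm_pseudohyperbolic[of R w z] by linarith
    then show "cmod (poly U z) \<le> cmod (poly V z)" by (rule power2_le_imp_le) simp
  qed
  have Q0: "poly Q z \<noteq> 0" if z: "cmod z \<le> R" for z
  proof
    assume "poly Q z = 0"
    then have "(poly V z)\<^sup>2 = - (of_real b * (poly U z)\<^sup>2)" using R by (simp add: Q add_eq_0_iff2)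
    then have "(cmod (poly V z))\<^sup>2 = b * (cmod (poly U z))\<^sup>2"
      using b by (metis norm_minus_cancel norm_mult norm_of_real norm_power abs_of_pos)
    also have "\<dots> \<le> b * (cmod (poly V z))\<^sup>2"
      using UV[OF z] b by (intro mult_left_mono power_mono) auto
    finally have "(1 - b) * (cmod (poly V z))\<^sup>2 \<le> 0" by (simp add: algebra_simps)
    then show False using b V0[OF z] by (simp add: mult_le_0_iff)
  qed
  have ratio: "poly N z = poly V z ^ 3 * (of_real b + x)" "poly Q z = of_real R * (poly V z)\<^sup>2 * (1 + of_real b * x)"
    if "cmod z \<le> R" "x = (poly U z / poly V z)\<^sup>2" for z x
    using V0[OF that(1)] by (simp_all add: N Q that(2) power_divide field_simps power2_eq_square power3_eq_cube)
  have NQ_X: "cmod (poly N z) \<le> cmod (z - w) * cmod (poly Q z)" if z: "z \<in> X" for z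
  proof -
    have zR: "cmod z \<le> R" using X z by auto
    define \<sigma> where "\<sigma> = cmod (poly U z) / cmod (poly V z)"
    define x where "x = (poly U z / poly V z)\<^sup>2"
    have Vp: "cmod (poly V z) > 0" using V0[OF zR] by simp
    have "\<sigma> \<le> 1" using UV[OF zR] Vp by (simp add: \<sigma>_def)
    have "cmod (poly V z) \<le> 2 * R\<^sup>2"
    proof -
      have "cmod (poly V z) \<le> cmod (of_real (R\<^sup>2)) + cmod (cnj w * z)"
        unfolding V by (rule norm_triangle_ineq4)
      also have "cmod (cnj w * z) \<le> R * R" using w zR R by (auto simp: norm_mult intro!: mult_mono)
      finally show ?thesis by (simp add: power2_eq_square norm_mult)
    qed
    have "s * cmod (poly V z) \<le> \<delta> / (2 * R) * (2 * R\<^sup>2)"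
      using s \<open>cmod (poly V z) \<le> 2 * R\<^sup>2\<close> \<delta> R by (intro mult_mono) auto
    also have "\<dots> = R * \<delta>" using R by (simp add: power2_eq_square)
    also have "\<dots> \<le> cmod (poly U z)"
      using \<delta>(2)[OF z] R by (simp add: U norm_mult dist_norm norm_minus_commute)
    finally have "s \<le> \<sigma>" using Vp by (simp add: \<sigma>_def field_simps)
    then have le: "cmod (of_real b + x) \<le> \<sigma> * cmod (1 + of_real b * x)"
      using \<open>\<sigma> \<le> 1\<close> s b by (intro Blaschke_square_le) (auto simp: x_def \<sigma>_def b_def norm_power norm_divide)
    have "cmod (poly N z) = cmod (poly V z) ^ 3 * cmod (of_real b + x)"
      by (simp add: ratio(1)[OF zR x_def] norm_mult norm_power)
    also have "\<dots> \<le> cmod (poly V z) ^ 3 * (\<sigma> * cmod (1 + of_real b * x))"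
      by (intro mult_left_mono le) simp
    also have "\<dots> = cmod (poly U z) * (cmod (poly V z))\<^sup>2 * cmod (1 + of_real b * x)"
      using Vp by (simp add: \<sigma>_def power2_eq_square power3_eq_cube)
    also have "\<dots> = cmod (z - w) * cmod (poly Q z)"
      using R by (simp add: ratio(2)[OF zR x_def] U norm_mult norm_power)
    finally show ?thesis .
  qed
  have NQ_R: "cmod (poly N z) = cmod (z - w) * cmod (poly Q z)" if z: "cmod z = R" for z
  proof -
    have zR: "cmod z \<le> R" using z by simp
    define x where "x = (poly U z / poly V z)\<^sup>2"
    have "(cmod (poly V z))\<^sup>2 = (cmod (poly U z))\<^sup>2"
      unfolding U V using norm_pseudohyperbolic[of R w z] unfolding z by simp
    then have eq: "cmod (poly V z) = cmod (poly U z)" by (simp add: power2_eq_iff_nonneg)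
    have "cmod (poly V z) \<noteq> 0" using V0[OF zR] by simp
    then have x1: "cmod x = 1" using eq by (simp add: x_def norm_power norm_divide)
    \<comment> \<open>For unimodular x the numerator b + x is x times the conjugate of the
      denominator 1 + b x.\<close>
    have "x * cnj (1 + of_real b * x) = x + of_real b * (x * cnj x)" by (simp add: algebra_simps)
    also have "x * cnj x = 1" using x1 complex_norm_square[of x] by simp
    finally have "cmod (of_real b + x) = cmod (x * cnj (1 + of_real b * x))" by (simp add: add.commute)
    also have "\<dots> = cmod (1 + of_real b * x)" using x1 by (simp only: norm_mult complex_mod_cnj)
    finally have le: "cmod (of_real b + x) = cmod (1 + of_real b * x)" .
    have "cmod (poly N z) = cmod (poly V z) ^ 3 * cmod (1 + of_real b * x)"
      by (simp add: ratio(1)[OF zR x_def] norm_mult norm_power le)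
    also have "\<dots> = cmod (poly U z) * (cmod (poly V z))\<^sup>2 * cmod (1 + of_real b * x)"
      by (simp add: eq power2_eq_square power3_eq_cube)
    also have "\<dots> = cmod (z - w) * cmod (poly Q z)"
      using R by (simp add: ratio(2)[OF zR x_def] U norm_mult norm_power)
    finally show ?thesis .
  qed
  \<comment> \<open>The modulus of the residue at \<open>w\<close>. It is non-zero because of
    \<open>b > 0\<close>; with b = 0 the function would be \<zeta> itself, without a pole.\<close>
  define \<kappa> where "\<kappa> = cmod (poly N w) / cmod (poly Q w)"
  have wR: "cmod w \<le> R" using w by simp
  have "poly N w \<noteq> 0" using V0[OF wR] b by (simp add: N U)
  then have \<kappa>: "\<kappa> > 0" using Q0[OF wR] by (simp add: \<kappa>_def)
  show ?thesis
  proof (rule that[OF \<kappa>])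
    fix \<epsilon> :: real assume e: "0 < \<epsilon>"
    obtain s where s: "\<And>z. cmod z \<le> R \<Longrightarrow> cmod (poly s z * poly Q z - 1) \<le> \<epsilon>"
      using approx_inverse_poly[OF R Q0 e] by blast
    have sQ: "1 - \<epsilon> \<le> cmod (poly Q z) * cmod (poly s z)" "cmod (poly Q z) * cmod (poly s z) \<le> 1 + \<epsilon>"
      if "cmod z \<le> R" for z
      using s[OF that] norm_triangle_sub[of "poly s z * poly Q z" 1]
        norm_triangle_sub[of 1 "poly s z * poly Q z"]
      by (simp_all add: norm_mult norm_minus_commute mult.commute)
    show "\<exists>P. (\<forall>z\<in>X. cmod (poly P z) \<le> (1 + \<epsilon>) * cmod (z - w)) \<and>
       (\<forall>z. cmod z = R \<longrightarrow> (1 - \<epsilon>) * cmod (z - w) \<le> cmod (poly P z)) \<and> (1 - \<epsilon>) * \<kappa> \<le> cmod (poly P w)"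
    proof (intro exI[of _ "N * s"] conjI ballI allI impI)
      fix z assume z: "z \<in> X"
      have "cmod (poly (N * s) z) \<le> cmod (z - w) * cmod (poly Q z) * cmod (poly s z)"
        using NQ_X[OF z] by (auto simp: norm_mult intro!: mult_right_mono)
      also have "\<dots> = cmod (z - w) * (cmod (poly Q z) * cmod (poly s z))" by simp
      also have "\<dots> \<le> cmod (z - w) * (1 + \<epsilon>)" using z X by (intro mult_left_mono sQ) auto
      finally show "cmod (poly (N * s) z) \<le> (1 + \<epsilon>) * cmod (z - w)" by (simp add: mult.commute)
    next
      fix z assume z: "cmod z = R"
      have "cmod (z - w) * (1 - \<epsilon>) \<le> cmod (z - w) * (cmod (poly Q z) * cmod (poly s z))"
        using z by (intro mult_left_mono sQ) auto
      also have "\<dots> = cmod (poly (N * s) z)" using NQ_R[OF z] by (simp add: norm_mult)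
      finally show "(1 - \<epsilon>) * cmod (z - w) \<le> cmod (poly (N * s) z)" by (simp add: mult.commute)
    next
      have "\<kappa> * (1 - \<epsilon>) \<le> \<kappa> * (cmod (poly Q w) * cmod (poly s w))"
        using wR \<kappa> by (intro mult_left_mono sQ) auto
      also have "\<dots> = cmod (poly (N * s) w)" using Q0[OF wR] by (simp add: \<kappa>_def norm_mult)
      finally show "(1 - \<epsilon>) * \<kappa> \<le> cmod (poly (N * s) w)" by (simp add: mult.commute)
    qed
  qed
qed

section \<open>Weighted sequence spaces\<close>

definition weighted_l2 :: "('i \<Rightarrow> real) \<Rightarrow> ('i \<Rightarrow> complex) set" where
  "weighted_l2 \<omega> = {x. (\<lambda>n. \<omega> n * (cmod (x n))\<^sup>2) summable_on UNIV}"

definition weighted_sqnorm :: "('i \<Rightarrow> real) \<Rightarrow> ('i \<Rightarrow> complex) \<Rightarrow> real" where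
  "weighted_sqnorm \<omega> x = (\<Sum>\<^sub>\<infinity>n. \<omega> n * (cmod (x n))\<^sup>2)"

definition weighted_iprod :: "('i \<Rightarrow> real) \<Rightarrow> ('i \<Rightarrow> complex) \<Rightarrow> ('i \<Rightarrow> complex) \<Rightarrow> complex" where
  "weighted_iprod \<omega> x y = (\<Sum>\<^sub>\<infinity>n. of_real (\<omega> n) * x n * cnj (y n))"

text \<open>No summability is assumed: taking real parts shows that it fails on both sides together,
  and then both sums have the default value 0.\<close>

lemma infsum_complex_of_real: "(\<Sum>\<^sub>\<infinity>n\<in>A. complex_of_real (f n)) = of_real (\<Sum>\<^sub>\<infinity>n\<in>A. f n)"
proof (cases "f summable_on A")
  case True
  then show ?thesis by (intro infsumI has_sum_of_real has_sum_infsum)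
next
  case False
  have "\<not> (\<lambda>n. complex_of_real (f n)) summable_on A"
    using summable_on_bounded_linear[OF bounded_linear_Re, of "\<lambda>n. complex_of_real (f n)" A] False
    by (auto simp: o_def)
  then show ?thesis using False by (simp add: infsum_not_exists)
qed

lemma norm_add_power2_le: "(norm (a + b))\<^sup>2 \<le> 2 * (norm a)\<^sup>2 + 2 * (norm (b :: 'b :: real_normed_vector))\<^sup>2"
proof -
  have "(norm (a + b))\<^sup>2 \<le> (norm a + norm b)\<^sup>2" by (intro power_mono norm_triangle_ineq norm_ge_zero)
  also have "\<dots> \<le> 2 * (norm a)\<^sup>2 + 2 * (norm b)\<^sup>2"
    using zero_le_power2[of "norm a - norm b"] by (simp add: power2_sum power2_diff)
  finally show ?thesis .
qed

context
  fixes \<omega> :: "'i \<Rightarrow> real"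
  assumes \<omega>: "\<And>n. \<omega> n > 0"
begin

lemma weighted_l2_add:
  assumes "x \<in> weighted_l2 \<omega>" "y \<in> weighted_l2 \<omega>"
  shows "(\<lambda>n. x n + y n) \<in> weighted_l2 \<omega>"
proof -
  have "(\<lambda>n. 2 * (\<omega> n * (cmod (x n))\<^sup>2) + 2 * (\<omega> n * (cmod (y n))\<^sup>2)) summable_on UNIV"
    using assms unfolding weighted_l2_def by (intro summable_on_add summable_on_cmult_right) auto
  then have "(\<lambda>n. \<omega> n * (cmod (x n + y n))\<^sup>2) summable_on UNIV"
  proof (rule summable_on_comparison_test)
    fix n
    show "\<omega> n * (cmod (x n + y n))\<^sup>2 \<le> 2 * (\<omega> n * (cmod (x n))\<^sup>2) + 2 * (\<omega> n * (cmod (y n))\<^sup>2)"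
      using mult_left_mono[OF norm_add_power2_le[of "x n" "y n"] less_imp_le[OF \<omega>[of n]]]
      by (simp add: algebra_simps)
  qed (use less_imp_le[OF \<omega>] in auto)
  then show ?thesis by (simp add: weighted_l2_def)
qed

lemma weighted_l2_smult:
  assumes "x \<in> weighted_l2 \<omega>"
  shows "(\<lambda>n. c * x n) \<in> weighted_l2 \<omega>"
proof -
  have "(\<lambda>n. (cmod c)\<^sup>2 * (\<omega> n * (cmod (x n))\<^sup>2)) summable_on UNIV"
    using assms unfolding weighted_l2_def by (intro summable_on_cmult_right) auto
  then show ?thesis by (simp add: weighted_l2_def norm_mult power_mult_distrib mult_ac)
qed

lemma weighted_l2_0: "(\<lambda>n. 0) \<in> weighted_l2 \<omega>"
  by (simp add: weighted_l2_def)

lemma weighted_l2_diff: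
  assumes "x \<in> weighted_l2 \<omega>" "y \<in> weighted_l2 \<omega>"
  shows "(\<lambda>n. x n - y n) \<in> weighted_l2 \<omega>"
  using weighted_l2_add[OF assms(1) weighted_l2_smult[OF assms(2), of "-1"]] by simp

lemma weighted_iprod_summable:
  assumes "x \<in> weighted_l2 \<omega>" "y \<in> weighted_l2 \<omega>"
  shows "(\<lambda>n. of_real (\<omega> n) * x n * cnj (y n)) summable_on UNIV"
proof (rule abs_summable_summable)
  have "(\<lambda>n. \<omega> n * (cmod (x n))\<^sup>2 + \<omega> n * (cmod (y n))\<^sup>2) summable_on UNIV"
    using assms unfolding weighted_l2_def by (intro summable_on_add) auto
  then show "(\<lambda>n. norm (of_real (\<omega> n) * x n * cnj (y n))) summable_on UNIV"
  proof (rule summable_on_comparison_test)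
    fix n
    have "cmod (x n) * cmod (y n) \<le> (cmod (x n))\<^sup>2 + (cmod (y n))\<^sup>2"
    proof -
      have "2 * (cmod (x n) * cmod (y n)) \<le> (cmod (x n))\<^sup>2 + (cmod (y n))\<^sup>2"
        using zero_le_power2[of "cmod (x n) - cmod (y n)"] by (simp add: power2_diff)
      moreover have "0 \<le> cmod (x n) * cmod (y n)" by simp
      ultimately show ?thesis by linarith
    qed
    from mult_left_mono[OF this less_imp_le[OF \<omega>[of n]]]
    show "norm (of_real (\<omega> n) * x n * cnj (y n)) \<le> \<omega> n * (cmod (x n))\<^sup>2 + \<omega> n * (cmod (y n))\<^sup>2"
      using less_imp_le[OF \<omega>[of n]] by (simp add: norm_mult algebra_simps)
  qed auto
qed

lemma weighted_iprod_self: "weighted_iprod \<omega> x x = of_real (weighted_sqnorm \<omega> x)"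
proof -
  have "of_real (\<omega> n) * x n * cnj (x n) = of_real (\<omega> n * (cmod (x n))\<^sup>2)" for n
    by (simp add: complex_norm_square mult_ac del: of_real_power)
  then show ?thesis by (simp only: weighted_iprod_def weighted_sqnorm_def infsum_complex_of_real)
qed

lemma weighted_sqnorm_nonneg: "weighted_sqnorm \<omega> x \<ge> 0"
  unfolding weighted_sqnorm_def using less_imp_le[OF \<omega>] by (intro infsum_nonneg) auto

lemma weighted_coeff_le:
  assumes "x \<in> weighted_l2 \<omega>"
  shows "\<omega> n * (cmod (x n))\<^sup>2 \<le> weighted_sqnorm \<omega> x"
  using finite_sum_le_infsum[of "\<lambda>n. \<omega> n * (cmod (x n))\<^sup>2" UNIV "{n}"] assms less_imp_le[OF \<omega>]
  by (simp add: weighted_l2_def weighted_sqnorm_def)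

lemma weighted_l2_bound:
  assumes "\<And>F. finite F \<Longrightarrow> (\<Sum>n\<in>F. \<omega> n * (cmod (x n))\<^sup>2) \<le> C"
  shows "x \<in> weighted_l2 \<omega>" "weighted_sqnorm \<omega> x \<le> C"
proof -
  have "(\<lambda>n. \<omega> n * (cmod (x n))\<^sup>2) summable_on UNIV"
    using less_imp_le[OF \<omega>] assms by (intro nonneg_bdd_above_summable_on bdd_aboveI2[of _ _ C]) auto
  then show "x \<in> weighted_l2 \<omega>" "weighted_sqnorm \<omega> x \<le> C"
    using assms by (auto simp: weighted_l2_def weighted_sqnorm_def intro!: infsum_le_finite_sums)
qed

text \<open>The limit is taken coordinatewise. In each finite partial sum the second index may tend
  to infinity, and \<open>weighted_l2_bound\<close> passes from finite partial sums to the whole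
  sum.\<close>

lemma weighted_l2_complete:
  assumes s: "\<And>i::nat. s i \<in> weighted_l2 \<omega>"
    and Cauchy: "\<And>e. e > 0 \<Longrightarrow> \<exists>N. \<forall>i\<ge>N. \<forall>j\<ge>N. weighted_sqnorm \<omega> (\<lambda>n. s i n - s j n) < e"
  shows "\<exists>l\<in>weighted_l2 \<omega>. (\<lambda>i. weighted_sqnorm \<omega> (\<lambda>n. s i n - l n)) \<longlonglongrightarrow> 0"
proof -
  have "Cauchy (\<lambda>i. s i n)" for n
  proof (rule CauchyI)
    fix e :: real assume e: "e > 0"
    then obtain N where N: "\<And>i j. i \<ge> N \<Longrightarrow> j \<ge> N \<Longrightarrow> weighted_sqnorm \<omega> (\<lambda>n. s i n - s j n) < \<omega> n * e\<^sup>2"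
      using Cauchy[of "\<omega> n * e\<^sup>2"] \<omega>[of n] by auto
    have "norm (s i n - s j n) < e" if "i \<ge> N" "j \<ge> N" for i j
    proof -
      have "\<omega> n * (cmod (s i n - s j n))\<^sup>2 < \<omega> n * e\<^sup>2"
        using le_less_trans[OF weighted_coeff_le[OF weighted_l2_diff[OF s s]] N[OF that]] .
      then have "(cmod (s i n - s j n))\<^sup>2 < e\<^sup>2" using \<omega>[of n] by simp
      then show ?thesis using e by (intro power2_less_imp_less[of "cmod (s i n - s j n)"]) auto
    qed
    then show "\<exists>M. \<forall>i\<ge>M. \<forall>j\<ge>M. norm (s i n - s j n) < e" by blast
  qed
  then have "convergent (\<lambda>i. s i n)" for n by (simp add: Cauchy_convergent_iff)
  then have "\<forall>n. \<exists>a. (\<lambda>i. s i n) \<longlonglongrightarrow> a" by (simp add: convergent_def)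
  from choice[OF this] have "\<exists>l. \<forall>n. (\<lambda>i. s i n) \<longlonglongrightarrow> l n" .
  then obtain l where l: "\<And>n. (\<lambda>i. s i n) \<longlonglongrightarrow> l n" by blast
  have tail: "\<exists>N. \<forall>i\<ge>N. (\<lambda>n. s i n - l n) \<in> weighted_l2 \<omega> \<and> weighted_sqnorm \<omega> (\<lambda>n. s i n - l n) \<le> e"
    if e: "e > 0" for e
  proof -
    obtain N where N: "\<And>i j. i \<ge> N \<Longrightarrow> j \<ge> N \<Longrightarrow> weighted_sqnorm \<omega> (\<lambda>n. s i n - s j n) < e"
      using Cauchy[OF e] by auto
    have "(\<Sum>n\<in>F. \<omega> n * (cmod (s i n - l n))\<^sup>2) \<le> e" if i: "i \<ge> N" and F: "finite F" for i F
    proof (rule LIMSEQ_le_const2)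
      show "(\<lambda>j. \<Sum>n\<in>F. \<omega> n * (cmod (s i n - s j n))\<^sup>2) \<longlonglongrightarrow> (\<Sum>n\<in>F. \<omega> n * (cmod (s i n - l n))\<^sup>2)"
        by (intro tendsto_intros l)
      have "(\<Sum>n\<in>F. \<omega> n * (cmod (s i n - s j n))\<^sup>2) \<le> e" if j: "j \<ge> N" for j
      proof -
        have "(\<Sum>n\<in>F. \<omega> n * (cmod (s i n - s j n))\<^sup>2) \<le> weighted_sqnorm \<omega> (\<lambda>n. s i n - s j n)"
          unfolding weighted_sqnorm_def
          by (rule finite_sum_le_infsum)
            (use weighted_l2_diff[OF s s, of i j] F less_imp_le[OF \<omega>] in \<open>auto simp: weighted_l2_def\<close>)
        then show ?thesis using N[OF i j] by simp
      qed
      then show "\<exists>N. \<forall>j\<ge>N. (\<Sum>n\<in>F. \<omega> n * (cmod (s i n - s j n))\<^sup>2) \<le> e" by blast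
    qed
    then show ?thesis using weighted_l2_bound[of "\<lambda>n. s _ n - l n" e] by blast
  qed
  obtain N where "(\<lambda>n. s N n - l n) \<in> weighted_l2 \<omega>" using tail[of 1] by auto
  from weighted_l2_diff[OF s[of N] this] have l_in: "l \<in> weighted_l2 \<omega>" by simp
  have "(\<lambda>i. weighted_sqnorm \<omega> (\<lambda>n. s i n - l n)) \<longlonglongrightarrow> 0"
  proof (rule LIMSEQ_I)
    fix e :: real assume "e > 0"
    then obtain N where N: "\<And>i. i \<ge> N \<Longrightarrow> weighted_sqnorm \<omega> (\<lambda>n. s i n - l n) \<le> e / 2"
      using tail[of "e / 2"] by auto
    show "\<exists>N. \<forall>i\<ge>N. norm (weighted_sqnorm \<omega> (\<lambda>n. s i n - l n) - 0) < e"
    proof (intro exI[of _ N] allI impI)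
      fix i assume "i \<ge> N"
      then show "norm (weighted_sqnorm \<omega> (\<lambda>n. s i n - l n) - 0) < e"
        using N[of i] \<open>e > 0\<close> by (simp add: abs_of_nonneg[OF weighted_sqnorm_nonneg])
    qed
  qed
  then show ?thesis using l_in by blast
qed

end

text \<open>
  The universe \<open>'a\<close> is abstract, so the sequence space is moved into it along an injection \<open>\<iota>\<close>.
\<close>

locale weighted_l2_copy =
  fixes \<omega> :: "'i \<Rightarrow> real" and \<iota> :: "('i \<Rightarrow> complex) \<Rightarrow> 'a"
  assumes weight_pos: "\<omega> n > 0" and inj_\<iota>: "inj \<iota>"
begin

definition coord :: "'a \<Rightarrow> 'i \<Rightarrow> complex" where
  "coord = inv_into UNIV \<iota>"

definition L2 :: "'a hilbert" where
  "L2 = \<lparr>carrier = \<iota> ` weighted_l2 \<omega>, monoid.mult = (\<lambda>_ _. undefined), one = undefined,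
     ring.zero = \<iota> (\<lambda>_. 0), add = (\<lambda>a b. \<iota> (\<lambda>n. coord a n + coord b n)),
     module.smult = (\<lambda>c a. \<iota> (\<lambda>n. c * coord a n)),
     iprod = (\<lambda>a b. weighted_iprod \<omega> (coord a) (coord b))\<rparr>"

lemma coord_\<iota> [simp]: "coord (\<iota> x) = x"
  by (simp add: coord_def inj_\<iota>)

lemma \<iota>_in_L2 [simp]: "\<iota> x \<in> carrier L2 \<longleftrightarrow> x \<in> weighted_l2 \<omega>"
  using inj_\<iota> by (auto simp: L2_def inj_image_mem_iff)

lemma \<iota>_coord [simp]: "a \<in> carrier L2 \<Longrightarrow> \<iota> (coord a) = a"
  by (auto simp: L2_def)

lemma coord_in [simp]: "a \<in> carrier L2 \<Longrightarrow> coord a \<in> weighted_l2 \<omega>"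
  by (auto simp: L2_def)

lemma L2_simps:
  "\<zero>\<^bsub>L2\<^esub> = \<iota> (\<lambda>_. 0)"
  "a \<oplus>\<^bsub>L2\<^esub> b = \<iota> (\<lambda>n. coord a n + coord b n)"
  "c \<odot>\<^bsub>L2\<^esub> a = \<iota> (\<lambda>n. c * coord a n)"
  "iprod L2 a b = weighted_iprod \<omega> (coord a) (coord b)"
  by (simp_all add: L2_def)

lemma vnorm_L2: "vnorm L2 a = sqrt (weighted_sqnorm \<omega> (coord a))"
  by (simp add: vnorm_def L2_simps weighted_iprod_self[OF weight_pos])

lemma module_L2: "Module.module complex_ring L2"
proof (rule moduleI)
  show "cring complex_ring"
  proof (rule cringI)
    show "abelian_group complex_ring"
      by (rule abelian_groupI) (auto intro: exI[of _ "- _"] left_minus)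
    show "Group.comm_monoid complex_ring"
      by (rule comm_monoidI) auto
  qed (auto simp: distrib_right)
  show "abelian_group L2"
  proof (rule abelian_groupI)
    fix x assume x: "x \<in> carrier L2"
    show "\<exists>y\<in>carrier L2. y \<oplus>\<^bsub>L2\<^esub> x = \<zero>\<^bsub>L2\<^esub>"
      using x weighted_l2_smult[OF weight_pos, where x = "coord x" and c = "-1"]
      by (intro bexI[of _ "\<iota> (\<lambda>n. - coord x n)"]) (auto simp: L2_simps)
  qed (auto simp: L2_simps weighted_l2_add[OF weight_pos] weighted_l2_0[OF weight_pos] add_ac)
qed (auto simp: L2_simps weighted_l2_smult[OF weight_pos] algebra_simps)

text \<open>The record has no field for subtraction; it is built from the group inverse, which is
  identified here by uniqueness.\<close>

lemma coord_minus:
  assumes "x \<in> carrier L2" "y \<in> carrier L2"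
  shows "coord (x \<ominus>\<^bsub>L2\<^esub> y) n = coord x n - coord y n"
proof -
  interpret Module.module complex_ring L2 by (rule module_L2)
  have y': "\<iota> (\<lambda>n. - coord y n) \<in> carrier L2"
    using weighted_l2_smult[OF weight_pos, where x = "coord y" and c = "-1"] assms by simp
  have "\<ominus>\<^bsub>L2\<^esub> y = \<iota> (\<lambda>n. - coord y n)"
    using assms y' by (intro M.minus_equality) (auto simp: L2_simps)
  then show ?thesis by (simp add: a_minus_def L2_simps)
qed

lemma hilbert_L2: "hilbert_space L2"
proof -
  interpret Module.module complex_ring L2 by (rule module_L2)
  note summable = weighted_iprod_summable[OF weight_pos coord_in coord_in]
  show ?thesis
  proof (intro hilbert_space.intro complex_hilbert_space.intro module_L2 complex_hilbert_space_axioms.intro)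
    fix x y z assume "x \<in> carrier L2" "y \<in> carrier L2" "z \<in> carrier L2"
    then show "iprod L2 (x \<oplus>\<^bsub>L2\<^esub> y) z = iprod L2 x z + iprod L2 y z"
      using summable by (simp add: L2_simps weighted_iprod_def infsum_add ring_distribs)
  next
    fix x y :: 'a and a :: complex
    have "weighted_iprod \<omega> (\<lambda>n. a * coord x n) (coord y)
        = (\<Sum>\<^sub>\<infinity>n. a * (of_real (\<omega> n) * coord x n * cnj (coord y n)))"
      unfolding weighted_iprod_def by (simp add: mult_ac)
    then show "iprod L2 (a \<odot>\<^bsub>L2\<^esub> x) y = a * iprod L2 x y"
      by (simp only: L2_simps coord_\<iota> weighted_iprod_def infsum_cmult_right')
  next
    fix x y :: 'a
    show "iprod L2 y x = cnj (iprod L2 x y)"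
      by (simp add: L2_simps weighted_iprod_def mult_ac flip: infsum_cnj)
  next
    fix x :: 'a
    show "iprod L2 x x \<in> \<real>\<^sub>\<ge>\<^sub>0"
      by (simp add: L2_simps weighted_iprod_self[OF weight_pos] weighted_sqnorm_nonneg[OF weight_pos])
  next
    fix x assume x: "x \<in> carrier L2" and "iprod L2 x x = 0"
    then have 0: "weighted_sqnorm \<omega> (coord x) = 0" by (simp add: L2_simps weighted_iprod_self[OF weight_pos])
    have "coord x n = 0" for n
      using weighted_coeff_le[OF weight_pos coord_in[OF x], of n] weight_pos[of n] 0
      by (simp add: mult_le_0_iff)
    then have "coord x = (\<lambda>_. 0)" by auto
    then show "x = \<zero>\<^bsub>L2\<^esub>" using \<iota>_coord[OF x] by (simp add: L2_simps)
  next
    fix s :: "nat \<Rightarrow> 'a"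
    assume s: "\<And>n. s n \<in> carrier L2"
      and Cauchy: "\<And>e. e > 0 \<Longrightarrow> \<exists>N::nat. \<forall>m\<ge>N. \<forall>n\<ge>N. vnorm L2 (s m \<ominus>\<^bsub>L2\<^esub> s n) < e"
    have v: "vnorm L2 (x \<ominus>\<^bsub>L2\<^esub> y) = sqrt (weighted_sqnorm \<omega> (\<lambda>n. coord x n - coord y n))"
      if "x \<in> carrier L2" "y \<in> carrier L2" for x y
    proof -
      have "coord (x \<ominus>\<^bsub>L2\<^esub> y) = (\<lambda>n. coord x n - coord y n)" by (rule ext) (rule coord_minus[OF that])
      then show ?thesis by (simp only: vnorm_L2)
    qed
    have "\<exists>l\<in>weighted_l2 \<omega>. (\<lambda>i. weighted_sqnorm \<omega> (\<lambda>n. coord (s i) n - l n)) \<longlonglongrightarrow> 0"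
    proof (rule weighted_l2_complete[OF weight_pos])
      fix e :: real assume "e > 0"
      then have "sqrt e > 0" by simp
      from Cauchy[OF this] show "\<exists>N. \<forall>i\<ge>N. \<forall>j\<ge>N. weighted_sqnorm \<omega> (\<lambda>n. coord (s i) n - coord (s j) n) < e"
        by (simp add: v s)
    qed (simp add: s)
    then obtain l where l: "l \<in> weighted_l2 \<omega>"
      and lim: "(\<lambda>i. weighted_sqnorm \<omega> (\<lambda>n. coord (s i) n - l n)) \<longlonglongrightarrow> 0" by blast
    show "\<exists>l\<in>carrier L2. (\<lambda>n. vnorm L2 (s n \<ominus>\<^bsub>L2\<^esub> l)) \<longlonglongrightarrow> 0"
      using tendsto_real_sqrt[OF lim] l by (intro bexI[of _ "\<iota> l"]) (simp_all add: v s)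
  qed
qed

end

text \<open>A real number is determined by the rationals below it, so a sequence is encoded by
  triples of an index, a choice of real or imaginary part, and a rational below that part. The
  triples are countable, so the code is a set of natural numbers.\<close>

lemma lepoll_int_complex_fun: "(UNIV :: (int \<Rightarrow> complex) set) \<lesssim> (UNIV :: real set)"
proof -
  define \<phi> where "\<phi> a = {q :: rat. of_rat q < a}" for a :: real
  have \<phi>: "a = b" if "\<phi> a = \<phi> b" for a b
  proof (rule ccontr)
    assume "a \<noteq> b"
    then have "min a b < max a b" by (simp add: min_def max_def)
    then obtain q where "min a b < of_rat q" "of_rat q < max a b"
      using of_rat_dense by blast
    then have "(q \<in> \<phi> a) \<noteq> (q \<in> \<phi> b)" by (auto simp: \<phi>_def min_def max_def split: if_splits)
    then show False using that by simp
  qed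
  define F where "F x = to_nat ` {(n :: int, b :: bool, q). q \<in> \<phi> (if b then Re (x n) else Im (x n))}"
    for x :: "int \<Rightarrow> complex"
  have "inj F"
  proof (rule injI)
    fix x y assume "F x = F y"
    then have eq: "{(n :: int, b :: bool, q). q \<in> \<phi> (if b then Re (x n) else Im (x n))}
        = {(n, b, q). q \<in> \<phi> (if b then Re (y n) else Im (y n))}"
      unfolding F_def by (simp add: inj_image_eq_iff)
    have "\<phi> (if b then Re (x n) else Im (x n)) = \<phi> (if b then Re (y n) else Im (y n))" for n b
    proof (rule Set.set_eqI)
      fix q
      show "q \<in> \<phi> (if b then Re (x n) else Im (x n)) \<longleftrightarrow> q \<in> \<phi> (if b then Re (y n) else Im (y n))"
        using arg_cong[OF eq, of "\<lambda>S. (n, b, q) \<in> S"] by simp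
    qed
    from this[of True] this[of False] show "x = y"
      using \<phi> by (auto simp: complex_eq_iff)
  qed
  then have "(UNIV :: (int \<Rightarrow> complex) set) \<lesssim> (UNIV :: nat set set)"
    unfolding lepoll_def by blast
  also have "\<dots> \<lesssim> (UNIV :: real set)"
    by (rule eqpoll_imp_lepoll[OF nat_sets_eqpoll_reals])
  finally show ?thesis .
qed

section \<open>The bilateral shift\<close>

text \<open>Symmetric in n, so the shift and its inverse obey the same bounds. Decay by the factor
  r^2 per step away from 0 is the fastest that the bound 1 / r on the inverse permits.\<close>

definition shift_weight :: "real \<Rightarrow> int \<Rightarrow> real" where
  "shift_weight r n = r ^ (2 * nat \<bar>n\<bar>)"

lemma summable_on_int_power:
  fixes \<rho> :: real
  assumes "0 \<le> \<rho>" "\<rho> < 1"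
  shows "(\<lambda>n :: int. \<rho> ^ nat \<bar>n\<bar>) summable_on UNIV"
proof -
  have geom: "(\<lambda>k :: nat. \<rho> ^ k) summable_on UNIV"
    using assms by (intro norm_summable_imp_summable_on) (simp add: norm_power summable_geometric)
  have 1: "(\<lambda>n. \<rho> ^ nat \<bar>n\<bar>) summable_on range int"
    using geom by (subst summable_on_reindex) (auto simp: o_def inj_on_def)
  have 2: "(\<lambda>n. \<rho> ^ nat \<bar>n\<bar>) summable_on range (\<lambda>k. - int k)"
    using geom by (subst summable_on_reindex) (auto simp: o_def inj_on_def)
  have "n \<in> range int \<union> range (\<lambda>k. - int k)" for n :: int
    by (cases "n \<ge> 0") (auto intro: range_eqI[of _ _ "nat n"] range_eqI[of _ _ "nat (- n)"])
  then have UN: "UNIV = range int \<union> (range (\<lambda>k. - int k) - range int)" by auto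
  have "(\<lambda>n. \<rho> ^ nat \<bar>n\<bar>) summable_on (range (\<lambda>k. - int k) - range int)"
    using 2 by (rule summable_on_subset_banach) auto
  then show ?thesis by (subst UN, intro summable_on_Un_disjoint 1) auto
qed

locale bilateral_shift =
  fixes r :: real and \<iota> :: "(int \<Rightarrow> complex) \<Rightarrow> 'a"
  assumes r: "0 < r" "r < 1" and inj: "inj \<iota>"
begin

lemma weight_pos: "shift_weight r n > 0"
  using r by (simp add: shift_weight_def)

sublocale weighted_l2_copy "shift_weight r" \<iota>
  by standard (use weight_pos inj in auto)

sublocale H: hilbert_space L2
  by (rule hilbert_L2)

lemma weight_0 [simp]: "shift_weight r 0 = 1"
  by (simp add: shift_weight_def)

text \<open>Away from 0 one neighbour has r^2 times the weight and the other r^-2 times, so the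
  third claim is an equality; at 0 both have r^2 times the weight. The first two claims serve
  \<open>QA\<close>, the third serves \<open>PA\<close>.\<close>

lemma weight_neighbours:
  shows "shift_weight r (n + 1) \<le> shift_weight r n / r\<^sup>2"
    and "shift_weight r (n - 1) \<le> shift_weight r n / r\<^sup>2"
    and "shift_weight r (n + 1) + shift_weight r (n - 1) \<le> (r\<^sup>2 + 1 / r\<^sup>2) * shift_weight r n"
proof -
  have r2: "r\<^sup>2 > 0" "r\<^sup>2 \<le> 1" using r by (auto intro: power_le_one)
  have "1 \<le> 1 / r\<^sup>2" using r2 by simp
  then have r2': "r\<^sup>2 \<le> 1 / r\<^sup>2" using r2 by linarith
  have up: "shift_weight r (m + 1) = r\<^sup>2 * shift_weight r m" if "m \<ge> 0" for m
  proof -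
    have "nat \<bar>m + 1\<bar> = Suc (nat \<bar>m\<bar>)" using that by simp
    then show ?thesis unfolding shift_weight_def by (simp only:) (simp add: power2_eq_square)
  qed
  have neg: "shift_weight r (- m) = shift_weight r m" for m by (simp add: shift_weight_def)
  have down: "shift_weight r (m - 1) = r\<^sup>2 * shift_weight r m" if "m \<le> 0" for m
    using up[of "- m"] neg[of "m - 1"] neg[of m] that by simp
  have cases: "(shift_weight r (n + 1) = r\<^sup>2 * shift_weight r n \<or> shift_weight r (n + 1) = shift_weight r n / r\<^sup>2)
      \<and> (shift_weight r (n - 1) = r\<^sup>2 * shift_weight r n \<or> shift_weight r (n - 1) = shift_weight r n / r\<^sup>2)
      \<and> (shift_weight r (n + 1) = r\<^sup>2 * shift_weight r n \<or> shift_weight r (n - 1) = r\<^sup>2 * shift_weight r n)"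
  proof -
    consider "n = 0" | "n \<ge> 1" | "n \<le> - 1" by linarith
    then show ?thesis
    proof cases
      case 1
      then show ?thesis using up[of 0] down[of 0] by simp
    next
      case 2
      then have "shift_weight r n = r\<^sup>2 * shift_weight r (n - 1)" using up[of "n - 1"] by simp
      then have "shift_weight r (n - 1) = shift_weight r n / r\<^sup>2" using r2 by simp
      moreover have "shift_weight r (n + 1) = r\<^sup>2 * shift_weight r n" using up[of n] 2 by simp
      ultimately show ?thesis by blast
    next
      case 3
      then have "shift_weight r n = r\<^sup>2 * shift_weight r (n + 1)" using down[of "n + 1"] by simp
      then have "shift_weight r (n + 1) = shift_weight r n / r\<^sup>2" using r2 by simp
      moreover have "shift_weight r (n - 1) = r\<^sup>2 * shift_weight r n" using down[of n] 3 by simp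
      ultimately show ?thesis by blast
    qed
  qed
  have le: "r\<^sup>2 * shift_weight r n \<le> shift_weight r n / r\<^sup>2"
    using mult_right_mono[OF r2' less_imp_le[OF weight_pos[of n]]] by simp
  show "shift_weight r (n + 1) \<le> shift_weight r n / r\<^sup>2" "shift_weight r (n - 1) \<le> shift_weight r n / r\<^sup>2"
    using cases le by auto
  show "shift_weight r (n + 1) + shift_weight r (n - 1) \<le> (r\<^sup>2 + 1 / r\<^sup>2) * shift_weight r n"
  proof -
    have "(r\<^sup>2 + 1 / r\<^sup>2) * shift_weight r n = r\<^sup>2 * shift_weight r n + shift_weight r n / r\<^sup>2"
      by (simp add: distrib_right)
    then show ?thesis using cases le by linarith
  qed
qed

text \<open>Reindexing moves the translation from the vector to the weights, so estimates for the
  shift reduce to comparing neighbouring weights.\<close>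

lemma translate:
  assumes k: "\<And>n. shift_weight r (n + k) \<le> shift_weight r n / r\<^sup>2" and x: "x \<in> weighted_l2 (shift_weight r)"
  shows "(\<lambda>n. shift_weight r (n + k) * (cmod (x n))\<^sup>2) summable_on UNIV"
    and "(\<lambda>n. x (n - k)) \<in> weighted_l2 (shift_weight r)"
    and "weighted_sqnorm (shift_weight r) (\<lambda>n. x (n - k)) = (\<Sum>\<^sub>\<infinity>n. shift_weight r (n + k) * (cmod (x n))\<^sup>2)"
proof -
  have bij: "bij_betw (\<lambda>n. n + k) UNIV UNIV"
    by (rule bij_betwI[of _ _ _ "\<lambda>n. n - k"]) auto
  have "(\<lambda>n. 1 / r\<^sup>2 * (shift_weight r n * (cmod (x n))\<^sup>2)) summable_on UNIV"
    using x unfolding weighted_l2_def by (intro summable_on_cmult_right) simp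
  then show 1: "(\<lambda>n. shift_weight r (n + k) * (cmod (x n))\<^sup>2) summable_on UNIV"
  proof (rule summable_on_comparison_test)
    fix n
    show "shift_weight r (n + k) * (cmod (x n))\<^sup>2 \<le> 1 / r\<^sup>2 * (shift_weight r n * (cmod (x n))\<^sup>2)"
      using mult_right_mono[OF k[of n], of "(cmod (x n))\<^sup>2"] by simp
  qed (use less_imp_le[OF weight_pos] in auto)
  show "(\<lambda>n. x (n - k)) \<in> weighted_l2 (shift_weight r)"
    using 1 summable_on_reindex_bij_betw[OF bij, of "\<lambda>n. shift_weight r n * (cmod (x (n - k)))\<^sup>2"]
    by (simp add: weighted_l2_def)
  show "weighted_sqnorm (shift_weight r) (\<lambda>n. x (n - k)) = (\<Sum>\<^sub>\<infinity>n. shift_weight r (n + k) * (cmod (x n))\<^sup>2)"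
    using infsum_reindex_bij_betw[OF bij, of "\<lambda>n. shift_weight r n * (cmod (x (n - k)))\<^sup>2"]
    by (simp add: weighted_sqnorm_def)
qed

lemma sum_sqnorm_translate_le:
  assumes x: "x \<in> weighted_l2 (shift_weight r)"
  shows "weighted_sqnorm (shift_weight r) (\<lambda>n. x (n - 1)) + weighted_sqnorm (shift_weight r) (\<lambda>n. x (n + 1))
    \<le> (r\<^sup>2 + 1 / r\<^sup>2) * weighted_sqnorm (shift_weight r) x"
proof -
  note up = translate[of 1 x, OF weight_neighbours(1) x]
  note down = translate[of "-1" x, simplified, OF weight_neighbours(2) x]
  have "weighted_sqnorm (shift_weight r) (\<lambda>n. x (n - 1)) + weighted_sqnorm (shift_weight r) (\<lambda>n. x (n + 1))
      = (\<Sum>\<^sub>\<infinity>n. shift_weight r (n + 1) * (cmod (x n))\<^sup>2 + shift_weight r (n - 1) * (cmod (x n))\<^sup>2)"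
    by (simp only: up(3) down(3) infsum_add[OF up(1) down(1)])
  also have "\<dots> \<le> (\<Sum>\<^sub>\<infinity>n. (r\<^sup>2 + 1 / r\<^sup>2) * (shift_weight r n * (cmod (x n))\<^sup>2))"
  proof (rule infsum_mono)
    show "(\<lambda>n. shift_weight r (n + 1) * (cmod (x n))\<^sup>2 + shift_weight r (n - 1) * (cmod (x n))\<^sup>2) summable_on UNIV"
      by (rule summable_on_add[OF up(1) down(1)])
    show "(\<lambda>n. (r\<^sup>2 + 1 / r\<^sup>2) * (shift_weight r n * (cmod (x n))\<^sup>2)) summable_on UNIV"
      using x unfolding weighted_l2_def by (intro summable_on_cmult_right) simp
    fix n
    show "shift_weight r (n + 1) * (cmod (x n))\<^sup>2 + shift_weight r (n - 1) * (cmod (x n))\<^sup>2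
        \<le> (r\<^sup>2 + 1 / r\<^sup>2) * (shift_weight r n * (cmod (x n))\<^sup>2)"
      using mult_right_mono[OF weight_neighbours(3)[of n], of "(cmod (x n))\<^sup>2"]
      by (simp only: distrib_right mult.assoc) simp
  qed
  also have "\<dots> = (r\<^sup>2 + 1 / r\<^sup>2) * weighted_sqnorm (shift_weight r) x"
    by (simp only: weighted_sqnorm_def infsum_cmult_right')
  finally show ?thesis .
qed

section \<open>The shift and its inverse as operators in both classes\<close>

definition shift :: "'a \<Rightarrow> 'a" where
  "shift a = \<iota> (\<lambda>n. coord a (n - 1))"

definition unshift :: "'a \<Rightarrow> 'a" where
  "unshift a = \<iota> (\<lambda>n. coord a (n + 1))"

lemma coord_shift [simp]: "coord (shift a) n = coord a (n - 1)"
  by (simp add: shift_def)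

lemma coord_unshift [simp]: "coord (unshift a) n = coord a (n + 1)"
  by (simp add: unshift_def)

lemma shift_closed: "a \<in> carrier L2 \<Longrightarrow> shift a \<in> carrier L2"
  using translate(2)[OF weight_neighbours(1), of "coord a"] by (simp add: shift_def)

lemma unshift_closed: "a \<in> carrier L2 \<Longrightarrow> unshift a \<in> carrier L2"
  using translate(2)[of "-1" "coord a"] weight_neighbours(2) by (simp add: unshift_def)

lemma vnorm_L2_power2: "(vnorm L2 a)\<^sup>2 = weighted_sqnorm (shift_weight r) (coord a)"
  by (simp add: vnorm_L2 weighted_sqnorm_nonneg[OF weight_pos])

lemma vnorm_shift_unshift:
  assumes "a \<in> carrier L2"
  shows "(vnorm L2 (shift a))\<^sup>2 + (vnorm L2 (unshift a))\<^sup>2 \<le> (r\<^sup>2 + 1 / r\<^sup>2) * (vnorm L2 a)\<^sup>2"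
  using sum_sqnorm_translate_le[OF coord_in[OF assms]]
  by (simp add: vnorm_L2_power2 shift_def unshift_def)

lemma vnorm_translate_le:
  assumes "\<And>n. shift_weight r (n + k) \<le> shift_weight r n / r\<^sup>2" "a \<in> carrier L2"
    and "coord b = (\<lambda>n. coord a (n - k))"
  shows "vnorm L2 b \<le> 1 / r * vnorm L2 a"
proof -
  note t = translate[OF assms(1) coord_in[OF assms(2)]]
  have "weighted_sqnorm (shift_weight r) (coord b) \<le> (\<Sum>\<^sub>\<infinity>n. 1 / r\<^sup>2 * (shift_weight r n * (cmod (coord a n))\<^sup>2))"
    unfolding assms(3) t(3)
  proof (rule infsum_mono[OF t(1)])
    show "(\<lambda>n. 1 / r\<^sup>2 * (shift_weight r n * (cmod (coord a n))\<^sup>2)) summable_on UNIV"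
      using coord_in[OF assms(2)] unfolding weighted_l2_def by (intro summable_on_cmult_right) simp
    fix n
    show "shift_weight r (n + k) * (cmod (coord a n))\<^sup>2 \<le> 1 / r\<^sup>2 * (shift_weight r n * (cmod (coord a n))\<^sup>2)"
      using mult_right_mono[OF assms(1)[of n], of "(cmod (coord a n))\<^sup>2"] by simp
  qed
  also have "\<dots> = 1 / r\<^sup>2 * weighted_sqnorm (shift_weight r) (coord a)"
    by (simp only: weighted_sqnorm_def infsum_cmult_right')
  finally have "sqrt (weighted_sqnorm (shift_weight r) (coord b)) \<le> sqrt (1 / r\<^sup>2 * weighted_sqnorm (shift_weight r) (coord a))"
    by (rule real_sqrt_le_mono)
  then show ?thesis using r by (simp add: vnorm_L2 real_sqrt_mult real_sqrt_divide)
qed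

lemma vnorm_shift_le: "a \<in> carrier L2 \<Longrightarrow> vnorm L2 (shift a) \<le> 1 / r * vnorm L2 a"
  by (rule vnorm_translate_le[OF weight_neighbours(1)]) auto

lemma vnorm_unshift_le: "a \<in> carrier L2 \<Longrightarrow> vnorm L2 (unshift a) \<le> 1 / r * vnorm L2 a"
  by (rule vnorm_translate_le[of "-1"]) (auto simp: weight_neighbours(2))

lemma bounded_shift: "bounded_operator L2 shift"
  by (rule H.bounded_operatorI[OF _ _ _ vnorm_shift_le])
    (auto simp: shift_closed, auto simp: shift_def L2_simps)

lemma bounded_unshift: "bounded_operator L2 unshift"
  by (rule H.bounded_operatorI[OF _ _ _ vnorm_unshift_le])
    (auto simp: unshift_closed, auto simp: unshift_def L2_simps)

lemma unshift_shift: "a \<in> carrier L2 \<Longrightarrow> unshift (shift a) = a"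
  by (simp add: unshift_def)

lemma shift_unshift: "a \<in> carrier L2 \<Longrightarrow> shift (unshift a) = a"
  by (simp add: shift_def)

lemma invertible_shift: "invertible_operator L2 shift"
  and op_inv_shift: "a \<in> carrier L2 \<Longrightarrow> op_inv L2 shift a = unshift a"
  using H.invertible_operatorI[OF bounded_shift bounded_unshift unshift_shift shift_unshift] by auto

lemma shift_in_PA: "(L2, shift) \<in> PA r"
  using H.complex_hilbert_space_axioms invertible_shift H.positive_operator_PA_iff[OF invertible_shift, of "r\<^sup>2 + 1 / r\<^sup>2"]
    vnorm_shift_unshift
  by (simp add: PA_def op_inv_shift)

lemma shift_in_QA: "(L2, shift) \<in> QA r"
proof -
  have "op_norm L2 shift \<le> 1 / r" "op_norm L2 (op_inv L2 shift) \<le> 1 / r"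
    using r by (auto intro!: H.op_norm_le simp: op_inv_shift vnorm_shift_le[simplified] vnorm_unshift_le[simplified])
  then show ?thesis
    using H.complex_hilbert_space_axioms invertible_shift by (simp add: QA_def)
qed

text \<open>The equation x (n - 1) = w x n forces x n = w^-n up to a factor. Against the weights
  this is square summable for n tending to infinity because r < |w|, and for n tending to minus
  infinity because |w| < 1 / r.\<close>

lemma annulus_subset_spectrum:
  assumes w: "r < cmod w" "cmod w < 1 / r"
  shows "w \<in> spectrum L2 shift"
proof -
  have w0: "w \<noteq> 0" using w r by auto
  define x where "x n = w powi (- n)" for n :: int
  define \<rho> where "\<rho> = max ((r / cmod w)\<^sup>2) ((r * cmod w)\<^sup>2)"
  have "r * cmod w < 1" "r / cmod w < 1" using w r w0 by (auto simp: field_simps)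
  then have \<rho>: "0 \<le> \<rho>" "\<rho> < 1"
    using r by (auto simp: \<rho>_def abs_square_less_1 abs_mult le_max_iff_disj)
  have "x \<in> weighted_l2 (shift_weight r)"
    unfolding weighted_l2_def mem_Collect_eq
  proof (rule summable_on_comparison_test[OF summable_on_int_power[OF \<rho>]])
    fix n :: int
    show "shift_weight r n * (cmod (x n))\<^sup>2 \<le> \<rho> ^ nat \<bar>n\<bar>"
    proof (cases "n \<ge> 0")
      case True
      then have "shift_weight r n * (cmod (x n))\<^sup>2 = ((r / cmod w)\<^sup>2) ^ nat \<bar>n\<bar>"
        by (simp add: shift_weight_def x_def power_int_minus power_int_def norm_power norm_inverse norm_divide
            power_divide divide_inverse power_mult_distrib flip: power_mult power_inverse)
          (simp add: mult.commute)
      also have "\<dots> \<le> \<rho> ^ nat \<bar>n\<bar>" by (intro power_mono) (auto simp: \<rho>_def)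
      finally show ?thesis .
    next
      case False
      then have "shift_weight r n * (cmod (x n))\<^sup>2 = ((r * cmod w)\<^sup>2) ^ nat \<bar>n\<bar>"
        by (simp add: shift_weight_def x_def power_int_def norm_power power_mult_distrib flip: power_mult)
          (simp add: mult.commute)
      also have "\<dots> \<le> \<rho> ^ nat \<bar>n\<bar>" by (intro power_mono) (auto simp: \<rho>_def)
      finally show ?thesis .
    qed
  qed (use less_imp_le[OF weight_pos] in auto)
  then have a: "\<iota> x \<in> carrier L2" by simp
  have "x (n - 1) = w * x n" for n
    using w0 power_int_add_1[of w "- n"] by (simp add: x_def mult.commute)
  then have "shift (\<iota> x) = w \<odot>\<^bsub>L2\<^esub> \<iota> x" by (simp add: shift_def L2_simps)
  then have zero: "w \<odot>\<^bsub>L2\<^esub> \<iota> x \<ominus>\<^bsub>L2\<^esub> shift (\<iota> x) = \<zero>\<^bsub>L2\<^esub>"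
    using a by (simp add: H.M.minus_eq H.M.r_neg)
  have "\<iota> x \<noteq> \<zero>\<^bsub>L2\<^esub>"
  proof
    assume "\<iota> x = \<zero>\<^bsub>L2\<^esub>"
    then have "x 0 = 0" by (simp add: L2_simps inj_eq[OF inj])
    then show False by (simp add: x_def)
  qed
  moreover have "\<zero>\<^bsub>L2\<^esub> = \<iota> x" if "invertible_operator L2 (\<lambda>a. w \<odot>\<^bsub>L2\<^esub> a \<ominus>\<^bsub>L2\<^esub> shift a)"
    using H.op_inv_left[OF that a] H.bounded_operator_zero[OF H.op_inv_bounded[OF that]] by (simp add: zero)
  ultimately show ?thesis unfolding spectrum_def by auto
qed

section \<open>Coordinate functionals and the dual norm\<close>

lemma coord_poly_op:
  assumes a: "a \<in> carrier L2"
  shows "coord (poly_op L2 p shift a) n = (\<Sum>j\<le>degree p. coeff p j * coord a (n - int j))"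
proof (induction p arbitrary: n)
  case 0
  then show ?case using a by (simp add: L2_simps)
next
  case (pCons c p)
  have "coord (poly_op L2 (pCons c p) shift a) n
      = c * coord a n + (\<Sum>j\<le>degree p. coeff p j * coord a (n - 1 - int j))"
    by (simp add: H.poly_op_pCons[OF bounded_shift a] L2_simps pCons)
  also have "\<dots> = (\<Sum>j\<le>Suc (degree p). coeff (pCons c p) j * coord a (n - int j))"
    by (simp add: sum.atMost_Suc_shift algebra_simps del: sum.atMost_Suc)
  also have "\<dots> = (\<Sum>j\<le>degree (pCons c p). coeff (pCons c p) j * coord a (n - int j))"
    by (cases "p = 0") auto
  finally show ?case .
qed

lemma coord_zero_le: "a \<in> carrier L2 \<Longrightarrow> cmod (coord a 0) \<le> vnorm L2 a"
  using weighted_coeff_le[OF weight_pos coord_in, of a 0] by (simp add: vnorm_L2 real_le_rsqrt)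

text \<open>Used on the truncation error, where the loss r^-L is outweighed by the factor |w|^L with
  |w| < r.\<close>

lemma coord_nat_le: "a \<in> carrier L2 \<Longrightarrow> r ^ L * cmod (coord a (int L)) \<le> vnorm L2 a"
  using weighted_coeff_le[OF weight_pos coord_in, of a "int L"]
  by (simp add: vnorm_L2 real_le_rsqrt shift_weight_def power_mult_distrib mult.commute flip: power_mult)

text \<open>
  The coefficient vector of a polynomial \<open>h\<close>, conjugated, reflected about \<open>L\<close> and weighted so that
  pairing with it recovers the squared norm of \<open>z\<^sup>-\<^sup>L h(z)\<close> for the dual weight \<open>r\<^sup>-\<^sup>2\<^sup>|\<^sup>n\<^sup>|\<close>.
\<close>

definition dual_vector :: "nat \<Rightarrow> complex poly \<Rightarrow> int \<Rightarrow> complex" where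
  "dual_vector L h n =
     (if n \<le> int L then cnj (coeff h (nat (int L - n))) * of_real (1 / shift_weight r n) else 0)"

definition dual_sqnorm :: "nat \<Rightarrow> complex poly \<Rightarrow> real" where
  "dual_sqnorm L h = (\<Sum>j\<le>degree h. (cmod (coeff h j))\<^sup>2 / shift_weight r (int L - int j))"

lemma dual_vector_sqnorm:
  shows "dual_vector L h \<in> weighted_l2 (shift_weight r)"
    and "weighted_sqnorm (shift_weight r) (dual_vector L h) = dual_sqnorm L h"
proof -
  define S where "S = (\<lambda>j. int L - int j) ` {..degree h}"
  have S: "finite S" by (simp add: S_def)
  have zero: "dual_vector L h n = 0" if "n \<notin> S" for n
  proof (cases "n \<le> int L")
    case True
    then have n: "n = int L - int (nat (int L - n))" by simp
    then have "nat (int L - n) \<notin> {..degree h}" using that unfolding S_def by blast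
    then have "coeff h (nat (int L - n)) = 0" by (intro coeff_eq_0) simp
    then show ?thesis by (simp add: dual_vector_def)
  qed (simp add: dual_vector_def)
  have "(\<lambda>n. shift_weight r n * (cmod (dual_vector L h n))\<^sup>2) summable_on UNIV
      \<longleftrightarrow> (\<lambda>n. shift_weight r n * (cmod (dual_vector L h n))\<^sup>2) summable_on S"
    by (rule summable_on_cong_neutral) (auto simp: zero)
  then show "dual_vector L h \<in> weighted_l2 (shift_weight r)"
    using S by (simp add: weighted_l2_def)
  have "weighted_sqnorm (shift_weight r) (dual_vector L h)
      = infsum (\<lambda>n. shift_weight r n * (cmod (dual_vector L h n))\<^sup>2) S"
    unfolding weighted_sqnorm_def by (rule infsum_cong_neutral) (auto simp: zero)
  also have "\<dots> = (\<Sum>j\<le>degree h. shift_weight r (int L - int j) * (cmod (dual_vector L h (int L - int j)))\<^sup>2)"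
    using S by (simp add: S_def sum.reindex inj_on_def)
  also have "\<dots> = dual_sqnorm L h"
    unfolding dual_sqnorm_def
  proof (intro sum.cong refl)
    fix j
    have "shift_weight r (int L - int j) > 0" by (rule weight_pos)
    then show "shift_weight r (int L - int j) * (cmod (dual_vector L h (int L - int j)))\<^sup>2
        = (cmod (coeff h j))\<^sup>2 / shift_weight r (int L - int j)"
      by (simp add: dual_vector_def norm_mult norm_divide power_mult_distrib power_divide power2_eq_square)
  qed
  finally show "weighted_sqnorm (shift_weight r) (dual_vector L h) = dual_sqnorm L h" .
qed

text \<open>\<open>dual_vector L h\<close> is the Riesz vector of the functional taking u to
  coordinate L of h(T) u, so the value of the functional there is its squared norm.\<close>

lemma coord_poly_op_dual_vector:
  "coord (poly_op L2 h shift (\<iota> (dual_vector L h))) (int L) = of_real (dual_sqnorm L h)"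
proof -
  have "coeff h j * dual_vector L h (int L - int j)
      = of_real ((cmod (coeff h j))\<^sup>2 / shift_weight r (int L - int j))" for j
    by (simp add: dual_vector_def complex_norm_square del: of_real_power)
  then show ?thesis
    by (simp add: coord_poly_op dual_vector_sqnorm(1) dual_sqnorm_def)
qed

text \<open>The coefficient of z^(j - L) in h / z^L has weight r^(-2 |j - L|) in the dual norm and
  r^(2 (L - j)) in Parseval's sum on |z| = 1 / r. The difference \<open>e j\<close> is never
  negative, and j = L - 1 contributes the stated gain.\<close>

lemma dual_sqnorm_ge:
  assumes L: "L \<ge> 1" and c: "coeff h (L - 1) = c"
    and m: "m \<ge> 0" "\<And>z. cmod z = 1 / r \<Longrightarrow> (1 / r) ^ L * m \<le> cmod (poly h z)"
  shows "m\<^sup>2 + (cmod c)\<^sup>2 * (1 / r\<^sup>2 - r\<^sup>2) \<le> dual_sqnorm L h"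
proof -
  define e where "e j = 1 / shift_weight r (int L - int j) - r ^ (2 * L) * (1 / r) ^ (2 * j)" for j
  have e: "e j \<ge> 0" for j
  proof (cases "j \<le> L")
    case True
    then have "nat \<bar>int L - int j\<bar> = L - j" by simp
    then have w: "shift_weight r (int L - int j) = r ^ (2 * (L - j))" unfolding shift_weight_def by (simp only:)
    have "r ^ (2 * L) * (1 / r) ^ (2 * j) = r ^ (2 * (L - j))"
    proof -
      have "2 * L = 2 * (L - j) + 2 * j" using True by simp
      then have "r ^ (2 * L) = r ^ (2 * (L - j)) * r ^ (2 * j)" by (metis power_add)
      then show ?thesis using r by (simp add: power_one_over)
    qed
    moreover have "r ^ (2 * (L - j)) \<le> 1" using r by (intro power_le_one) auto
    moreover have "1 \<le> 1 / r ^ (2 * (L - j))" using r \<open>r ^ (2 * (L - j)) \<le> 1\<close> by simp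
    ultimately show ?thesis unfolding e_def w by linarith
  next
    case False
    then have "nat \<bar>int L - int j\<bar> = j - L" by simp
    then have w: "shift_weight r (int L - int j) = r ^ (2 * (j - L))" unfolding shift_weight_def by (simp only:)
    have "2 * j = 2 * (j - L) + 2 * L" using False by simp
    then have "r ^ (2 * j) = r ^ (2 * (j - L)) * r ^ (2 * L)" by (metis power_add)
    then show ?thesis using r by (simp add: e_def w power_one_over)
  qed
  have eL: "e (L - 1) = 1 / r\<^sup>2 - r\<^sup>2"
  proof -
    obtain l where l: "L = Suc l" using L by (cases L) auto
    show ?thesis using r by (simp add: e_def l shift_weight_def power_one_over power2_eq_square)
  qed
  have "((1 / r) ^ L * m)\<^sup>2 \<le> (\<Sum>j\<le>degree h. (cmod (coeff h j))\<^sup>2 * (1 / r) ^ (2 * j))"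
    using r m by (intro Parseval_lower_bound) auto
  then have "r ^ (2 * L) * ((1 / r) ^ L * m)\<^sup>2 \<le> r ^ (2 * L) * (\<Sum>j\<le>degree h. (cmod (coeff h j))\<^sup>2 * (1 / r) ^ (2 * j))"
    using r by (intro mult_left_mono) auto
  moreover have "r ^ (2 * L) * ((1 / r) ^ L * m)\<^sup>2 = m\<^sup>2"
  proof -
    have "r ^ L * ((1 / r) ^ L * m) = m" using r by (simp add: power_one_over)
    then show ?thesis by (metis power_even_eq power_mult_distrib)
  qed
  ultimately have 1: "m\<^sup>2 \<le> r ^ (2 * L) * (\<Sum>j\<le>degree h. (cmod (coeff h j))\<^sup>2 * (1 / r) ^ (2 * j))" by simp
  have "dual_sqnorm L h - r ^ (2 * L) * (\<Sum>j\<le>degree h. (cmod (coeff h j))\<^sup>2 * (1 / r) ^ (2 * j))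
      = (\<Sum>j\<le>degree h. (cmod (coeff h j))\<^sup>2 * e j)"
    unfolding dual_sqnorm_def e_def sum_distrib_left sum_subtractf[symmetric]
    by (intro sum.cong refl) (simp add: algebra_simps)
  moreover have "(cmod c)\<^sup>2 * (1 / r\<^sup>2 - r\<^sup>2) \<le> (\<Sum>j\<le>degree h. (cmod (coeff h j))\<^sup>2 * e j)"
  proof (cases "c = 0")
    case True
    then show ?thesis using e by (simp add: sum_nonneg)
  next
    case False
    then have "L - 1 \<in> {..degree h}" using c le_degree by auto
    then have "(cmod (coeff h (L - 1)))\<^sup>2 * e (L - 1) \<le> (\<Sum>j\<le>degree h. (cmod (coeff h j))\<^sup>2 * e j)"
      using e by (intro member_le_sum) auto
    then show ?thesis by (simp only: c eL)
  qed
  ultimately show ?thesis using 1 by linarith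
qed

text \<open>h / z^L is the Laurent expansion of P / (z - w) outside |w|, cut off after z^-L. Writing
  P = P(w) + (z - w) G, the part z^L G starts in degree L, so coefficient L - 1 comes only from (z^L
  - w^L) / (z - w) and is the residue.\<close>

lemma truncated_quotient:
  fixes P :: "complex poly"
  assumes L: "L \<ge> 1"
  obtains h where "[:- w, 1:] * h + [:poly P w * w ^ L:] = monom 1 L * P" "coeff h (L - 1) = poly P w"
proof -
  have "poly (P - [:poly P w:]) w = 0" by simp
  then obtain G where G: "P - [:poly P w:] = [:- w, 1:] * G" using poly_eq_0_iff_dvd by blast
  define Z where "Z = (\<Sum>k<L. monom (w ^ k) (L - Suc k))"
  define h where "h = monom 1 L * G + Polynomial.smult (poly P w) Z"
  have Z: "[:- w, 1:] * Z = monom 1 L - [:w ^ L:]"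
  proof (rule iffD1[OF poly_eq_poly_eq_iff], rule ext)
    fix z
    show "poly ([:- w, 1:] * Z) z = poly (monom 1 L - [:w ^ L:]) z"
      using power_diff_sumr2[of w L z] by (simp add: Z_def poly_sum poly_monom algebra_simps)
  qed
  have "[:- w, 1:] * h = monom 1 L * ([:- w, 1:] * G) + Polynomial.smult (poly P w) ([:- w, 1:] * Z)"
    by (simp only: h_def distrib_left mult_smult_right mult.left_commute)
  also have "\<dots> = monom 1 L * P - [:poly P w * w ^ L:]"
  proof -
    have "monom 1 L * [:poly P w:] = Polynomial.smult (poly P w) (monom 1 L)" by (simp add: smult_monom)
    then show ?thesis unfolding Z G[symmetric] right_diff_distrib smult_diff_right by simp
  qed
  finally have 1: "[:- w, 1:] * h + [:poly P w * w ^ L:] = monom 1 L * P" by simp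
  have "coeff Z (L - 1) = (\<Sum>k<L. if k = 0 then 1 else 0)"
    unfolding Z_def coeff_sum using L by (intro sum.cong) auto
  also have "\<dots> = 1" using L by simp
  finally have "coeff h (L - 1) = poly P w" using L by (simp add: h_def coeff_monom_mult)
  with 1 show ?thesis by (rule that)
qed

text \<open>Two bounds for \<open>D\<close>, the squared dual norm of the truncation of f = P / (z -
  w), collide: if \<open>X\<close> were spectral, D would be at most (1 + 2 \<epsilon>)^2, while the
  residue pushes it above (1 - 2 \<epsilon>)^2 by a fixed amount.\<close>

theorem shift_not_spectral_set:
  assumes w: "cmod w < r" "w \<notin> X" and X: "closed X" "X \<subseteq> {z. cmod z \<le> 1 / r}" "X \<noteq> {}"
  shows "\<not> spectral_set X L2 shift"
proof
  assume spec: "spectral_set X L2 shift"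
  define R where "R = 1 / r"
  define q where "q = [:- w, 1:]"
  have "1 < R" using r by (simp add: R_def)
  then have R: "R > 1" "r < R" "R > 0" using r by linarith+
  have wR: "cmod w < R" using w R by simp
  have q: "q \<noteq> 0" "poly q z = z - w" for z by (auto simp: q_def)
  \<comment> \<open>The assumed inclusion of the spectrum in \<open>X\<close> keeps \<open>w\<close>
    out of it, so the spectrum need not be computed.\<close>
  have inv: "invertible_operator L2 (poly_op L2 q shift)"
    by (rule H.invertible_poly_op[OF bounded_shift q(1)]) (use spec w q in \<open>auto simp: spectral_set_def\<close>)
  obtain K where K: "K \<ge> 0" "\<And>v. v \<in> carrier L2 \<Longrightarrow> vnorm L2 (op_inv L2 (poly_op L2 q shift) v) \<le> K * vnorm L2 v"
    using H.bounded_operator_bound[OF H.op_inv_bounded[OF inv]] by blast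
  obtain \<kappa> where \<kappa>: "\<kappa> > 0"
    and approx: "\<And>\<epsilon>. 0 < \<epsilon> \<Longrightarrow> \<exists>P. (\<forall>z\<in>X. cmod (poly P z) \<le> (1 + \<epsilon>) * cmod (z - w)) \<and>
       (\<forall>z. cmod z = R \<longrightarrow> (1 - \<epsilon>) * cmod (z - w) \<le> cmod (poly P z)) \<and> (1 - \<epsilon>) * \<kappa> \<le> cmod (poly P w)"
    using almost_inner_function[OF wR w(2) X(1)] X(2) unfolding R_def by blast
  define \<delta> where "\<delta> = 1 / r\<^sup>2 - r\<^sup>2"
  have r2: "r\<^sup>2 < 1" "r\<^sup>2 > 0" using r by (auto simp: abs_square_less_1)
  then have "1 < 1 / r\<^sup>2" by simp
  then have \<delta>: "\<delta> > 0" using r2 unfolding \<delta>_def by linarith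
  \<comment> \<open>The estimates end in
    \<open>\<kappa>\<^sup>2 / 2 * \<delta> \<le> 8 * \<epsilon>\<close>, which the second bound
    refutes; the first keeps \<open>1 - \<epsilon>\<close> at least 3/4 when \<open>c\<close> is
    estimated.\<close>
  define \<epsilon> where "\<epsilon> = min (1 / 4) (\<kappa>\<^sup>2 * \<delta> / 64)"
  have e: "0 < \<epsilon>" "\<epsilon> \<le> 1 / 4" "\<epsilon> \<le> \<kappa>\<^sup>2 * \<delta> / 64" using \<kappa> \<delta> by (auto simp: \<epsilon>_def)
  obtain P where P_X: "\<And>z. z \<in> X \<Longrightarrow> cmod (poly P z) \<le> (1 + \<epsilon>) * cmod (z - w)"
    and P_R: "\<And>z. cmod z = R \<Longrightarrow> (1 - \<epsilon>) * cmod (z - w) \<le> cmod (poly P z)"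
    and P_w: "(1 - \<epsilon>) * \<kappa> \<le> cmod (poly P w)"
    using approx[OF e(1)] by blast
  define c where "c = poly P w"
  \<comment> \<open>\<open>L\<close> has to make the error c w^L / (z - w) small against R^L on the
    circle (\<open>lim1\<close>) and, after the loss r^-L at coordinate L, small at the operator
    (\<open>lim2\<close>).\<close>
  have lim1: "(\<lambda>L. cmod c * (cmod w / R) ^ L) \<longlonglongrightarrow> cmod c * 0"
    using wR R by (intro tendsto_intros LIMSEQ_power_zero) (auto simp: norm_divide)
  have lim2: "(\<lambda>L. cmod c * K * (cmod w / r) ^ L) \<longlonglongrightarrow> cmod c * K * 0"
    using w r by (intro tendsto_intros LIMSEQ_power_zero) (auto simp: norm_divide)
  have "\<forall>\<^sub>F L in sequentially. cmod c * (cmod w / R) ^ L < \<epsilon> * (R - cmod w)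
      \<and> cmod c * K * (cmod w / r) ^ L < \<epsilon> \<and> L \<ge> 1"
    using e wR by (intro eventually_conj order_tendstoD(2)[OF lim1] order_tendstoD(2)[OF lim2] eventually_ge_at_top) auto
  then obtain L where "\<forall>l\<ge>L. cmod c * (cmod w / R) ^ l < \<epsilon> * (R - cmod w)
      \<and> cmod c * K * (cmod w / r) ^ l < \<epsilon> \<and> l \<ge> 1"
    unfolding eventually_sequentially by blast
  then have L1: "cmod c * (cmod w / R) ^ L < \<epsilon> * (R - cmod w)"
    and L2': "cmod c * K * (cmod w / r) ^ L < \<epsilon>" and L: "L \<ge> 1"
    by auto
  obtain h where h: "q * h + [:c * w ^ L:] = monom 1 L * P" and hc: "coeff h (L - 1) = c"
    using truncated_quotient[OF L, of w P] unfolding q_def c_def by blast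
  have "(1 / r) ^ L * (1 - 2 * \<epsilon>) \<le> cmod (poly h z)" if "cmod z = 1 / r" for z
  proof -
    have z: "cmod z = R" using that by (simp add: R_def)
    have zw: "R - cmod w \<le> cmod (z - w)" using z norm_triangle_ineq2[of z w] by simp
    have pos: "cmod (z - w) > 0" using zw wR by linarith
    have "poly (q * h + [:c * w ^ L:]) z = poly (monom 1 L * P) z" by (simp only: h)
    then have eq: "z ^ L * poly P z = (z - w) * poly h z + c * w ^ L" by (simp add: q poly_monom)
    have "cmod (c * w ^ L) = R ^ L * (cmod c * (cmod w / R) ^ L)"
      using R by (simp add: norm_mult norm_power power_divide)
    also have "\<dots> \<le> R ^ L * (\<epsilon> * (R - cmod w))" using L1 R by (intro mult_left_mono) auto
    also have "\<dots> \<le> R ^ L * (\<epsilon> * cmod (z - w))" using zw e R by (intro mult_left_mono) auto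
    finally have small: "cmod (c * w ^ L) \<le> R ^ L * (\<epsilon> * cmod (z - w))" .
    have "R ^ L * ((1 - \<epsilon>) * cmod (z - w)) \<le> R ^ L * cmod (poly P z)"
      using P_R[OF z] R by (intro mult_left_mono) auto
    also have "\<dots> = cmod (z ^ L * poly P z)" by (simp add: norm_mult norm_power z)
    also have "\<dots> \<le> cmod ((z - w) * poly h z) + cmod (c * w ^ L)" unfolding eq by (rule norm_triangle_ineq)
    finally have "R ^ L * ((1 - \<epsilon>) * cmod (z - w)) \<le> cmod (z - w) * cmod (poly h z) + R ^ L * (\<epsilon> * cmod (z - w))"
      using small by (simp add: norm_mult)
    then have "cmod (z - w) * (R ^ L * (1 - 2 * \<epsilon>)) \<le> cmod (z - w) * cmod (poly h z)"
      by (simp add: algebra_simps)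
    then show ?thesis using pos by (simp add: R_def)
  qed
  then have lower: "(1 - 2 * \<epsilon>)\<^sup>2 + (cmod c)\<^sup>2 * \<delta> \<le> dual_sqnorm L h"
    unfolding \<delta>_def using e by (intro dual_sqnorm_ge[OF L hc]) auto

  define v where "v = \<iota> (dual_vector L h)"
  define y where "y = op_inv L2 (poly_op L2 q shift) v"
  define D where "D = dual_sqnorm L h"
  have v: "v \<in> carrier L2" by (simp add: v_def dual_vector_sqnorm)
  have v_norm: "vnorm L2 v = sqrt D" by (simp add: v_def D_def vnorm_L2 dual_vector_sqnorm)
  have y: "y \<in> carrier L2" unfolding y_def by (rule H.bounded_operator_closed[OF H.op_inv_bounded[OF inv] v])
  have qy: "poly_op L2 q shift y = v" unfolding y_def by (rule H.op_inv_right[OF inv v])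
  have y_norm: "vnorm L2 y \<le> K * sqrt D" using K(2)[OF v] by (simp add: y_def v_norm)
  note cl = H.poly_op_closed[OF bounded_shift]

  have "(P, q) \<in> Rat X" using w q by (auto simp: Rat_def)
  then have "op_norm L2 (rat_op L2 (P, q) shift) \<le> (SUP z\<in>X. cmod (rat_eval (P, q) z))"
    using spec unfolding spectral_set_def by blast
  also have "\<dots> \<le> 1 + \<epsilon>"
  proof (rule cSUP_least[OF X(3)])
    fix z assume z: "z \<in> X"
    then have "cmod (z - w) > 0" using w by auto
    then show "cmod (rat_eval (P, q) z) \<le> 1 + \<epsilon>"
      using P_X[OF z] by (simp add: rat_eval_def q norm_divide field_simps)
  qed
  finally have op: "op_norm L2 (rat_op L2 (P, q) shift) \<le> 1 + \<epsilon>" .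
  have rat: "rat_op L2 (P, q) shift = (\<lambda>x. poly_op L2 P shift (op_inv L2 (poly_op L2 q shift) x))"
    by (simp add: rat_op_def fun_eq_iff)
  have "bounded_operator L2 (rat_op L2 (P, q) shift)"
    unfolding rat by (rule H.bounded_operator_comp[OF H.bounded_operator_poly_op[OF bounded_shift] H.op_inv_bounded[OF inv]])
  from H.vnorm_le_op_norm[OF this v]
  have "vnorm L2 (poly_op L2 P shift y) \<le> op_norm L2 (rat_op L2 (P, q) shift) * sqrt D"
    by (simp add: rat y_def v_norm)
  also have "\<dots> \<le> (1 + \<epsilon>) * sqrt D"
    using op v_norm H.vnorm_nonneg[OF v] by (intro mult_right_mono) auto
  finally have Py: "vnorm L2 (poly_op L2 P shift y) \<le> (1 + \<epsilon>) * sqrt D" .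

  \<comment> \<open>The same vector is computed twice. As T^L P(T) y, with P(T) y = f(T) v, its
    coordinate L is the coordinate of weight 1 of f(T) v; through h it is \<open>D\<close> plus the
    truncation error.\<close>
  have "coord (poly_op L2 (monom 1 L * P) shift y) (int L) = coord (poly_op L2 P shift y) 0"
  proof -
    have "coord (poly_op L2 (monom 1 L * P) shift y) (int L)
        = (\<Sum>j\<le>L. coeff (monom 1 L) j * coord (poly_op L2 P shift y) (int L - int j))"
      by (simp add: H.poly_op_mult[OF bounded_shift y] coord_poly_op[OF cl[OF y]] degree_monom_eq)
    also have "\<dots> = (\<Sum>j\<le>L. if j = L then coord (poly_op L2 P shift y) 0 else 0)"
      by (intro sum.cong refl) simp
    finally show ?thesis by simp
  qed
  moreover have "coord (poly_op L2 (q * h + [:c * w ^ L:]) shift y) (int L) = of_real D + c * w ^ L * coord y (int L)"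
  proof -
    have "poly_op L2 (q * h) shift y = poly_op L2 h shift v"
      using H.poly_op_mult[OF bounded_shift y, of h q] by (simp add: mult.commute qy)
    moreover have "coord (poly_op L2 [:c * w ^ L:] shift y) (int L) = c * w ^ L * coord y (int L)"
      by (simp add: coord_poly_op[OF y])
    ultimately show ?thesis
      using coord_poly_op_dual_vector[of h L]
      by (simp add: H.poly_op_add[OF bounded_shift y] L2_simps v_def D_def)
  qed
  ultimately have eq: "of_real D = coord (poly_op L2 P shift y) 0 - c * w ^ L * coord y (int L)"
    by (simp add: h)
  have D0: "D > 0"
  proof -
    have "0 < (1 - 2 * \<epsilon>)\<^sup>2" using e by simp
    moreover have "0 \<le> (cmod c)\<^sup>2 * \<delta>" using \<delta> by simp
    ultimately show ?thesis using lower unfolding D_def by linarith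
  qed
  have "cmod (c * w ^ L * coord y (int L)) = cmod c * (cmod w / r) ^ L * (r ^ L * cmod (coord y (int L)))"
    using r by (simp add: norm_mult norm_power power_divide)
  also have "\<dots> \<le> cmod c * (cmod w / r) ^ L * (K * sqrt D)"
    using order_trans[OF coord_nat_le[OF y] y_norm] r by (intro mult_left_mono) auto
  also have "\<dots> = (cmod c * K * (cmod w / r) ^ L) * sqrt D" by simp
  also have "\<dots> \<le> \<epsilon> * sqrt D" using L2' D0 by (intro mult_right_mono) auto
  finally have small: "cmod (c * w ^ L * coord y (int L)) \<le> \<epsilon> * sqrt D" .
  have "D = cmod (of_real D)" using D0 by simp
  also have "\<dots> \<le> cmod (coord (poly_op L2 P shift y) 0) + cmod (c * w ^ L * coord y (int L))"
    unfolding eq by (rule norm_triangle_ineq4)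
  also have "\<dots> \<le> (1 + \<epsilon>) * sqrt D + \<epsilon> * sqrt D"
    by (rule add_mono[OF order_trans[OF coord_zero_le[OF cl[OF y]] Py] small])
  also have "\<dots> = (1 + 2 * \<epsilon>) * sqrt D" by (simp add: algebra_simps)
  \<comment> \<open>The functional takes the value \<open>D\<close> at \<open>v\<close>, a vector of
    norm \<open>sqrt D\<close>; cancelling leaves a bound for its norm.\<close>
  finally have "sqrt D * sqrt D \<le> (1 + 2 * \<epsilon>) * sqrt D" using D0 by simp
  then have "sqrt D \<le> 1 + 2 * \<epsilon>" by (rule mult_right_le_imp_le) (use D0 in simp)
  then have "(sqrt D)\<^sup>2 \<le> (1 + 2 * \<epsilon>)\<^sup>2" using D0 by (intro power_mono) auto
  then have "D \<le> (1 + 2 * \<epsilon>)\<^sup>2" using D0 by simp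
  moreover have "\<kappa>\<^sup>2 / 2 * \<delta> \<le> (cmod c)\<^sup>2 * \<delta>"
  proof (rule mult_right_mono)
    have "(3 / 4 * \<kappa>)\<^sup>2 \<le> (cmod c)\<^sup>2"
    proof (rule power_mono)
      have "3 / 4 * \<kappa> \<le> (1 - \<epsilon>) * \<kappa>" using e \<kappa> by (intro mult_right_mono) auto
      then show "3 / 4 * \<kappa> \<le> cmod c" using P_w by (simp add: c_def)
    qed (use \<kappa> in simp)
    moreover have "(3 / 4 * \<kappa>)\<^sup>2 = 9 / 16 * \<kappa>\<^sup>2" by (simp add: power_mult_distrib power_divide)
    ultimately show "\<kappa>\<^sup>2 / 2 \<le> (cmod c)\<^sup>2" using zero_le_power2[of \<kappa>] by linarith
  qed (use \<delta> in simp)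
  ultimately have "(1 - 2 * \<epsilon>)\<^sup>2 + \<kappa>\<^sup>2 / 2 * \<delta> \<le> (1 + 2 * \<epsilon>)\<^sup>2"
    using lower unfolding D_def by linarith
  then have "\<kappa>\<^sup>2 / 2 * \<delta> \<le> 8 * \<epsilon>" by (simp add: power2_eq_square algebra_simps)
  moreover have "\<kappa>\<^sup>2 * \<delta> > 0" using \<kappa> \<delta> by simp
  ultimately show False using e(3) by simp
qed

text \<open>The spectrum forces the open annulus into \<open>X\<close>, and closedness forces its
  closure, so an omitted point of the disc has modulus below r.\<close>

lemma proper_subset_not_spectral_set:
  assumes X: "compact X" "X \<subset> {z. cmod z \<le> 1 / r}"
  shows "\<not> spectral_set X L2 shift"
proof
  assume spec: "spectral_set X L2 shift"
  have annulus: "z \<in> X" if "r < cmod z" "cmod z < 1 / r" for z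
    using annulus_subset_spectrum[OF that] spec by (auto simp: spectral_set_def)
  have r1: "1 < 1 / r" using r by simp
  obtain w where w: "cmod w \<le> 1 / r" "w \<notin> X" using X(2) by blast
  show False
  proof (cases "cmod w < r")
    case True
    have "X \<noteq> {}" using annulus[of 1] r r1 by auto
    then show False
      using shift_not_spectral_set[OF True w(2) compact_imp_closed[OF X(1)]] X(2) spec by blast
  next
    case False
    define m where "m = cmod w"
    have m: "r \<le> m" "m \<le> 1 / r" "m > 0" using False w r by (auto simp: m_def)
    have "open (- X)" using X(1) by (simp add: compact_imp_closed open_Compl)
    then obtain d where d: "d > 0" "ball w d \<subseteq> - X" using w(2) open_contains_ball by blast
    \<comment> \<open>Moving \<open>w\<close> radially by the fraction \<open>t\<close> towards the
      unit circle enters the open annulus, as r < 1 < 1 / r. The displacement is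
      \<open>t * \<bar>1 - m\<bar>\<close>, which must stay below \<open>d\<close>; the added 1
      covers m = 1.\<close>
    define t where "t = min 1 (d / (2 * (\<bar>1 - m\<bar> + 1)))"
    have "0 < d / (2 * (\<bar>1 - m\<bar> + 1))" using d by (intro divide_pos_pos) (auto intro: add_nonneg_pos)
    then have t: "0 < t" "t \<le> 1" by (simp_all add: t_def)
    have td: "t * \<bar>1 - m\<bar> < d"
    proof -
      have "t * \<bar>1 - m\<bar> \<le> d / (2 * (\<bar>1 - m\<bar> + 1)) * (\<bar>1 - m\<bar> + 1)"
        using t d by (intro mult_mono) (auto simp: t_def)
      also have "\<dots> = d / 2" by (simp add: field_simps add_nonneg_eq_0_iff)
      finally show ?thesis using d by simp
    qed
    define m' where "m' = m + t * (1 - m)"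
    have m': "r < m'" "m' < 1 / r"
    proof -
      have "t * r < t * 1" using t r by (intro mult_strict_left_mono) auto
      moreover have "(1 - t) * r \<le> (1 - t) * m" using t m by (intro mult_left_mono) auto
      ultimately show "r < m'" by (simp add: m'_def algebra_simps)
      have "t * 1 < t * (1 / r)" using t r1 by (intro mult_strict_left_mono) auto
      moreover have "(1 - t) * m \<le> (1 - t) * (1 / r)" using t m by (intro mult_left_mono) auto
      ultimately show "m' < 1 / r"
        unfolding m'_def left_diff_distrib right_diff_distrib by linarith
    qed
    define z where "z = of_real (m' / m) * w"
    have "cmod z = m'" using m m' r by (simp add: z_def norm_mult norm_divide flip: m_def)
    then have "z \<in> X" using annulus m' by simp
    have "z - w = of_real (t * (1 - m) / m) * w"
      using m by (simp add: z_def m'_def field_simps)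
    then have "cmod (z - w) = \<bar>t * (1 - m) / m\<bar> * m" by (simp only: norm_mult norm_of_real m_def)
    then have "cmod (z - w) = t * \<bar>1 - m\<bar>" using m t by (simp add: abs_mult)
    then have "z \<in> ball w d" using td by (simp add: dist_norm norm_minus_commute)
    then show False using d \<open>z \<in> X\<close> by blast
  qed
qed

end

section \<open>The disc and the two classes\<close>

lemma PA_spectral_set:
  assumes "0 < r" "r < 1" "(H, T) \<in> PA r"
  shows "spectral_set {z. cmod z \<le> 1 / r} H T"
proof -
  interpret hilbert_space H
    using assms(3) by (intro hilbert_space.intro) (simp add: PA_def)
  have T: "invertible_operator H T" using assms(3) by (simp add: PA_def)
  show ?thesis
  proof (rule spectral_set_cball[OF invertible_operator_bounded[OF T]])
    fix x assume "x \<in> carrier H"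
    then show "vnorm H (T x) \<le> 1 / r * vnorm H x"
    proof (rule PA_imp_contraction[OF T, rotated 2])
      fix x assume "x \<in> carrier H"
      then show "(vnorm H (T x))\<^sup>2 + (vnorm H (op_inv H T x))\<^sup>2 \<le> ((1 / r)\<^sup>2 + 1 / (1 / r)\<^sup>2) * (vnorm H x)\<^sup>2"
        using positive_operator_PA_iff[OF T, of "r\<^sup>2 + 1 / r\<^sup>2"] assms(3)
        by (simp add: PA_def power_divide add.commute)
    qed (use assms in simp)
  qed (use assms in simp)
qed

lemma QA_spectral_set:
  assumes "0 < r" "(H, T) \<in> QA r"
  shows "spectral_set {z. cmod z \<le> 1 / r} H T"
proof -
  interpret hilbert_space H
    using assms(2) by (intro hilbert_space.intro) (simp add: QA_def)
  have T: "bounded_operator H T" and norm: "op_norm H T \<le> 1 / r"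
    using assms(2) by (auto simp: QA_def invertible_operator_bounded)
  show ?thesis
  proof (rule spectral_set_cball[OF T])
    fix x assume x: "x \<in> carrier H"
    show "vnorm H (T x) \<le> 1 / r * vnorm H x"
      using vnorm_le_op_norm[OF T x] mult_right_mono[OF norm vnorm_nonneg[OF x]] by linarith
  qed (use assms in simp)
qed

theorem proposition6p4:
  fixes r :: real
  assumes "0 < r" and "r < 1"
    and universe: "(UNIV :: real set) \<lesssim> (UNIV :: 'a set)"
  shows "minimal_spectral_set {z :: complex. cmod z \<le> 1 / r}
           (PA r :: ('a hilbert \<times> ('a \<Rightarrow> 'a)) set)
       \<and> minimal_spectral_set {z :: complex. cmod z \<le> 1 / r}
           (QA r :: ('a hilbert \<times> ('a \<Rightarrow> 'a)) set)"
proof -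
  obtain \<iota> :: "(int \<Rightarrow> complex) \<Rightarrow> 'a" where "inj \<iota>"
    using lepoll_trans[OF lepoll_int_complex_fun universe] unfolding lepoll_def by blast
  with assms interpret bilateral_shift r \<iota> by unfold_locales
  have "{z :: complex. cmod z \<le> 1 / r} = cball 0 (1 / r)" by auto
  then have "compact {z :: complex. cmod z \<le> 1 / r}" by simp
  \<comment> \<open>The single operator \<open>shift\<close> lies in both classes and excludes every
    smaller compact set at once.\<close>
  then show ?thesis
    unfolding minimal_spectral_set_def
    using PA_spectral_set[OF assms(1,2)] QA_spectral_set[OF assms(1)] shift_in_PA shift_in_QA
      proper_subset_not_spectral_set
    by blast
qed

end
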